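(* Let $G=(V,E)$ be a maximal outerplanar graph of order $n\ge 3$. Then there exists a resolving set $S\subset V$ of $G$ such that $|S|=\lceil \frac{2n}{5}\rceil$. Moreover, such a set $S$ can be computed in time linear in $n$.
   Context: Graphs are finite, simple and connected; $d(u,v)$ is the length of a shortest path between $u$ and $v$. A vertex $x$ resolves a pair of vertices $u,v$ if $d(u,x)\neq d(v,x)$. A set $S\subseteq V(G)$ is a resolving set of $G$ if every pair of distinct vertices of $G$ is resolved by some vertex of $S$. A graph is outerplanar if it can be drawn in the plane without crossings with all vertices on the unbounded face; a maximal outerplanar graph (MOP graph) is an outerplanar graph such that the addition of any edge produces a non-outerplanar graph. A MOP graph of order $n\ge 3$ is the same as a triangulation of a convex $n$-gon (the graph is given with this plane embedding). *)

theory Defs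
  imports "HOL-Analysis.Analysis"
begin

section \<open>Graphs, distance, resolving sets\<close>

definition simple_graph :: "'a set \<Rightarrow> 'a set set \<Rightarrow> bool" where
  "simple_graph V E \<longleftrightarrow> finite V \<and> (\<forall>e\<in>E. e \<subseteq> V \<and> card e = 2)"

definition path_between :: "'a set \<Rightarrow> 'a set set \<Rightarrow> 'a \<Rightarrow> 'a list \<Rightarrow> 'a \<Rightarrow> bool" where
  "path_between V E u p v \<longleftrightarrow>
     p \<noteq> [] \<and> hd p = u \<and> last p = v \<and> set p \<subseteq> V \<and> distinct p \<and>
     successively (\<lambda>x y. {x, y} \<in> E) p"

definition connected_graph :: "'a set \<Rightarrow> 'a set set \<Rightarrow> bool" where
  "connected_graph V E \<longleftrightarrow>
     simple_graph V E \<and> V \<noteq> {} \<and> (\<forall>u\<in>V. \<forall>v\<in>V. \<exists>p. path_between V E u p v)"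

text \<open>The length of a path is its number of edges, one less than its number of vertices.
  Only used for vertices of a connected graph.\<close>

definition gdist :: "'a set \<Rightarrow> 'a set set \<Rightarrow> 'a \<Rightarrow> 'a \<Rightarrow> nat" where
  "gdist V E u v = (LEAST k. \<exists>p. path_between V E u p v \<and> length p = k + 1)"

definition resolves :: "'a set \<Rightarrow> 'a set set \<Rightarrow> 'a \<Rightarrow> 'a \<Rightarrow> 'a \<Rightarrow> bool" where
  "resolves V E x u v \<longleftrightarrow> gdist V E u x \<noteq> gdist V E v x"

definition resolving_set :: "'a set \<Rightarrow> 'a set set \<Rightarrow> 'a set \<Rightarrow> bool" where
  "resolving_set V E S \<longleftrightarrow>
     S \<subseteq> V \<and> (\<forall>u\<in>V. \<forall>v\<in>V. u \<noteq> v \<longrightarrow> (\<exists>x\<in>S. resolves V E x u v))"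


section \<open>Maximal outerplanar graphs\<close>

text \<open>Vertices are drawn as points and edges as arbitrary simple arcs in the plane; distinct arcs
  may meet only at the image of a common endpoint, and an arc passes through no vertex other than
  its two endpoints.\<close>

definition plane_drawing ::
  "'a set \<Rightarrow> 'a set set \<Rightarrow> ('a \<Rightarrow> complex) \<Rightarrow> ('a set \<Rightarrow> real \<Rightarrow> complex) \<Rightarrow> bool" where
  "plane_drawing V E pos crv \<longleftrightarrow>
     inj_on pos V \<and>
     (\<forall>e\<in>E. arc (crv e) \<and> {pathstart (crv e), pathfinish (crv e)} = pos ` e \<and>
        path_image (crv e) \<inter> pos ` V = pos ` e) \<and>
     (\<forall>e\<in>E. \<forall>f\<in>E. e \<noteq> f \<longrightarrow> path_image (crv e) \<inter> path_image (crv f) \<subseteq> pos ` (e \<inter> f))"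

definition drawing_points ::
  "'a set \<Rightarrow> 'a set set \<Rightarrow> ('a \<Rightarrow> complex) \<Rightarrow> ('a set \<Rightarrow> real \<Rightarrow> complex) \<Rightarrow> complex set" where
  "drawing_points V E pos crv = pos ` V \<union> (\<Union>e\<in>E. path_image (crv e))"

text \<open>For a compact set of points in the plane, \<open>outside\<close> is the unbounded component of the
  complement, that is, the unbounded face.\<close>

definition outerplanar :: "'a set \<Rightarrow> 'a set set \<Rightarrow> bool" where
  "outerplanar V E \<longleftrightarrow>
     (\<exists>pos crv. plane_drawing V E pos crv \<and>
        (\<forall>v\<in>V. pos v \<in> frontier (outside (drawing_points V E pos crv))))"

definition maximal_outerplanar :: "'a set \<Rightarrow> 'a set set \<Rightarrow> bool" where
  "maximal_outerplanar V E \<longleftrightarrow>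
     connected_graph V E \<and> outerplanar V E \<and>
     (\<forall>u\<in>V. \<forall>v\<in>V. u \<noteq> v \<and> {u, v} \<notin> E \<longrightarrow> \<not> outerplanar V (insert {u, v} E))"


section \<open>Embedded graphs as input data\<close>

text \<open>The vertices \<open>{..<n}\<close> are placed at the corners \<open>0, \<dots>, n - 1\<close> of a convex \<open>n\<close>-gon, corners
  being numbered in cyclic order along the boundary, with vertex \<open>h i\<close> at corner \<open>i\<close>; no two
  edges, drawn as straight segments, cross. If the graph is maximal outerplanar, this is a
  triangulation of the polygon: its sides are then necessarily edges.\<close>

definition convex_embedding :: "nat \<Rightarrow> nat set set \<Rightarrow> (nat \<Rightarrow> nat) \<Rightarrow> bool" where
  "convex_embedding n E h \<longleftrightarrow>
     bij_betw h {..<n} {..<n} \<and>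
     (\<forall>i k j l. i < k \<and> k < j \<and> j < l \<and> l < n \<longrightarrow> \<not> ({h i, h j} \<in> E \<and> {h k, h l} \<in> E))"

text \<open>The embedding is given by its rotation system: entry \<open>v\<close> of \<open>adj\<close> lists the neighbours of
  \<open>v\<close> in the order in which they occur around \<open>v\<close>, starting at the unbounded face. The labelling
  of the vertices by \<open>0, \<dots>, n - 1\<close> is arbitrary, in particular unrelated to their boundary
  order.\<close>

definition rotation_system :: "nat \<Rightarrow> nat set set \<Rightarrow> nat list list \<Rightarrow> bool" where
  "rotation_system n E adj \<longleftrightarrow>
     length adj = n \<and>
     (\<exists>h. convex_embedding n E h \<and>
        (\<forall>i<n. adj ! h i =
           map (\<lambda>k. h ((i + k) mod n)) (filter (\<lambda>k. {h i, h ((i + k) mod n)} \<in> E) [1..<n])))"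

text \<open>Memory layout: cell \<open>0\<close> holds \<open>n\<close>, and the list of neighbours of \<open>v\<close> occupies the cells from
  the address stored in cell \<open>1 + v\<close> up to, but not including, the address stored in cell
  \<open>2 + v\<close>.\<close>

definition encode_adj :: "nat list list \<Rightarrow> nat list" where
  "encode_adj adj =
     length adj #
     map (\<lambda>v. length adj + 2 + length (concat (take v adj))) [0..<length adj + 1] @
     concat adj"


section \<open>Linear time on a random access machine\<close>

text \<open>A program is a fixed term over finitely many registers and a random access memory. Each
  elementary instruction and each evaluation of a test costs one unit of time. The semantics is
  parametrised by the largest number \<open>W\<close> that fits into a machine word: an execution that would
  produce a larger number is stuck. Taking \<open>W = C * n\<close> for a constant \<open>C\<close> gives words of
  \<open>log n + O(1)\<close> bits. Subtraction is truncated at 0.\<close>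

datatype cmd =
    Skip
  | Put nat nat              \<comment> \<open>register := constant\<close>
  | Add nat nat nat          \<comment> \<open>register := register + register\<close>
  | Sub nat nat nat          \<comment> \<open>register := register - register\<close>
  | Load nat nat             \<comment> \<open>register := memory[register]\<close>
  | Store nat nat            \<comment> \<open>memory[register] := register\<close>
  | Seq cmd cmd
  | IfLess nat nat cmd cmd   \<comment> \<open>test: register < register\<close>
  | WhileLess nat nat cmd    \<comment> \<open>test: register < register\<close>

type_synonym state = "(nat \<Rightarrow> nat) \<times> (nat \<Rightarrow> nat)"

text \<open>\<open>exec W c s t s'\<close>: started in state \<open>s\<close> (registers, memory), \<open>c\<close> halts in state \<open>s'\<close> after
  exactly \<open>t\<close> units of time.\<close>

inductive exec :: "nat \<Rightarrow> cmd \<Rightarrow> state \<Rightarrow> nat \<Rightarrow> state \<Rightarrow> bool" for W :: nat where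
  Skip: "exec W Skip s 1 s"
| Put: "k \<le> W \<Longrightarrow> exec W (Put x k) (r, m) 1 (r(x := k), m)"
| Add: "r y + r z \<le> W \<Longrightarrow> exec W (Add x y z) (r, m) 1 (r(x := r y + r z), m)"
| Sub: "exec W (Sub x y z) (r, m) 1 (r(x := r y - r z), m)"
| Load: "exec W (Load x a) (r, m) 1 (r(x := m (r a)), m)"
| Store: "exec W (Store a x) (r, m) 1 (r, m(r a := r x))"
| Seq: "exec W c1 s t1 s' \<Longrightarrow> exec W c2 s' t2 s'' \<Longrightarrow> exec W (Seq c1 c2) s (t1 + t2) s''"
| IfTrue: "r x < r y \<Longrightarrow> exec W c1 (r, m) t s' \<Longrightarrow> exec W (IfLess x y c1 c2) (r, m) (t + 1) s'"
| IfFalse: "\<not> r x < r y \<Longrightarrow> exec W c2 (r, m) t s' \<Longrightarrow> exec W (IfLess x y c1 c2) (r, m) (t + 1) s'"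
| WhileFalse: "\<not> r x < r y \<Longrightarrow> exec W (WhileLess x y c) (r, m) 1 (r, m)"
| WhileTrue: "r x < r y \<Longrightarrow> exec W c (r, m) t1 s' \<Longrightarrow> exec W (WhileLess x y c) s' t2 s'' \<Longrightarrow>
    exec W (WhileLess x y c) (r, m) (t1 + t2 + 1) s''"

definition initial_state :: "nat list \<Rightarrow> state" where
  "initial_state xs = ((\<lambda>_. 0), (\<lambda>i. if i < length xs then xs ! i else 0))"

text \<open>The result is the set of entries of a memory block whose start address and length are left in
  registers \<open>0\<close> and \<open>1\<close>.\<close>

definition output_set :: "state \<Rightarrow> nat set" where
  "output_set s = (\<lambda>i. snd s (fst s 0 + i)) ` {..<fst s 1}"

end

theory Submission
  imports Defs "HOL-Complex_Analysis.Winding_Numbers"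
begin

text \<open>
  Let the boundary vertices be \<open>0, \<dots>, n - 1\<close> in cyclic order, with an ear at vertex 2. Cut them into
  segments \<open>5 i, \<dots>, 5 i + 4\<close> and select from each its first vertex, the anchor, and one of the two
  middle vertices \<open>5 i + 2\<close>, \<open>5 i + 3\<close>; a remainder of 1 or 2 vertices contributes one more, a
  remainder of 3 or 4 contributes two more. Vertices of equal distance to all selected ones agree
  in particular on which selected vertices are at distance at most 1 and at most 2, and these data
  alone already separate all pairs, provided the middle vertices are chosen by \<open>flag\<close> and some
  anchors are moved one step back by \<open>shifted\<close>. As \<open>flag i\<close> depends only on the
  triangle at the side from \<open>5 i + 1\<close> to \<open>5 i + 2\<close>, a few adjacency tests and marks left by earlier
  segments, the selection can be made in one pass over the boundary, and its total cost is bounded by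
  the sum of the degrees.

  On the topological side, of three arcs with common end points one lies inside the loop formed by
  the other two, so its inner vertices are not on the unbounded face. Excluding such theta curves
  yields a circular order of the vertices without crossing edges, and conversely every crossing-free
  order gives a drawing with chords of a parabola; maximality then makes the graph a triangulated
  polygon.
\<close>

section \<open>Landmarks in a triangulated polygon\<close>

text \<open>Selecting two vertices in five leaves gaps of one or two vertices. When two vertices in
  gaps of two see the same landmarks at distances 1 and 2, the absence of crossings turns landmarks
  next to one of them into hubs, joined to three consecutive vertices around the other. A segment
  can escape such a hub by selecting its other middle vertex, but where hubs can occur depends on
  what the other segments select. \<open>good\<close> cuts this circle. It lists the anchors of
  later segments and both candidates of earlier ones, whichever was selected, so \<open>flag\<close>
  is no recursion; and since earlier and later segments are treated differently, of two segments
  that block each other one is told to give way. The order of the segments has to begin somewhere on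
  the cycle: a distant hub over vertex 2 would be adjacent to it, so an ear there frees the first
  segment from nearly all conflicts. What flags cannot cure is an anchor that is itself the hub of
  the two segments meeting at it; this is why anchors move.\<close>

locale triangulated_polygon =
  fixes n :: int and e :: "int \<Rightarrow> int \<Rightarrow> bool"
  assumes n3: "3 \<le> n"
    and periodic: "e (i + n) j = e i j"
    and sym: "e i j \<Longrightarrow> e j i"
    and irrefl: "\<not> e i i"
    and nocross: "\<lbrakk>i < k; k < j; j < l; l < i + n; e i j; e k l\<rbrakk> \<Longrightarrow> False"
    and maximal: "\<lbrakk>i < j; j < i + n; \<not> e i j\<rbrakk> \<Longrightarrow> \<exists>k l. i < k \<and> k < j \<and> j < l \<and> l < i + n \<and> e k l"
begin

lemma commute: "e i j = e j i"
  using sym by blast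

lemma periodic2: "e i (j + n) = e i j"
  using periodic[of j i] commute by metis

lemma periodic3: "e (n + i) j = e i j" "e i (n + j) = e i j"
  using periodic[of i j] periodic2[of i j] by (simp_all add: add.commute)

lemma periodic_minus: "e (i - n) j = e i j" "e i (j - n) = e i j"
  using periodic[of "i - n" j] periodic2[of i "j - n"] by auto

lemma periodic_mult: "e (i + n * c) j = e i j"
proof (induction c rule: int_induct[where k = 0])
  case (step1 c) then show ?case using periodic[of "i + n * c" j] by (simp add: algebra_simps)
next
  case (step2 c) then show ?case using periodic_minus(1)[of "i + n * c" j] by (simp add: algebra_simps)
qed simp

lemma mod1: "e (i mod n) j = e i j"
  using periodic_mult[of "i mod n" "i div n" j] by simp

lemma cong1: "i mod n = i' mod n \<Longrightarrow> e i j = e i' j"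
  by (metis mod1)

lemma side: "e i (i + 1)"
proof (rule ccontr)
  assume "\<not> e i (i + 1)"
  then show False using maximal[of i "i + 1"] n3 by auto
qed

lemma side': "e (i - 1) i" "e i (i - 1)" "e (i + 1) i" "j = i + 1 \<Longrightarrow> e i j" "i = j + 1 \<Longrightarrow> e i j"
  using side[of "i - 1"] side[of i] side[of j] commute[of i "i - 1"] commute[of i "i + 1"] commute[of j "j + 1"] by auto

lemma window: "\<exists>l'. w \<le> l' \<and> l' < w + n \<and> l' mod n = l mod n"
proof -
  have "w \<le> w + (l - w) mod n" "w + (l - w) mod n < w + n" using n3 by auto
  moreover have "(w + (l - w) mod n) mod n = l mod n" by (simp add: mod_simps)
  ultimately show ?thesis by blast
qed

lemma confined: "\<lbrakk>e i j; i < k; k < j; j < i + n; e k l; i \<le> l; l < i + n\<rbrakk> \<Longrightarrow> l \<le> j"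
  using nocross[of i k j l] by force

text \<open>An edge crossing the diagonal from \<open>i\<close> to \<open>k\<close> would also cross
  a side of the quadrilateral, unless it is the other diagonal.\<close>

lemma quad:
  assumes "i < j" "j < k" "k < l" "l < i + n" "e i j" "e j k" "e k l" "e i l"
  shows "e i k \<or> e j l"
proof (rule ccontr)
  assume a: "\<not> (e i k \<or> e j l)"
  then obtain x y where xy: "i < x" "x < k" "k < y" "y < i + n" "e x y"
    using maximal[of i k] assms by auto
  have "x = j"
    using nocross[of j x k y] nocross[of i x j y] xy assms by (cases x j rule: linorder_cases) auto
  moreover have "y = l"
    using nocross[of j k y l] nocross[of i j l y] xy assms \<open>x = j\<close> by (cases y l rule: linorder_cases) auto
  ultimately show False using a xy by auto
qed

text \<open>Reflection turns statements about right-hand neighbours into their left-hand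
  counterparts; \<open>gap1_left\<close>, \<open>left_left\<close> and one half of
  \<open>center\<close> are obtained in this way.\<close>

lemma reflected: "triangulated_polygon n (\<lambda>i j. e (- i) (- j))"
proof
  show "3 \<le> n" by (rule n3)
  show "e (- (i + n)) (- j) = e (- i) (- j)" for i j
    using periodic_minus(1)[of "- i" "- j"] by (simp add: algebra_simps)
  show "e (- i) (- j) \<Longrightarrow> e (- j) (- i)" for i j by (rule sym)
  show "\<not> e (- i) (- i)" for i by (rule irrefl)
  show False if "i < k" "k < j" "j < l" "l < i + n" "e (- i) (- j)" "e (- k) (- l)" for i k j l
    using nocross[of "- j" "- k" "- i" "- l + n"] that sym[of "- i" "- j"] periodic2[of "- k" "- l"] by auto
  show "\<exists>k l. i < k \<and> k < j \<and> j < l \<and> l < i + n \<and> e (- k) (- l)"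
    if ij: "i < j" "j < i + n" "\<not> e (- i) (- j)" for i j
  proof -
    have "\<not> e (- j) (- i)" using ij commute by blast
    then obtain k l where kl: "- j < k" "k < - i" "- i < l" "l < - j + n" "e k l"
      using maximal[of "- j" "- i"] ij by auto
    show ?thesis
      using kl commute periodic2[of k "l - n"] by (intro exI[of _ "- k"] exI[of _ "- l + n"]) auto
  qed
qed

text \<open>Distances 0, 1 and at most 2 are all that the proof distinguishes.\<close>

definition close :: "int \<Rightarrow> int \<Rightarrow> bool" where
  "close u s \<longleftrightarrow> e u s \<or> (\<exists>w. e u w \<and> e w s)"

text \<open>Only vertices outside \<open>S\<close> are compared, because a landmark is told apart
  from every other vertex by its distance 0 to itself.\<close>

definition unresolved :: "(int \<Rightarrow> bool) \<Rightarrow> int \<Rightarrow> int \<Rightarrow> bool" where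
  "unresolved S u v \<longleftrightarrow> \<not> S u \<and> \<not> S v \<and> u mod n \<noteq> v mod n \<and>
     (\<forall>s. S s \<longrightarrow> (e u s \<longleftrightarrow> e v s) \<and> (close u s \<longleftrightarrow> close v s))"

end

lemma (in triangulated_polygon) close_cong: "u mod n = u' mod n \<Longrightarrow> close u s = close u' s"
  unfolding close_def using cong1[of u u'] by simp

section \<open>Unresolved pairs force hubs\<close>

locale marked_polygon = triangulated_polygon +
  fixes S :: "int \<Rightarrow> bool"
  assumes S_periodic: "S (i + n) = S i"
begin

lemma S_minus: "S (i - n) = S i"
  using S_periodic[of "i - n"] by simp

abbreviation "unres \<equiv> unresolved S"

lemma S_cong: "i mod n = j mod n \<Longrightarrow> S i = S j"
proof -
  have *: "S (i + n * c) = S i" for i c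
  proof (induction c rule: int_induct[where k = 0])
    case (step1 c) then show ?case using S_periodic[of "i + n * c"] by (simp add: algebra_simps)
  next
    case (step2 c) then show ?case using S_minus[of "i + n * c"] by (simp add: algebra_simps)
  qed simp
  show "i mod n = j mod n \<Longrightarrow> S i = S j"
    using *[of "i mod n" "i div n"] *[of "j mod n" "j div n"] by (metis mod_mult_div_eq)
qed

lemma unres_sym: "unres u v \<Longrightarrow> unres v u"
  unfolding unresolved_def by auto

lemma unres_shift: "unres u v = unres (u + n) v"
  unfolding unresolved_def periodic S_periodic close_cong[of "u + n" u, simplified] by simp

lemma unres_shift2: "unres u v = unres u (v + n)"
  using unres_shift[of v u] unres_sym by metis

lemma unresD:
  assumes "unres u v"
  shows "\<not> S u" "\<not> S v" "S s \<Longrightarrow> e u s \<Longrightarrow> e v s" "S s \<Longrightarrow> e v s \<Longrightarrow> e u s" "u mod n \<noteq> v mod n"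
  using assms unfolding unresolved_def by auto

text \<open>The middle vertex of the path of length two is moved into a window of length
  \<open>n\<close> of free choice, so that its index can be compared with the others by
  size.\<close>

lemma unres_close:
  assumes "unres u v" "S s" "e v w" "e w s" "\<not> e u s"
  obtains m where "x \<le> m" "m < x + n" "e u m" "e m s"
proof -
  obtain m where m: "e u m" "e m s"
    using assms unfolding unresolved_def close_def by blast
  obtain m' where m': "x \<le> m'" "m' < x + n" "m' mod n = m mod n" using window by blast
  have "e m' u" "e m' s" using cong1[OF m'(3)] m commute by blast+
  then show ?thesis using that[of m'] m' commute by blast
qed

lemma reflected_marked: "marked_polygon n (\<lambda>i j. e (- i) (- j)) (\<lambda>i. S (- i))"
proof -
  interpret R: triangulated_polygon n "\<lambda>i j. e (- i) (- j)" by (rule reflected)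
  show ?thesis
    by unfold_locales (use S_minus in \<open>simp add: algebra_simps\<close>)
qed

lemma reflected_unres:
  assumes "unres u v"
  shows "triangulated_polygon.unresolved n (\<lambda>i j. e (- i) (- j)) (\<lambda>i. S (- i)) (- u) (- v)"
proof -
  interpret R: triangulated_polygon n "\<lambda>i j. e (- i) (- j)" by (rule reflected)
  have c: "R.close (- a) s = close a (- s)" for a s
    unfolding R.close_def close_def by (auto intro: exI[of _ "- w" for w])
  have "(- u) mod n \<noteq> (- v) mod n"
    using assms mod_minus_cong[of "- u" n "- v"] unfolding unresolved_def by auto
  then show ?thesis using assms unfolding R.unresolved_def unresolved_def c by simp
qed

text \<open>Both vertices share all four landmarks next to them. The edges from \<open>u + 1\<close>
  to \<open>v\<close> and from \<open>u\<close> to \<open>v - 1\<close> cross unless these landmarks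
  coincide; the same on the other side leaves only \<open>n = 4\<close>.\<close>

lemma gap1_gap1:
  assumes "6 \<le> n" "unres u v" "S (u - 1)" "S (u + 1)" "S (v - 1)" "S (v + 1)" "u < v" "v < u + n"
  shows False
proof -
  note D = unresD[OF assms(2)]
  have 1: "e v (u + 1)" "e u (v - 1)" "e v (u - 1)" "e u (v + 1)"
    using D(3)[OF assms(4) side] D(3)[OF assms(3) side'(2)] D(4)[OF assms(6) side] D(4)[OF assms(5) side'(2)] by auto
  have "u + 1 \<noteq> v" "v + 1 \<noteq> u + n" using D(1,2) assms(4,6) S_periodic[of u] by auto
  then have ne: "u + 1 < v" "v + 1 < u + n" using assms by auto
  have "\<not> u + 1 < v - 1"
    using nocross[of u "u + 1" "v - 1" v] 1 commute[of v "u + 1"] assms by auto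
  moreover have "\<not> v + 1 < u - 1 + n"
    using nocross[of v "v + 1" "u - 1 + n" "u + n"] 1 assms periodic2[of v "u - 1"]
      periodic2[of "v + 1" u] commute[of u "v + 1"] by (auto simp: algebra_simps)
  ultimately show False using ne assms by linarith
qed

text \<open>The edges to common landmarks cross unless \<open>v + 1\<close> and \<open>u - 1\<close>
  coincide. Then \<open>u\<close> lies under the chord from \<open>v\<close> to
  \<open>v + 3\<close>. As \<open>v - 2\<close> is two steps from \<open>v\<close>, it is so from
  \<open>u\<close> too, and the only way out from under the chord is over \<open>v + 3\<close>,
  which thereby becomes a hub. Its edge to \<open>v - 1\<close> is the remaining diagonal of a
  quadrilateral.\<close>

lemma gap1_right:
  assumes "6 \<le> n" "unres u v" "S (u - 1)" "S (u + 1)" "S (v + 1)" "S (v - 2)" "u < v" "v < u + n"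
  shows "u + n = v + 2 \<and> e (v + 3) v \<and> e (v + 3) (v - 1) \<and> e (v + 3) (v - 2)"
proof -
  note D = unresD[OF assms(2)]
  have 1: "e v (u + 1)" "e v (u - 1)" "e u (v + 1)"
    using D(3)[OF assms(4) side] D(3)[OF assms(3) side'(2)] D(4)[OF assms(5) side] by auto
  have "v + 1 \<noteq> u + n" using D(1) assms(5) S_periodic[of u] by auto
  then have ne: "v + 1 < u + n" using assms by auto
  have "\<not> v + 1 < u - 1 + n"
    using nocross[of v "v + 1" "u - 1 + n" "u + n"] 1 assms periodic2[of v "u - 1"]
      periodic2[of "v + 1" u] commute[of u "v + 1"] by (auto simp: algebra_simps)
  then have u: "u + n = v + 2" using ne by linarith
  have e3: "e v (v + 3)" using 1(1) u periodic2[of v "u + 1"] by (simp add: algebra_simps)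
  have un: "e (v + 2) j = e u j" for j using u periodic[of u j] by simp
  have nz: "\<not> e u (v - 2)"
    using confined[of v "v + 3" "v + 2" "v - 2 + n"] un periodic2[of "v + 2" "v - 2"] assms e3 by auto
  obtain m where m: "v \<le> m" "m < v + n" "e u m" "e m (v - 2)"
    using unres_close[OF assms(2,6) _ _ nz, of "v - 1" v] side'(2)[of v] side'(2)[of "v - 1"] by auto
  have "m \<le> v + 3" using confined[of v "v + 3" "v + 2" m] un m assms e3 by auto
  moreover have "m \<noteq> v" using m(4) nz D(4)[OF assms(6)] by auto
  moreover have "m \<noteq> v + 1"
    using confined[of v "v + 3" "v + 1" "v - 2 + n"] periodic2[of "v + 1" "v - 2"] m assms e3 by auto
  moreover have "m \<noteq> v + 2" using m un[of "v + 2"] irrefl by auto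
  ultimately have "m = v + 3" using m(1) by linarith
  then have m3: "e (v + 3) (v - 2)" using m by simp
  have "\<not> e (v - 2) v" using nz D(4)[OF assms(6)] commute[of v "v - 2"] by auto
  then have "e (v - 1) (v + 3)"
    using quad[of "v - 2" "v - 1" v "v + 3"] m3 commute e3 side'(1)[of "v - 1"] side'(1)[of v] assms by auto
  then show ?thesis using u m3 e3 commute by blast
qed

lemma gap1_left:
  assumes "6 \<le> n" "unres u v" "S (u - 1)" "S (u + 1)" "S (v - 1)" "S (v + 2)" "v < u" "u < v + n"
  shows "u = v - 2 + n \<and> e (v - 3) v \<and> e (v - 3) (v + 1) \<and> e (v - 3) (v + 2)"
proof -
  interpret R: marked_polygon n "\<lambda>i j. e (- i) (- j)" "\<lambda>i. S (- i)" by (rule reflected_marked)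
  have *: "- u - 1 = - (u + 1)" "- u + 1 = - (u - 1)" "- v + 1 = - (v - 1)" "- v - 2 = - (v + 2)"
    "-v+3 = -(v - 3)" "-v - 1 = -(v+1)" by auto
  show ?thesis
    using R.gap1_right[OF assms(1) reflected_unres[OF assms(2)]] assms unfolding * minus_minus by auto
qed

text \<open>The landmark \<open>u + 1\<close> is joined to \<open>v\<close>, and this chord
  separates \<open>u\<close> from \<open>v - 2\<close>. A path of length two from \<open>u\<close>
  to \<open>v - 2\<close> has to pass an end of the chord; passing \<open>v\<close> would make
  \<open>v - 2\<close> a neighbour of only one of the two vertices.\<close>

lemma right_right:
  assumes "unres u v" "S (u + 1)" "S (v + 1)" "S (v - 2)" "u + 1 < v - 2" "v + 1 < u + n"
  shows "e (u + 1) v \<and> e (u + 1) (v - 1) \<and> e (u + 1) (v - 2)"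
proof -
  note D = unresD[OF assms(1)]
  have 1: "e (u + 1) v" using D(3)[OF assms(2) side] commute[of v "u + 1"] by simp
  have nz: "\<not> e u (v - 2)"
    using nocross[of "u + 1" "v - 2" v "u + n"] 1 assms periodic2[of "v - 2" u] commute by auto
  obtain m where m: "u + 1 \<le> m" "m < u + 1 + n" "e u m" "e m (v - 2)"
    using unres_close[OF assms(1,4) _ _ nz, of "v - 1" "u + 1"] side'(2)[of v] side'(2)[of "v - 1"] by auto
  have "m \<le> v" using confined[of "u + 1" v "v - 2" m] m commute assms 1 by auto
  moreover have "m \<noteq> v" using m(4) nz D(4)[OF assms(4)] by auto
  moreover have "\<not> u + 1 < m"
  proof
    assume "u + 1 < m"
    then show False
      using nocross[of "u + 1" m v "u + n"] 1 assms periodic2[of m u] m sym[of u m] calculation by auto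
  qed
  ultimately have "m = u + 1" using m(1) by linarith
  then have 2: "e (u + 1) (v - 2)" using m by simp
  have "\<not> e (v - 2) v" using nz D(4)[OF assms(4)] commute[of v "v - 2"] by auto
  then show ?thesis
    using quad[of "u + 1" "v - 2" "v - 1" v] 1 2 assms side'(1)[of "v - 1"] side'(1)[of v] by auto
qed

lemma left_left:
  assumes "unres u v" "S (u - 1)" "S (v - 1)" "S (v + 2)" "v + 2 < u - 1" "u - n < v - 1"
  shows "e (u - 1) v \<and> e (u - 1) (v + 1) \<and> e (u - 1) (v + 2)"
proof -
  interpret R: marked_polygon n "\<lambda>i j. e (- i) (- j)" "\<lambda>i. S (- i)" by (rule reflected_marked)
  have *: "- u + 1 = - (u - 1)" "- v + 1 = - (v - 1)" "- v - 2 = - (v + 2)" "-v - 1 = -(v+1)" by auto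
  show ?thesis
    using R.right_right[OF reflected_unres[OF assms(1)]] assms unfolding * minus_minus by auto
qed

text \<open>Otherwise the edges from \<open>u\<close> to \<open>v - 1\<close> and from
  \<open>u + 1\<close> to \<open>v\<close>, which exist because landmarks are shared, would
  cross.\<close>

lemma right_left:
  assumes "unres u v" "S (u + 1)" "S (v - 1)" "u < v" "v < u + n"
  shows "v = u + 2"
proof -
  note D = unresD[OF assms(1)]
  have 1: "e v (u + 1)" "e u (v - 1)" using D(3)[OF assms(2) side] D(4)[OF assms(3) side'(2)] by auto
  have "u + 1 \<noteq> v" using D(2) assms(2) by auto
  then have "u + 1 < v" using assms(4) by linarith
  moreover have "\<not> u + 1 < v - 1"
    using nocross[of u "u + 1" "v - 1" v] 1 commute[of v "u + 1"] assms by auto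
  ultimately show ?thesis by linarith
qed

text \<open>Paths of length two lead from \<open>x + 1\<close> over \<open>m\<close> to
  \<open>x - 3\<close> and from \<open>x - 1\<close> over some \<open>l\<close> to
  \<open>x + 3\<close>. Their ends interleave on the boundary, so the paths can avoid crossing only
  by meeting in \<open>l = m\<close>. The middle vertex \<open>x\<close> itself is left to
  \<open>center\<close>.\<close>

lemma center_hub:
  assumes "7 \<le> n" "unres (x - 1) (x + 1)" "S (x - 3)" "S (x + 3)"
    and "\<not> e (x + 1) (x - 3)" "\<not> e (x + 1) (x + 3)"
    and m: "x + 1 < m" "m < x + 1 + n" "m \<noteq> x + n" "e (x + 1) m" "e m (x - 3)"
  shows "e m (x - 1) \<and> e m (x + 3)"
proof -
  note D = unresD[OF assms(2)]
  have nD: "\<not> e (x - 1) (x - 3)" "\<not> e (x - 1) (x + 3)" using D(3)[OF assms(3)] D(3)[OF assms(4)] assms by auto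
  have "e (x + 1) (x + 2)" "e (x + 2) (x + 3)" using side[of "x + 1"] side[of "x + 2"] by (simp_all add: add.assoc)
  then obtain l where l: "x + 1 \<le> l" "l < x + 1 + n" "e (x - 1) l" "e l (x + 3)"
    using unres_close[OF assms(2,4) _ _ nD(2), of "x + 2" "x + 1"] by blast
  have l': "e (x - 1 + n) l" "e l (x - 1 + n)" "e (x + 3) l" "e m (x + 1)"
    using l m(4) periodic[of "x - 1" l] commute[of l "x - 1 + n"] commute[of l "x + 3"] commute[of m "x + 1"] by auto
  have mB: "e m (x - 3 + n)" using m(5) periodic2[of m "x - 3"] by simp
  have lA: "l \<noteq> x + 1" using assms(6) l(4) by auto
  have lB: "l \<noteq> x - 3 + n"
  proof
    assume "l = x - 3 + n"
    then show False using nD(1) l(3) periodic2[of "x - 1" "x - 3"] by simp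
  qed
  consider "m = x + 2" | "m = x + 3" | "x + 3 < m" "m < x - 3 + n" | "m = x - 3 + n" | "m = x - 2 + n" | "m = x - 1 + n"
    using m by linarith
  then show ?thesis
  proof cases
    case 1
    have "\<not> (x + 3 < l \<and> l < x - 3 + n)"
      using nocross[of "x + 2" l "x - 3 + n" "x - 1 + n"] l l' mB 1 by auto
    moreover have "\<not> (x - 3 + n < l)"
      using nocross[of "x + 2" "x + 3" "x - 3 + n" l] l l' mB 1 assms(1) by auto
    moreover have "l \<noteq> x + 3" using l irrefl by auto
    ultimately have "l = x + 2" using l lA lB by linarith
    then show ?thesis using l 1 commute[of "x - 1" l] by auto
  next
    case 2
    then show ?thesis using m assms by auto
  next
    case 3
    have "\<not> (m < l)"
      using nocross[of "x + 1" "x + 3" m l] l l' m 3 by auto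
    moreover have "\<not> (l < m)"
      using nocross[of "x + 1" l m "x - 1 + n"] l l' m 3 lA by auto
    ultimately have "l = m" by linarith
    then show ?thesis using l commute[of "x - 1" l] by auto
  next
    case 4
    then show ?thesis using m(5) periodic[of "x - 3" "x - 3"] irrefl by auto
  next
    case 5
    have "\<not> (x - 2 + n < l)"
      using nocross[of "x + 1" "x + 3" "x - 2 + n" l] l l' m 5 assms(1) by auto
    moreover have "\<not> (x + 1 < l \<and> l < x - 2 + n)"
      using nocross[of "x + 1" l "x - 2 + n" "x - 1 + n"] l l' m 5 by auto
    ultimately have "l = m" using l lA 5 by linarith
    then show ?thesis using l commute[of "x - 1" l] by auto
  next
    case 6
    then show ?thesis using m(5) nD(1) periodic[of "x - 1" "x - 3"] by auto
  qed
qed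

text \<open>The chord from \<open>x - 3\<close> to \<open>x + 1\<close> encloses
  \<open>x - 1\<close>, so the path of length two from \<open>x - 1\<close> to \<open>x + 3\<close>
  has to leave over \<open>x - 3\<close>.\<close>

lemma center_left:
  assumes "7 \<le> n" "unres (x - 1) (x + 1)" "S (x - 3)" "S (x + 3)" "e (x + 1) (x - 3)"
  shows "e (x - 3) (x + 1) \<and> e (x - 3) (x + 2) \<and> e (x - 3) (x + 3)"
proof -
  note D = unresD[OF assms(2)]
  have BA: "e (x - 3) (x + 1)" using assms(5) commute[of "x - 3" "x + 1"] by simp
  have nD: "\<not> e (x - 1) (x + 3)"
    using nocross[of "x - 3" "x - 1" "x + 1" "x + 3"] BA assms(1) by auto
  have nA: "\<not> e (x + 1) (x + 3)" using nD D(4)[OF assms(4)] by auto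
  have s: "e (x + 1) (x + 2)" "e (x + 2) (x + 3)" using side[of "x + 1"] side[of "x + 2"] by (simp_all add: add.assoc)
  then obtain l where l: "x - 3 \<le> l" "l < x - 3 + n" "e (x - 1) l" "e l (x + 3)"
    using unres_close[OF assms(2,4) _ _ nD(1), of "x + 2" "x - 3"] by blast
  have "l \<le> x + 1" using confined[of "x - 3" "x + 1" "x - 1" l] BA l assms(1) by auto
  moreover have "\<not> (x - 3 < l \<and> l < x + 1)"
    using nocross[of "x - 3" l "x + 1" "x + 3"] BA l assms(1) by auto
  moreover have "l \<noteq> x + 1" using l nA by auto
  ultimately have "l = x - 3" using l by linarith
  then have BC: "e (x - 3) (x + 3)" using l by simp
  then show ?thesis using quad[of "x - 3" "x + 1" "x + 2" "x + 3"] BA s nA assms(1) by auto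
qed

text \<open>The outcomes say where the two sides of \<open>x\<close> can be joined: at
  \<open>x - 3\<close>, at \<open>x + 3\<close>, at \<open>x\<close> itself, at
  \<open>x - 2\<close>, or at a vertex \<open>m\<close> further round. The mirror image
  \<open>x + 2\<close> of the fourth outcome is part of the fifth, hence the disjunct
  \<open>m = x + 2\<close>. The third outcome is the one that \<open>shifted\<close> is made
  for.\<close>

lemma center:
  assumes "7 \<le> n" "unres (x - 1) (x + 1)" "S (x - 3)" "S (x + 3)"
  obtains "e (x - 3) (x + 1)" "e (x - 3) (x + 2)" "e (x - 3) (x + 3)"
  | "e (x + 3) (x - 1)" "e (x + 3) (x - 2)" "e (x + 3) (x - 3)"
  | "e x (x - 3)" "e x (x + 2)" "e x (x + 3)"
  | "e (x - 2) (x + 1)" "e (x - 2) (x + 2)" "e (x - 2) (x + 3)"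
  | m where "x + 1 < m" "m < x - 3 + n" "e m (x - 3)" "e m (x - 2)" "e m (x - 1)"
      "e m (x + 1)" "m = x + 2 \<or> e m (x + 2)" "e m (x + 3)"
proof -
  note concl = that
  interpret R: marked_polygon n "\<lambda>i j. e (- i) (- j)" "\<lambda>i. S (- i)" by (rule reflected_marked)
  have neg: "- x - 1 = - (x + 1)" "- x + 1 = - (x - 1)" "- x - 3 = - (x + 3)" "- x + 3 = - (x - 3)"
    "- x - 2 = - (x + 2)" "- x + 2 = - (x - 2)" by auto
  have Ru: "R.unres (- x - 1) (- x + 1)"
    unfolding neg using R.unres_sym[OF reflected_unres[OF assms(2)]] .
  note D = unresD[OF assms(2)]
  consider "e (x + 1) (x - 3)" | "e (x - 1) (x + 3)" |
    (N) "\<not> e (x + 1) (x - 3)" "\<not> e (x - 1) (x + 3)" by blast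
  then show thesis
  proof cases
    case 1
    then show ?thesis using center_left[OF assms] concl(1) by blast
  next
    case 2
    then show ?thesis
      using R.center_left[OF assms(1) Ru] assms concl(2) unfolding neg minus_minus by blast
  next
    case N
    have nE: "\<not> e (x + 1) (x + 3)" "\<not> e (x - 1) (x - 3)"
      using N D(4)[OF assms(4)] D(3)[OF assms(3)] by auto
    have s: "e (x + 1) (x + 2)" "e (x + 2) (x + 3)" "e (x - 1) (x - 2)" "e (x - 2) (x - 3)"
      "e (x - 3) (x - 2)" "e (x - 2) (x - 1)" "e x (x + 1)"
      using side[of "x + 1"] side[of "x + 2"] side'(1,2)[of "x - 1"] side'(1,2)[of "x - 2"] side[of x] by (simp_all add: add.assoc)
    have hub: thesis if m: "x + 1 < m" "m < x + 1 + n" "m \<noteq> x + n" "e (x + 1) m" "e m (x - 3)"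
        "e m (x - 1)" "e m (x + 3)" for m
    proof -
      have mA: "e m (x + 1)" using m commute[of m "x + 1"] by simp
      have "m \<noteq> x - 1 + n" using m nE periodic[of "x - 1" "x - 3"] by auto
      moreover have "m \<noteq> x - 3 + n" using m irrefl periodic[of "x - 3" "x - 3"] by auto
      moreover have "m \<noteq> x + 3" using m irrefl by auto
      ultimately consider "m = x - 2 + n" | "m = x + 2" | "x + 3 < m" "m < x - 3 + n" using m by linarith
      then show thesis
      proof cases
        case 1
        have P: "e (x - 2) j = e m j" for j using 1 periodic[of "x - 2" j] by simp
        have Q: "e (x + 2) m" using quad[of "x + 1" "x + 2" "x + 3" m] s m nE 1 assms(1)
            commute[of "x + 3" m] by auto
        show thesis
          by (intro concl(4)) (use m mA Q commute[of m "x + 2"] in \<open>simp_all add: P\<close>)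
      next
        case 2
        have "e (x + 2) (x - 2)"
          using quad[of m "x - 3 + n" "x - 2 + n" "x - 1 + n"] 2 m nE s assms(1)
            commute[of "x - 3" "x - 1"] by (auto simp: periodic periodic2)
        then show thesis using concl(5)[of m] 2 m mA assms(1) by auto
      next
        case 3
        have "e m (x - 2)"
          using quad[of m "x - 3 + n" "x - 2 + n" "x - 1 + n"] 3 m nE s assms(1)
            commute[of "x - 3" "x - 1"] by (auto simp: periodic periodic2)
        moreover have "e (x + 2) m" using quad[of "x + 1" "x + 2" "x + 3" m] s m nE 3 assms(1)
            commute[of "x + 3" m] by auto
        ultimately show thesis using concl(5)[of m] 3 m mA assms(1) commute[of m "x + 2"] by auto
      qed
    qed
    obtain m where m: "x + 1 \<le> m" "m < x + 1 + n" "e (x + 1) m" "e m (x - 3)"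
      using unres_close[OF unres_sym[OF assms(2)] assms(3) s(3,4) N(1)] by blast
    \<comment> \<open>Unless both paths of length two run over \<open>x\<close>, one of them has a
      middle vertex to which \<open>hub\<close> applies.\<close>
    show thesis
    proof (cases "m = x + n")
      case False
      have "m \<noteq> x + 1" using m irrefl by auto
      then have "x + 1 < m" using m by simp
      then show thesis
        using hub[OF _ m(2) False m(3,4)] center_hub[OF assms N(1) nE(1) _ m(2) False m(3,4)] by blast
    next
      case True
      then have xB: "e x (x - 3)" using m periodic[of x] by auto
      obtain l where l: "x - 1 - n < l" "l \<le> x - 1" "e (x - 1) l" "e l (x + 3)"
        using unres_close[OF assms(2) assms(4) s(1,2) N(2), of "x - n"] by force
      show thesis
      proof (cases "l = x - n")
        case False
        have "l \<noteq> x - 1" using l irrefl by auto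
        then have "R.unres (- x - 1) (- x + 1) \<Longrightarrow> e l (x + 1) \<and> e l (x - 3)"
          using R.center_hub[OF assms(1), of "- x" "- l"] l assms N nE False unfolding neg minus_minus by auto
        then have *: "e l (x + 1)" "e l (x - 3)" using Ru by auto
        have "l + n \<noteq> x + 1" using * irrefl periodic[of l "x + 1"] by metis
        then show thesis
          using hub[of "l + n"] * l False commute[of "x + 1" l] commute[of "x - 1" l] \<open>l \<noteq> x - 1\<close>
          by (auto simp: periodic periodic2)
      next
        case True
        then have xC: "e x (x + 3)" using l periodic_minus(1)[of x] by auto
        have "e x (x + 2)" using quad[of x "x + 1" "x + 2" "x + 3"] s xC nE assms(1) by auto
        then show thesis using concl(3) xB xC by blast
      qed
    qed
  qed
qed

end

section \<open>The choice of the landmarks\<close>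

locale eared_polygon = triangulated_polygon +
  assumes n6: "6 \<le> n"
    and ear: "e 2 y \<Longrightarrow> y mod n = 1 \<or> y mod n = 3"
begin

definition k :: int where "k = n div 5"
definition r :: int where "r = n mod 5"

text \<open>The vertices at which a hub obliges segment \<open>i\<close> to set its flag. If 5
  divides \<open>n\<close>, the last multiple \<open>5 * k\<close> denotes vertex 0, which accounts
  for the clause \<open>z = 0\<close>.\<close>

definition good :: "int \<Rightarrow> int \<Rightarrow> bool" where
  "good i y \<longleftrightarrow> (let z = y mod n in
     z mod 5 = 0 \<and> 5 * i < z \<and> z \<le> 5 * (k) \<or> z = 0 \<and> r = 0 \<or>
     z < 5 * i \<and> (z mod 5 = 2 \<or> z mod 5 = 3))"

text \<open>Here \<open>h\<close> is the apex of the triangle on the side from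
  \<open>5 * i + 1\<close> to \<open>5 * i + 2\<close>. A conflict caused by selecting
  \<open>5 * i + 3\<close> makes \<open>h\<close> a hub of \<open>5 * i + 1\<close> to
  \<open>5 * i + 3\<close>, or of \<open>5 * i\<close> to \<open>5 * i + 2\<close>; in the second
  case \<open>5 * i + 3\<close> is joined back to \<open>h - 1\<close> and \<open>h - 3\<close>, and
  \<open>flag_right_hub\<close> exploits these edges. In the first segment the apex over the side at
  the ear is 3, and a single test remains.\<close>

definition flag :: "int \<Rightarrow> bool" where
  "flag i \<longleftrightarrow> (if i = 0 then e 3 (- 1) else
     \<exists>h. 5 * i + 2 < h \<and> h < 5 * i + 1 + n \<and> e (5 * i + 1) h \<and>
       (\<forall>z. 5 * i + 2 < z \<and> z < h \<longrightarrow> \<not> e (5 * i + 1) z) \<and> good i h \<and>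
       (e (5 * i + 3) h \<or> e (5 * i) h \<and> e (5 * i + 3) (h - 1) \<and> e (5 * i + 3) (h - 3)))"

text \<open>With \<open>x = 5 * i\<close> this is the third outcome of \<open>center\<close>,
  between a flagged and an unflagged segment: the anchor is itself the hub, so its predecessor takes
  over as landmark.\<close>

definition shifted :: "int \<Rightarrow> bool" where
  "shifted i \<longleftrightarrow> 0 < i \<and> i < k \<and> flag (i - 1) \<and> \<not> flag i \<and>
     e (5 * i) (5 * i - 3) \<and> e (5 * i) (5 * i + 2) \<and> e (5 * i) (5 * i + 3)"

definition landmarks :: "int set" where
  "landmarks = (\<lambda>i. if shifted i then 5 * i - 1 else 5 * i) ` {0..<k}
     \<union> (\<lambda>i. if flag i then 5 * i + 2 else 5 * i + 3) ` {0..<k}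
     \<union> (if r > 0 then {5 * (k)} else {})
     \<union> (if r > 2 then {5 * (k) + 2} else {})"

definition S :: "int \<Rightarrow> bool" where
  "S x \<longleftrightarrow> x mod n \<in> landmarks"

lemma nk: "5 * k \<le> n" "n \<le> 5 * k + 4" "n = 5 * k + r" "0 \<le> r" "r \<le> 4"
  unfolding k_def r_def
  using mult_div_mod_eq[of 5 n] pos_mod_bound[of 5 n] pos_mod_sign[of 5 n] by linarith+

lemma mod_id: "0 \<le> x \<Longrightarrow> x < n \<Longrightarrow> x mod n = x"
  by simp

lemma earD: "e y 2 \<Longrightarrow> y mod n = 1 \<or> y mod n = 3"
  using ear commute[of y 2] by simp

lemma ear_cases: "e y 2 \<Longrightarrow> 0 \<le> y \<Longrightarrow> y \<le> n \<Longrightarrow> y = 1 \<or> y = 3"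
  using earD[of y] n6 by (cases "y = n") auto

lemma good_anchor: "0 \<le> i \<Longrightarrow> i < j \<Longrightarrow> j \<le> k \<Longrightarrow> good i (5 * j)"
proof (cases "5 * j = n")
  case True
  then have "r = 0" unfolding r_def by presburger
  then show ?thesis using True unfolding good_def by simp
next
  case False
  assume a: "0 \<le> i" "i < j" "j \<le> k"
  then have "5 * j mod n = 5 * j" using False nk by (intro mod_id) linarith+
  then show ?thesis using a unfolding good_def by simp
qed

lemma good_left: "0 \<le> j \<Longrightarrow> j < i \<Longrightarrow> i < k \<Longrightarrow> c = 2 \<or> c = 3 \<Longrightarrow> good i (5 * j + c)"
proof -
  assume a: "0 \<le> j" "j < i" "i < k" "c = 2 \<or> c = 3"
  then have "(5 * j + c) mod n = 5 * j + c" using nk by (intro mod_id) auto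
  moreover have "(5 * j + c) mod 5 = c" using a by auto
  ultimately show ?thesis using a unfolding good_def by auto
qed

lemma not_good:
  assumes "0 \<le> i" "i \<le> j" "j < k" "c \<in> {1..4}"
  shows "\<not> good i (5 * j + c)"
proof -
  have "(5 * j + c) mod n = 5 * j + c" using assms nk by (intro mod_id) auto
  moreover have "(5 * j + c) mod 5 = c" using assms by auto
  ultimately show ?thesis using assms unfolding good_def by auto
qed

lemma not_good_anchor:
  assumes "1 \<le> j" "j \<le> i" "i < k"
  shows "\<not> good i (5 * j)"
proof -
  have "(5 * j) mod n = 5 * j" using assms nk by (intro mod_id) auto
  then show ?thesis using assms unfolding good_def by auto
qed

lemma good_periodic: "good i (y + n) = good i y" "good i (n + y) = good i y"
  unfolding good_def by simp_all

text \<open>Position 2 of a later segment or of the remainder is never good, so the index has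
  wrapped around to the ear. This is used to refute hubs at \<open>5 * i + 7\<close>, as the ear has
  no distant neighbours.\<close>

lemma good_next:
  assumes "1 \<le> i" "i < k" "good i (5 * i + 7)"
  shows "(5 * i + 7) mod n = 2"
proof (cases "i + 1 < k")
  case True
  then show ?thesis using assms not_good[of i "i + 1" 2] by (simp add: algebra_simps)
next
  case False
  then have i: "5 * i + 7 = 5 * k + 2" using assms by linarith
  show ?thesis
  proof (cases "5 * k + 2 < n")
    case True
    then have "(5 * i + 7) mod n = 5 * i + 7" using i assms by (intro mod_id) auto
    moreover have "(5 * i + 7) mod 5 = 2" by presburger
    ultimately show ?thesis using assms unfolding good_def by auto
  next
    case False
    then have "(5 * i + 7) mod n = (5 * i + 7 - n) mod n" by (simp add: mod_diff_left_eq)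
    also have "\<dots> = 5 * i + 7 - n" using False i nk n6 by (intro mod_id) linarith+
    finally have m: "(5 * i + 7) mod n = 2 - r" using i nk(3) by linarith
    then have "r = 0 \<or> (r = 1 \<and> (5 * i + 7) mod n = 1) \<or> (r = 2 \<and> (5 * i + 7) mod n = 0)"
      using False nk by linarith
    then show ?thesis using m assms unfolding good_def by auto
  qed
qed

text \<open>A common neighbour \<open>y\<close> of both ends of a side is the apex over it: an edge
  from \<open>5 * i + 1\<close> to a nearer vertex would be crossed by the chord from
  \<open>5 * i + 2\<close> to \<open>y\<close>.\<close>

lemma flagI2:
  assumes "1 \<le> i" "5 * i + 2 < y" "y < 5 * i + 1 + n" "good i y"
    and "e y (5 * i + 1)" "e y (5 * i + 2)" "e y (5 * i + 3)"
  shows "flag i"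
proof -
  have c: "e (5 * i + 1) y" "e (5 * i + 2) y" "e (5 * i + 3) y"
    using assms(5-) sym by blast+
  have *: "\<not> e (5 * i + 1) z" if z: "5 * i + 2 < z \<and> z < y" for z
    using nocross[OF _ _ _ _ _ c(2), of "5 * i + 1" z] z assms(3) by auto
  have "i \<noteq> 0" using assms(1) by simp
  show ?thesis unfolding flag_def if_not_P[OF \<open>i \<noteq> 0\<close>]
    by (intro exI[of _ y] conjI allI impI) (use assms * c in blast)+
qed

lemma flagI1:
  assumes "1 \<le> i" "5 * i + 2 < y" "y < 5 * i + 1 + n" "good i y"
    and "e y (5 * i)" "e y (5 * i + 1)" "e y (5 * i + 2)" "e (5 * i + 3) (y - 1)" "e (5 * i + 3) (y - 3)"
  shows "flag i"
proof -
  have c: "e (5 * i + 1) y" "e (5 * i + 2) y" "e (5 * i) y"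
    using assms(5-) sym by blast+
  have *: "\<not> e (5 * i + 1) z" if z: "5 * i + 2 < z \<and> z < y" for z
    using nocross[OF _ _ _ _ _ c(2), of "5 * i + 1" z] z assms(3) by auto
  have "i \<noteq> 0" using assms(1) by simp
  show ?thesis unfolding flag_def if_not_P[OF \<open>i \<noteq> 0\<close>]
    by (intro exI[of _ y] conjI allI impI) (use assms * c in blast)+
qed

lemma flagE:
  assumes "flag i" "1 \<le> i" "i < k"
  obtains h where "5 * i + 4 < h" "h < 5 * i + 1 + n" "e (5 * i + 1) h" "\<not> e (5 * i + 1) (5 * i + 3)" "good i h"
    "e (5 * i + 3) h \<or> e (5 * i) h \<and> e (5 * i + 3) (h - 1) \<and> e (5 * i + 3) (h - 3)"
proof -
  have "i \<noteq> 0" using assms by simp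
  then obtain h where h: "5 * i + 2 < h" "h < 5 * i + 1 + n" "e (5 * i + 1) h"
       "\<forall>z. 5 * i + 2 < z \<and> z < h \<longrightarrow> \<not> e (5 * i + 1) z" "good i h"
       "e (5 * i + 3) h \<or> e (5 * i) h \<and> e (5 * i + 3) (h - 1) \<and> e (5 * i + 3) (h - 3)"
    using assms(1) unfolding flag_def if_not_P[OF \<open>i \<noteq> 0\<close>] by blast
  have "h \<noteq> 5 * i + 3" "h \<noteq> 5 * i + 4" using h(5) not_good[of i i 3] not_good[of i i 4] assms by auto
  then have "5 * i + 4 < h" using h(1) by linarith
  moreover have "\<not> e (5 * i + 1) (5 * i + 3)" using h(4)[rule_format, of "5 * i + 3"] calculation by simp
  ultimately show ?thesis using that[OF _ h(2,3) _ h(5,6)] by blast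
qed

text \<open>The hub leaves \<open>5 * i + 3\<close> with no neighbours but \<open>5 * i + 2\<close>,
  \<open>5 * i + 4\<close> and \<open>y\<close>. So the apex that caused the flag is
  \<open>y\<close>, or the second clause of \<open>flag\<close> makes it \<open>5 * i + 7\<close>,
  which would be the ear.\<close>

lemma flag_right_hub:
  assumes "flag i" "1 \<le> i" "i < k" "5 * i + 4 < y" "y < 5 * i + 2 + n" "y \<noteq> 5 * i + 5"
    and "e y (5 * i + 2)" "e y (5 * i + 3)" "e y (5 * i + 4)"
  shows "good i y \<and> e y (5 * i + 1)"
proof -
  obtain h where h: "5 * i + 4 < h" "h < 5 * i + 1 + n" "e (5 * i + 1) h" "\<not> e (5 * i + 1) (5 * i + 3)" "good i h"
    "e (5 * i + 3) h \<or> e (5 * i) h \<and> e (5 * i + 3) (h - 1) \<and> e (5 * i + 3) (h - 3)"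
    using flagE[OF assms(1-3)] by blast
  have nb: "l = 5 * i + 4 \<or> l = y \<or> l = 5 * i + 2 + n"
    if l: "e (5 * i + 3) l" "5 * i + 3 \<le> l" "l < 5 * i + 3 + n" for l
  proof -
    have "\<not> (5 * i + 4 < l \<and> l < y)"
      using nocross[of "5 * i + 3" "5 * i + 4" l y] l assms commute[of y "5 * i + 4"] by auto
    moreover have "\<not> (y < l \<and> l < 5 * i + 2 + n)"
      using nocross[of y l "5 * i + 2 + n" "5 * i + 3 + n"] l assms periodic2[of y "5 * i + 2"]
        periodic2[of l "5 * i + 3"] commute[of l "5 * i + 3"] by auto
    moreover have "l \<noteq> 5 * i + 3" using l irrefl by auto
    ultimately show ?thesis using l by linarith
  qed
  have y: "y < 5 * i + 1 + n"
  proof (rule ccontr)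
    assume "\<not> ?thesis"
    then have "y = 5 * i + 1 + n" using assms by linarith
    then show False using assms(8) h(4) periodic[of "5 * i + 1"] by simp
  qed
  show ?thesis
  proof (cases "e (5 * i + 3) h")
    case True
    then have "h = y" using nb[of h] h by auto
    then show ?thesis using h commute[of y "5 * i + 1"] by auto
  next
    case False
    then have F: "e (5 * i + 3) (h - 1)" "e (5 * i + 3) (h - 3)" using h by auto
    have "h \<noteq> 5 * i + 5"
      using nocross[of "5 * i + 1" "5 * i + 2" "5 * i + 5" y] h assms y commute[of y "5 * i + 2"] by auto
    then have hy: "h - 1 = y" using nb[of "h - 1"] F h by auto
    then have "h - 3 = 5 * i + 4" using nb[of "h - 3"] F h assms by auto
    then have h7: "h = 5 * i + 7" by simp
    then have "e 2 (5 * i + 1)" using good_next[of i] assms h cong1[of h 2 "5 * i + 1"] n6 commute[of h] by auto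
    moreover have "(5 * i + 1) mod n = 5 * i + 1" using assms nk by (intro mod_id) auto
    ultimately show ?thesis using ear[of "5 * i + 1"] assms by auto
  qed
qed

text \<open>The chord from \<open>5 * i\<close> to \<open>5 * i + 4\<close> hides
  \<open>5 * i + 3\<close>, so the apex that caused the flag could only be \<open>5 * i + 5\<close>;
  but then its edge to \<open>5 * i + 1\<close> crosses this chord. In the first segment the chord
  is crossed by the edge from 3 to \<open>n - 1\<close>.\<close>

lemma flag_no_left_hub:
  assumes "flag i" "0 \<le> i" "i < k" "e (5 * i) (5 * i + 3)" "e (5 * i) (5 * i + 4)"
  shows False
proof (cases "i = 0")
  case True
  then have "e 3 (n - 1)" using assms periodic2[of 3 "- 1"] unfolding flag_def by simp
  then show False using nocross[of 0 3 4 "n - 1"] assms True n6 by auto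
next
  case False
  then obtain h where h: "5 * i + 4 < h" "h < 5 * i + 1 + n" "e (5 * i + 1) h" "good i h"
    "e (5 * i + 3) h \<or> e (5 * i) h \<and> e (5 * i + 3) (h - 1) \<and> e (5 * i + 3) (h - 3)"
    using flagE[OF assms(1)] assms by (metis int_one_le_iff_zero_less order_le_less)
  have nb: "l \<le> 5 * i + 4" if "e (5 * i + 3) l" "5 * i \<le> l" "l < 5 * i + n" for l
    using confined[of "5 * i" "5 * i + 4" "5 * i + 3" l] that assms n6 by auto
  have "h \<noteq> 5 * i + n" using h(4) not_good_anchor[of i i] good_periodic(1)[of i "5 * i"] False assms by auto
  then have "h < 5 * i + n" using h by linarith
  then have "h = 5 * i + 5" using nb[of h] nb[of "h - 1"] h by linarith
  then show False
    using nocross[of "5 * i" "5 * i + 1" "5 * i + 4" h] h assms n6 by auto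
qed

lemma S_periodic': "S (x + n) = S x"
  unfolding S_def by simp

sublocale marked_polygon n e S
  by unfold_locales (rule S_periodic')

lemma not_shifted_zero: "\<not> shifted 0"
  unfolding shifted_def by simp

lemma S_iff: "0 \<le> x \<Longrightarrow> x < n \<Longrightarrow> S x \<longleftrightarrow>
   (\<exists>i. 0 \<le> i \<and> i < k \<and> (shifted i \<and> x = 5 * i - 1 \<or> \<not> shifted i \<and> x = 5 * i \<or>
      flag i \<and> x = 5 * i + 2 \<or> \<not> flag i \<and> x = 5 * i + 3)) \<or>
   r > 0 \<and> x = 5 * k \<or> r > 2 \<and> x = 5 * k + 2"
proof -
  assume x: "0 \<le> x" "x < n"
  have 1: "x \<in> (\<lambda>i. if shifted i then 5 * i - 1 else 5 * i) ` {0..<k} \<longleftrightarrow>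
      (\<exists>i. 0 \<le> i \<and> i < k \<and> (shifted i \<and> x = 5 * i - 1 \<or> \<not> shifted i \<and> x = 5 * i))"
    unfolding image_iff Bex_def by (intro ex_cong1) auto
  have 2: "x \<in> (\<lambda>i. if flag i then 5 * i + 2 else 5 * i + 3) ` {0..<k} \<longleftrightarrow>
      (\<exists>i. 0 \<le> i \<and> i < k \<and> (flag i \<and> x = 5 * i + 2 \<or> \<not> flag i \<and> x = 5 * i + 3))"
    unfolding image_iff Bex_def by (intro ex_cong1) auto
  show ?thesis
    unfolding S_def landmarks_def mod_id[OF x] Un_iff 1 2 by (simp split: if_split) blast
qed

lemma five_unique: "5 * i + c = 5 * j + d \<Longrightarrow> 0 \<le> c \<Longrightarrow> c \<le> 4 \<Longrightarrow> 0 \<le> d \<Longrightarrow> d \<le> 4 \<Longrightarrow> i = j \<and> c = d"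
  for i j c d :: int
  by presburger

lemma shifted_bound: "shifted i \<Longrightarrow> 0 < i \<and> i < k"
  unfolding shifted_def by simp

lemma S_pos:
  assumes "0 \<le> i" "i < k" "0 \<le> c" "c \<le> 4"
  shows "S (5 * i + c) \<longleftrightarrow>
    c = 4 \<and> shifted (i + 1) \<or> c = 0 \<and> \<not> shifted i \<or> c = 2 \<and> flag i \<or> c = 3 \<and> \<not> flag i" (is "_ \<longleftrightarrow> ?R")
proof
  assume "S (5 * i + c)"
  then consider j where "0 \<le> j" "j < k" "shifted j" "5 * i + c = 5 * (j - 1) + 4"
    | j where "0 \<le> j" "j < k" "\<not> shifted j" "5 * i + c = 5 * j + 0"
    | j where "0 \<le> j" "j < k" "flag j" "5 * i + c = 5 * j + 2"
    | j where "0 \<le> j" "j < k" "\<not> flag j" "5 * i + c = 5 * j + 3"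
    | "5 * i + c = 5 * k + 0" | "5 * i + c = 5 * k + 2"
    using S_iff[of "5 * i + c"] assms nk by auto
  then show ?R
  proof cases
    case (1 j) then show ?thesis using five_unique[OF 1(4)] assms by auto
  next
    case (2 j) then show ?thesis using five_unique[OF 2(4)] assms by auto
  next
    case (3 j) then show ?thesis using five_unique[OF 3(4)] assms by auto
  next
    case (4 j) then show ?thesis using five_unique[OF 4(4)] assms by auto
  next
    case 5 then show ?thesis using five_unique[OF 5] assms by auto
  next
    case 6 then show ?thesis using five_unique[OF 6] assms by auto
  qed
next
  assume ?R
  then have "\<exists>j. 0 \<le> j \<and> j < k \<and> (shifted j \<and> 5 * i + c = 5 * j - 1 \<or> \<not> shifted j \<and> 5 * i + c = 5 * j \<or>
      flag j \<and> 5 * i + c = 5 * j + 2 \<or> \<not> flag j \<and> 5 * i + c = 5 * j + 3)"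
  proof (elim disjE)
    assume "c = 4 \<and> shifted (i + 1)"
    then show ?thesis using shifted_bound[of "i + 1"] by (intro exI[of _ "i + 1"]) auto
  qed (use assms in auto)
  then show "S (5 * i + c)" using S_iff[of "5 * i + c"] assms nk by auto
qed

lemma S_rest:
  assumes "5 * k \<le> x" "x < n"
  shows "S x \<longleftrightarrow> x = 5 * k \<or> r > 2 \<and> x = 5 * k + 2"
proof -
  have "5 * k < n" using assms by simp
  then have "r > 0" using nk(3) by linarith
  moreover have "0 \<le> x" using assms n6 nk by linarith
  ultimately show ?thesis using S_iff[of x] assms by auto
qed

lemma S_zero: "S 0" "S n"
proof -
  have "0 < k" using n6 nk by linarith
  then show "S 0" using S_pos[of 0 0] not_shifted_zero by simp
  then show "S n" using S_periodic'[of 0] by simp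
qed

lemma S0: "0 \<le> i \<Longrightarrow> i \<le> k \<Longrightarrow> S (5 * i) \<longleftrightarrow> \<not> shifted i"
proof -
  assume i: "0 \<le> i" "i \<le> k"
  consider "i < k" | "5 * i < n" "i = k" | "5 * i = n" "i = k" using i nk by linarith
  then show ?thesis
  proof cases
    case 1
    then show ?thesis using i S_pos[of i 0] by simp
  next
    case 2
    then show ?thesis using S_rest[of "5 * i"] shifted_bound[of i] by auto
  next
    case 3
    then show ?thesis using S_zero shifted_bound[of i] by auto
  qed
qed

end

section \<open>Conflicts between two right ends or two left ends of gaps\<close>

context eared_polygon begin

text \<open>The right ends of the gaps of two vertices: these gaps are \<open>5 * i + 1\<close>,
  \<open>5 * i + 2\<close> in an unflagged segment and \<open>5 * i + 3\<close>,
  \<open>5 * i + 4\<close> in a flagged one. A shift of the anchor next to the gap changes the gap,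
  hence the negations.\<close>

definition rightish :: "int \<Rightarrow> int \<Rightarrow> bool" where
  "rightish u i \<longleftrightarrow> 0 \<le> i \<and> i < k \<and>
     (u = 5 * i + 2 \<and> \<not> flag i \<and> \<not> shifted i \<or> u = 5 * i + 4 \<and> flag i \<and> \<not> shifted (i + 1))"

definition leftish :: "int \<Rightarrow> int \<Rightarrow> bool" where
  "leftish u i \<longleftrightarrow> 0 \<le> i \<and> i < k \<and>
     (u = 5 * i + 1 \<and> \<not> flag i \<and> \<not> shifted i \<or> u = 5 * i + 3 \<and> flag i \<and> \<not> shifted (i + 1))"

lemma S_seg:
  assumes "0 \<le> i" "i < k"
  shows "\<not> S (5 * i + 1)" "S (5 * i + 2) \<longleftrightarrow> flag i" "S (5 * i + 3) \<longleftrightarrow> \<not> flag i"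
    "S (5 * i + 4) \<longleftrightarrow> shifted (i + 1)" "S (5 * i) \<longleftrightarrow> \<not> shifted i"
    "S (5 * i + 5) \<longleftrightarrow> \<not> shifted (i + 1)"
  using S_pos[OF assms, of 1] S_pos[OF assms, of 2] S_pos[OF assms, of 3] S_pos[OF assms, of 4]
    S_pos[OF assms, of 0] S0[of "i + 1"] assms by (simp_all add: algebra_simps)

lemma shifted_flag: "shifted i \<Longrightarrow> flag (i - 1) \<and> \<not> flag i"
  unfolding shifted_def by simp

lemma rightish_S: "rightish u i \<Longrightarrow> S (u + 1) \<and> S (u - 2)"
  using S_seg[of i] unfolding rightish_def by (auto simp: algebra_simps)

lemma leftish_S: "leftish u i \<Longrightarrow> S (u - 1) \<and> S (u + 2)"
  using S_seg[of i] unfolding leftish_def by (auto simp: algebra_simps)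

text \<open>All gaps between consecutive landmarks have one or two vertices, except that moving an
  anchor back opens a gap of three behind it.\<close>

lemma classify:
  assumes "0 \<le> u" "u < n" "\<not> S u"
  obtains i where "rightish u i" | i where "leftish u i" | "S (u - 1)" "S (u + 1)"
    | i where "shifted i" "u \<in> {5 * i, 5 * i + 1, 5 * i + 2}"
proof (cases "u < 5 * k")
  case True
  define i where "i = u div 5"
  have i: "0 \<le> i" "i < k" "5 * i \<le> u" "u \<le> 5 * i + 4" unfolding i_def using True assms(1) by auto
  note s = S_seg[OF i(1,2)]
  have f: "shifted i \<Longrightarrow> \<not> flag i" "shifted (i + 1) \<Longrightarrow> flag i" using shifted_flag[of i] shifted_flag[of "i + 1"] by auto
  consider "u = 5 * i" | "u = 5 * i + 1" | "u = 5 * i + 2" | "u = 5 * i + 3" | "u = 5 * i + 4" using i by linarith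
  then show ?thesis
  proof cases
    case 1 then show ?thesis using s assms that(4)[of i] by auto
  next
    case 2
    then have n: "u - 1 = 5 * i" "u + 1 = 5 * i + 2" by auto
    show ?thesis
    proof (cases "shifted i")
      case True then show ?thesis using 2 that(4)[of i] by auto
    next
      case False
      then show ?thesis
        using 2 i s that(2)[of i] that(3) n unfolding leftish_def by (cases "flag i") auto
    qed
  next
    case 3
    then have nf: "\<not> flag i" using s(2) assms(3) by simp
    show ?thesis
    proof (cases "shifted i")
      case True
      show ?thesis by (rule that(4)[OF True]) (simp add: 3)
    next
      case False
      show ?thesis by (rule that(1)[of i]) (use 3 i nf False in \<open>simp add: rightish_def\<close>)
    qed
  next
    case 4
    then have n: "u - 1 = 5 * i + 2" "u + 1 = 5 * i + 4" by auto
    show ?thesis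
    proof (cases "shifted (i + 1)")
      case True then show ?thesis using n s f that(3) by (auto simp: algebra_simps)
    next
      case False
      then show ?thesis using 4 i s assms that(2)[of i] unfolding leftish_def by auto
    qed
  next
    case 5
    then have n: "u - 1 = 5 * i + 3" "u + 1 = 5 * i + 5" by auto
    show ?thesis
    proof (cases "flag i")
      case True
      then show ?thesis using 5 i s assms that(1)[of i] unfolding rightish_def by auto
    next
      case False
      then show ?thesis using n s f that(3) by (auto simp: algebra_simps)
    qed
  qed
next
  case False
  \<comment> \<open>After the last full segment only gaps of one vertex occur, up to index
    \<open>n\<close>, which is the landmark 0 again.\<close>
  have S5: "S (5 * k)" using S0[of k] shifted_bound[of k] nk n6 by auto
  have S2: "S (5 * k + 2)" if r2: "r \<ge> 2"
  proof (cases "r = 2")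
    case True
    then have "5 * k + 2 = n" using nk(3) by linarith
    then show ?thesis using S_zero by simp
  next
    case False
    then have "r > 2" using r2 by simp
    moreover have "5 * k + 2 < n" using calculation nk(3) by linarith
    ultimately show ?thesis using S_rest[of "5 * k + 2"] by simp
  qed
  have S4: "S (5 * k + 4)" if r4: "r = 4"
  proof -
    have "5 * k + 4 = n" using nk(3) r4 by linarith
    then show ?thesis using S_zero by simp
  qed
  consider "u = 5 * k" | "u = 5 * k + 1" "r \<ge> 2" | "u = 5 * k + 2" "r > 2" | "u = 5 * k + 3" "r = 4"
    using False assms nk by linarith
  then show ?thesis
  proof cases
    case 1
    then show ?thesis using S5 assms(3) by simp
  next
    case 2
    then have "u - 1 = 5 * k" "u + 1 = 5 * k + 2" by auto
    then show ?thesis using that(3) S5 S2[OF 2(2)] by metis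
  next
    case 3
    then show ?thesis using S2 assms(3) by simp
  next
    case 4
    then have eq: "u - 1 = 5 * k + 2" "u + 1 = 5 * k + 4" by auto
    have "S (u - 1)" "S (u + 1)" unfolding eq using S2 S4 4(2) by auto
    then show ?thesis using that(3) by blast
  qed
qed

lemma ear_small: "e y 2 \<Longrightarrow> y = 5 * j + c \<Longrightarrow> 1 \<le> j \<Longrightarrow> j < k \<Longrightarrow> 0 \<le> c \<Longrightarrow> c \<le> 5 \<Longrightarrow> False"
  using ear_cases[of y] nk by auto

text \<open>Applied in both directions, \<open>right_right\<close> makes \<open>u + 1\<close> a hub
  over the gap of \<open>v\<close> and \<open>v + 1\<close> one over the gap of \<open>u\<close>.
  According to the order of the segments, one of these hubs either is good and demands a flag that
  is not set, or lies over a flagged segment without being good. The exceptions are landmarks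
  bounding both gaps and the first segment.\<close>

lemma right_right_conflict:
  assumes "rightish u s" "rightish v t" "u < v" "v < n" "unres u v"
  shows False
proof -
  note D = unresD[OF assms(5)]
  have Su: "S (u + 1)" "S (u - 2)" "S (v + 1)" "S (v - 2)"
    using rightish_S[OF assms(1)] rightish_S[OF assms(2)] by auto
  have b: "0 \<le> s" "s < k" "0 \<le> t" "t < k" using assms unfolding rightish_def by auto
  have "v \<noteq> u + 1" "v \<noteq> u + 2" using D(1,2) Su by auto
  then have uv: "u + 1 \<le> v - 2" using assms(3) by linarith
  have "v + 1 \<noteq> u + n" using D(1) Su S_periodic'[of u] by auto
  moreover have "0 \<le> u" using assms(1) unfolding rightish_def by auto
  ultimately have vn: "v + 1 < u + n" using assms by linarith
  have c1: "e (u + 1) v" "e (u + 1) (v - 1)" "e (u + 1) (v - 2)" if "u + 1 \<noteq> v - 2"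
    using right_right[OF assms(5) Su(1,3,4) _ vn] uv that by auto
  have c2: "e (v + 1) u" "e (v + 1) (u - 1)" "e (v + 1) (u - 2)" if "v + 1 \<noteq> u + n - 2"
  proof -
    have vu: "unres v (u + n)" using unres_sym[OF assms(5)] unres_shift2 by simp
    have x: "u + n + 1 = u + 1 + n" "u + n - 2 = u - 2 + n" "u + n - 1 = u - 1 + n" by auto
    have "v + 1 < u - 2 + n"
    proof (rule ccontr)
      assume "\<not> ?thesis"
      then have "v + 1 = u + n - 1" using that vn by linarith
      then have "v = u - 2 + n" by linarith
      then show False using Su(2) D(2) S_periodic'[of "u - 2"] by simp
    qed
    then have "e (v + 1) (u + n) \<and> e (v + 1) (u + n - 1) \<and> e (v + 1) (u + n - 2)"
      using right_right[OF vu Su(3)] Su S_periodic'[of "u + 1"] S_periodic'[of "u - 2"] assms(3) uv unfolding x by auto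
    then show "e (v + 1) u" "e (v + 1) (u - 1)" "e (v + 1) (u - 2)"
      unfolding x using periodic2 by auto
  qed
  consider (cc) "u = 5 * s + 2" "v = 5 * t + 2" "s < t" "\<not> flag s" "\<not> flag t"
    | (cb) "u = 5 * s + 2" "v = 5 * t + 4" "s < t" "\<not> flag s" "flag t"
    | (bc) "u = 5 * s + 4" "v = 5 * t + 2" "s < t" "flag s" "\<not> flag t"
    | (bb) "u = 5 * s + 4" "v = 5 * t + 4" "s < t" "flag s" "flag t"
    using assms(1-3) unfolding rightish_def by (cases "s = t") auto
  then show False
  proof cases
    case cc
    have "5 * (t - s) \<noteq> 3" by presburger
    then have 1: "e (5 * s + 3) (5 * t + 2)" "e (5 * s + 3) (5 * t + 1)" "e (5 * s + 3) (5 * t)" using c1 cc by (auto simp: algebra_simps)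
    have "v + 1 \<noteq> u + n - 2" using cc nk b by linarith
    then have 2: "e (5 * t + 3) (5 * s + 2)" "e (5 * t + 3) (5 * s)" using c2 cc by (auto simp: algebra_simps)
    \<comment> \<open>The window in \<open>flag\<close> begins behind the segment itself, so a hub
      in an earlier segment enters it with \<open>n\<close> added.\<close>
    have "flag t"
      using cc b good_left[of s t 3] 1 2 nk
      by (intro flagI1[of t "5 * s + 3 + n"])
        (auto simp: periodic3 good_periodic algebra_simps commute[of "5 * s + 3" ] commute[of "n + 5 * s + 3"])
    then show False using cc by simp
  next
    case cb
    have 1: "e (5 * s + 3) (5 * t + 4)" "e (5 * s + 3) (5 * t + 3)" "e (5 * s + 3) (5 * t + 2)" using c1 cb by (auto simp: algebra_simps)
    show False
    proof (cases "v + 1 = u + n - 2")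
      case True
      \<comment> \<open>\<open>v + 1\<close> and \<open>u - 2\<close> are both the landmark 0, so
        that \<open>u = 2\<close> and \<open>v = n - 1\<close>. This pair is the reason for testing
        the edge from 3 to \<open>- 1\<close> in \<open>flag 0\<close>.\<close>
      then have "5 * t + 5 = 5 * s + n" using cb by linarith
      then have s0: "s = 0" and t: "5 * t + 4 = - 1 + n" using b nk by linarith+
      have "e (5 * s + 3) (- 1 + n)" using 1(1) unfolding t .
      then have "flag 0" using s0 periodic2[of 3 "- 1"] unfolding flag_def by simp
      then show False using cb s0 by simp
    next
      case False
      then have 2: "e (5 * t + 5) (5 * s + 2)" "e (5 * t + 5) (5 * s + 1)" "e (5 * t + 5) (5 * s)" using c2 cb by (auto simp: algebra_simps)
      show False
      proof (cases "s = 0")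
        case True
        then show False using ear_small[of "5 * t + 5" t 5] 2 b cb by auto
      next
        case False
        have "flag s"
          using cb b good_anchor[of s "t + 1"] 1 2 nk False
          by (intro flagI1[of s "5 * t + 5"]) (auto simp: algebra_simps)
        then show False using cb by simp
      qed
    qed
  next
    case bc
    have "v + 1 \<noteq> u + n - 2" using bc nk b by linarith
    then have 2: "e (5 * t + 3) (5 * s + 4)" "e (5 * t + 3) (5 * s + 3)" "e (5 * t + 3) (5 * s + 2)" using c2 bc by (auto simp: algebra_simps)
    show False
    proof (cases "s = 0")
      case True
      then show False using ear_small[of "5 * t + 3" t 3] 2 b bc by auto
    next
      case False
      have "good s (5 * t + 3)"
        using flag_right_hub[of s "5 * t + 3"] bc b False nk 2 by auto
      then show False using not_good[of s t 3] bc b by auto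
    qed
  next
    case bb
    have "5 * (t - s) \<noteq> 3" by presburger
    then have "u + 1 \<noteq> v - 2" using bb by auto
    then have 1: "e (5 * s + 5) (5 * t + 4)" "e (5 * s + 5) (5 * t + 3)" "e (5 * s + 5) (5 * t + 2)" using c1 bb by (auto simp: algebra_simps)
    have "good t (5 * s + 5 + n)"
      using flag_right_hub[of t "5 * s + 5 + n"] bb b nk 1 by (auto simp: periodic)
    then show False using not_good_anchor[of "s + 1" t] bb b good_periodic by (simp add: algebra_simps)
  qed
qed

text \<open>Now \<open>v - 1\<close> is a hub over the gap of \<open>u\<close>, and
  \<open>u - 1\<close> one over the gap of \<open>v\<close>. Where goodness decides nothing, both
  hubs together leave no place for the apex that caused the flag of one of the segments.\<close>

lemma left_left_conflict:
  assumes "leftish u s" "leftish v t" "u < v" "v < n" "unres u v"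
  shows False
proof -
  note D = unresD[OF assms(5)]
  have Su: "S (u - 1)" "S (u + 2)" "S (v - 1)" "S (v + 2)"
    using leftish_S[OF assms(1)] leftish_S[OF assms(2)] by auto
  have b: "0 \<le> s" "s < k" "0 \<le> t" "t < k" using assms unfolding leftish_def by auto
  have u0: "1 \<le> u" using assms(1) unfolding leftish_def by auto
  have c1: "e (v - 1) u" "e (v - 1) (u + 1) " "e (v - 1) (u + 2)" if "u + 2 < v - 1"
    using left_left[OF unres_sym[OF assms(5)] Su(3,1,2) that] u0 assms(4) by auto
  have c2: "e (u - 1) v" "e (u - 1) (v + 1)" "e (u - 1) (v + 2)" if "v + 2 < u - 1 + n"
  proof -
    have un: "unres (u + n) v" using assms(5) unres_shift by simp
    have x: "u + n - 1 = u - 1 + n" by simp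
    have Sx: "S (u + n - 1)" unfolding x using Su(1) S_periodic' by simp
    have "v - 1 \<noteq> u" using D(1) Su(3) by auto
    then have "e (u + n - 1) v \<and> e (u + n - 1) (v + 1) \<and> e (u + n - 1) (v + 2)"
      using left_left[OF un Sx Su(3,4)] that assms(3) by auto
    then show "e (u - 1) v" "e (u - 1) (v + 1)" "e (u - 1) (v + 2)" unfolding x periodic by auto
  qed
  consider (cc) "u = 5 * s + 1" "v = 5 * t + 1" "s < t" "\<not> flag s" "\<not> flag t"
    | (cb) "u = 5 * s + 1" "v = 5 * t + 3" "s < t" "\<not> flag s" "flag t"
    | (bc) "u = 5 * s + 3" "v = 5 * t + 1" "s < t" "flag s" "\<not> flag t"
    | (bb) "u = 5 * s + 3" "v = 5 * t + 3" "s < t" "flag s" "flag t"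
    using assms(1-3) unfolding leftish_def by (cases "s = t") auto
  then show False
  proof cases
    case cc
    then have 1: "e (5 * t) (5 * s + 1)" "e (5 * t) (5 * s + 2)" "e (5 * t) (5 * s + 3)" using c1 by (auto simp: algebra_simps)
    show False
    proof (cases "s = 0")
      case True
      then show False using ear_small[of "5 * t" t 0] 1 b cc by auto
    next
      case False
      have "flag s"
        using cc b good_anchor[of s t] 1 nk False by (intro flagI2[of s "5 * t"]) auto
      then show False using cc by simp
    qed
  next
    case cb
    then have 1: "e (5 * t + 2) (5 * s + 1)" "e (5 * t + 2) (5 * s + 2)" "e (5 * t + 2) (5 * s + 3)" using c1 by (auto simp: algebra_simps)
    \<comment> \<open>For \<open>s = 0\<close> the landmarks \<open>u - 1\<close> and
      \<open>v + 2\<close> might both be vertex 0, and the second hub would be missing; the ear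
      excludes this.\<close>
    have s0: "1 \<le> s"
      using ear_small[of "5 * t + 2" t 2] 1 b cb by (cases "s = 0") auto
    then have 2: "e (5 * s) (5 * t + 3)" "e (5 * s) (5 * t + 4)" "e (5 * s) (5 * t + 5)"
      using c2 cb b nk by (auto simp: algebra_simps)
    have tn: "5 * t + 5 \<le> n" and t1: "1 \<le> t" using b nk s0 cb(3) by linarith+
    have 3: "e (5 * t + 2) (5 * s + 1 + n)" "e (5 * t + 2) (5 * s + 2 + n)" "e (5 * t + 2) (5 * s + 3 + n)"
      using 1 periodic2 by auto
    \<comment> \<open>The hubs \<open>5 * s\<close> and \<open>5 * t + 2\<close> fence in the vertex
      \<open>5 * t + 3\<close> from both sides.\<close>
    have nb: "l \<in> {5 * t + 4, 5 * s + n, 5 * s + 1 + n, 5 * t + 2 + n}"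
      if l: "e (5 * t + 3) l" "5 * t + 3 \<le> l" "l < 5 * t + 3 + n" for l
    proof -
      have "\<not> (5 * t + 4 < l \<and> l < 5 * s + n)"
        using nocross[of "5 * t + 3" "5 * t + 4" l "5 * s + n"] l 2(2) cb b tn commute[of "5 * s" "5 * t + 4"] periodic2[of "5 * t + 4" "5 * s"] by auto
      moreover have "\<not> (5 * s + 1 + n < l \<and> l < 5 * t + 2 + n)"
        using nocross[of "5 * s + 1 + n" l "5 * t + 2 + n" "5 * t + 3 + n"] l 1 cb b tn
          commute[of l "5 * t + 3"] commute[of "5 * s + 1" "5 * t + 2"]
          periodic periodic2 by auto
      moreover have "l \<noteq> 5 * t + 3" using l irrefl by auto
      ultimately show ?thesis using l by auto
    qed
    obtain h where h: "5 * t + 4 < h" "h < 5 * t + 1 + n" "e (5 * t + 1) h" "good t h"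
      "e (5 * t + 3) h \<or> e (5 * t) h \<and> e (5 * t + 3) (h - 1) \<and> e (5 * t + 3) (h - 3)"
      using flagE[OF cb(5) t1 b(4)] by blast
    have "\<not> (5 * t + 2 < h \<and> h < 5 * s + 3 + n)"
      using nocross[of "5 * t + 1" "5 * t + 2" h "5 * s + 3 + n"] h 3 cb b tn by auto
    then have "5 * s + 3 + n \<le> h" using h by linarith
    then show False using nb[of h] nb[of "h - 1"] h tn s0 cb by auto
  next
    case bc
    then have 2: "e (5 * s + 2) (5 * t + 1)" "e (5 * s + 2) (5 * t + 2)" "e (5 * s + 2) (5 * t + 3)"
      using c2 b nk by (auto simp: algebra_simps)
    have "flag t"
      using bc b good_left[of s t 2] 2 nk
      by (intro flagI2[of t "5 * s + 2 + n"]) (auto simp: periodic good_periodic)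
    then show False using bc by simp
  next
    case bb
    then have 1: "e (5 * t + 2) (5 * s + 3)" "e (5 * t + 2) (5 * s + 4)" "e (5 * t + 2) (5 * s + 5)"
      using c1 by (auto simp: algebra_simps)
    have 2: "e (5 * s + 2) (5 * t + 3)" "e (5 * s + 2) (5 * t + 4)" "e (5 * s + 2) (5 * t + 5)"
      using c2 b nk bb by (auto simp: algebra_simps)
    have s0: "1 \<le> s"
      using ear_small[of "5 * t + 3" t 3] 2 b bb commute[of 2 "5 * t + 3"] by (cases "s = 0") auto
    have nb: "l \<in> {5 * s + 4, 5 * t + 2, 5 * t + 3, 5 * s + 2 + n}"
      if l: "e (5 * s + 3) l" "5 * s + 3 \<le> l" "l < 5 * s + 3 + n" for l
    proof -
      have "\<not> (5 * s + 4 < l \<and> l < 5 * t + 2)"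
        using nocross[of "5 * s + 3" "5 * s + 4" l "5 * t + 2"] l 1(2) bb b nk commute[of "5 * t + 2" "5 * s + 4"] by auto
      moreover have "\<not> (5 * t + 3 < l \<and> l < 5 * s + 2 + n)"
        using nocross[of "5 * t + 3" l "5 * s + 2 + n" "5 * s + 3 + n"] l 2(1) bb b nk
          commute[of l "5 * s + 3"] commute[of "5 * s + 2" "5 * t + 3"] periodic2 by auto
      moreover have "l \<noteq> 5 * s + 3" using l irrefl by auto
      ultimately show ?thesis using l by auto
    qed
    obtain h where h: "5 * s + 4 < h" "h < 5 * s + 1 + n" "e (5 * s + 1) h" "good s h"
      "e (5 * s + 3) h \<or> e (5 * s) h \<and> e (5 * s + 3) (h - 1) \<and> e (5 * s + 3) (h - 3)"
      using flagE[OF bb(4) s0 b(2)] by blast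
    have ng: "h \<noteq> 5 * t + 2" "h \<noteq> 5 * t + 3" "h \<noteq> 5 * t + 4"
      using not_good[of s t 2] not_good[of s t 3] not_good[of s t 4] h bb b by auto
    have "h \<noteq> 5 * s + 5"
      using nocross[of "5 * s + 1" "5 * s + 2" "5 * s + 5" "5 * t + 3"] h 2 bb b nk by auto
    then show False using nb[of h] nb[of "h - 1"] h ng by auto
  qed
qed

end

context eared_polygon begin

lemma mod_shift: "n \<le> m \<Longrightarrow> m < 2 * n \<Longrightarrow> m mod n = m - n"
  using mod_pos_pos_trivial[of "m - n" n] minus_mod_self2[of m n] by simp

text \<open>The pair flanks an anchor \<open>x\<close> with a flagged segment on its left and an
  unflagged one on its right. The outcomes of \<open>center\<close> then set the flag on the right,
  put a hub that is not good over the segment on the left, or shift the anchor; at vertex 0 they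
  contradict the ear.\<close>

lemma center_conflict:
  assumes "rightish (x - 1) s" "leftish v t" "unres (x - 1) v" "v = x + 1 \<or> v + n = x + 1"
  shows False
proof -
  have b: "0 \<le> s" "s < k" "0 \<le> t" "t < k" using assms(1,2) unfolding rightish_def leftish_def by auto
  have x: "x = 5 * s + 5" "flag s" "\<not> shifted (s + 1)" "v = 5 * t + 1" "\<not> flag t"
  proof -
    have 1: "x - 1 = 5 * s + 2 \<or> x - 1 = 5 * s + 4 \<and> flag s" "v = 5 * t + 1 \<and> \<not> flag t \<or> v = 5 * t + 3"
      using assms(1,2) unfolding rightish_def leftish_def by auto
    have "x - 1 \<noteq> 5 * s + 2"
    proof
      assume a: "x - 1 = 5 * s + 2"
      then have "v = 5 * s + 4 \<or> v + n = 5 * s + 4" using assms(4) by auto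
      then show False using 1(2) b nk five_unique[of s 4 t 1] five_unique[of s 4 t 3] by auto
    qed
    then have s: "x - 1 = 5 * s + 4" "flag s" using 1 by auto
    then have "v = 5 * (s + 1) + 1 \<or> v + n = 5 * s + 6" using assms(4) by auto
    moreover have "v \<noteq> 5 * t + 3"
      using calculation five_unique[of "s + 1" 1 t 3] b nk by auto
    ultimately show "x = 5 * s + 5" "flag s" "v = 5 * t + 1" "\<not> flag t" using 1 s by auto
    show "\<not> shifted (s + 1)" using assms(1) s unfolding rightish_def by auto
  qed
  \<comment> \<open>Either \<open>x\<close> lies between two successive segments, or there is no
    remainder and \<open>x\<close> is the anchor 0 seen from the last segment.\<close>
  have cases: "t = s + 1 \<or> t = 0 \<and> s = k - 1 \<and> n = 5 * k"
  proof (cases "v = x + 1")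
    case True
    then show ?thesis using x by linarith
  next
    case False
    then have "5 * t + n = 5 * s + 5" using x assms(4) by linarith
    then have "t = 0" "s = k - 1" "n = 5 * k" using b nk by linarith+
    then show ?thesis by simp
  qed
  have u: "unres (x - 1) (x + 1)"
    using assms(3,4) unres_shift2[of "x - 1" v] by metis
  have st: "s \<noteq> t" using x by auto
  have n10: "10 \<le> n" using st b nk by linarith
  have SB: "S (x - 3)" using S_seg(2)[OF b(1,2)] x by (simp add: algebra_simps)
  have SC: "S (x + 3)"
  proof -
    have "S (5 * t + 3)" using S_seg(3)[OF b(3,4)] x by simp
    moreover have "x + 3 = 5 * t + 3 \<or> x + 3 = 5 * t + 3 + n" using x assms(4) by auto
    ultimately show ?thesis using S_periodic'[of "5 * t + 3"] by metis
  qed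
  have e1: "e (x - 2) j = e (5 * s + 3) j" "e (x - 3) j = e (5 * s + 2) j" "e j (x - 3) = e j (5 * s + 2)"
    "e j (x - 2) = e j (5 * s + 3)" "e j (x - 1) = e j (5 * s + 4)" for j
    using x by (simp_all add: algebra_simps)
  have n7: "7 \<le> n" using n10 by simp
  show False
    using cases
  proof (elim disjE)
    assume t: "t = s + 1"
    then have e2: "e j (x + 1) = e j (5 * t + 1)" "e j (x + 2) = e j (5 * t + 2)"
      "e j (x + 3) = e j (5 * t + 3)" "e (x + 3) j = e (5 * t + 3) j" for j
      using x by (simp_all add: algebra_simps)
    have t1: "1 \<le> t" and tn: "5 * t + 5 \<le> n" using t b nk by linarith+
    show False
      using n7 u SB SC
    proof (cases rule: center)
      case 1
      have "flag t"
        using 1 t1 good_left[of s t 2] t b tn unfolding e1 e2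
        by (intro flagI2[of t "5 * s + 2 + n"]) (auto simp: periodic good_periodic)
      then show False using x by simp
    next
      case 2
      show False
      proof (cases "s = 0")
        case True
        then show False using 2 t b ear_small[of "5 * t + 3" t 3] unfolding e1 e2 by auto
      next
        case False
        have "good s (5 * t + 3)"
          using flag_right_hub[of s "5 * t + 3"] x b False n10 t 2 unfolding e1 e2 by auto
        then show False using not_good[of s t 3] t b by auto
      qed
    next
      case 3
      then have "shifted t"
        using x t b unfolding shifted_def by (simp add: algebra_simps)
      then show False using x t by simp
    next
      case 4
      have "flag t"
        using 4 t1 good_left[of s t 3] t b tn unfolding e1 e2
        by (intro flagI2[of t "5 * s + 3 + n"]) (auto simp: periodic good_periodic)
      then show False using x by simp
    next
      case (5 m)
      note m = 5
      have mb: "5 * t + 1 < m" "m < 5 * s + 2 + n" using m x t by auto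
      show False
      proof (cases "s = 0")
        case True
        \<comment> \<open>\<open>flag_right_hub\<close> does not cover the first segment. There the
          hub would be a neighbour of the ear, hence vertex 1, and its edge to 8 crosses the edge
          from 3 to \<open>n - 1\<close> that set \<open>flag 0\<close>.\<close>
        then have "e m 2" using m unfolding e1 by simp
        then have "m mod n = 1 \<or> m mod n = 3" using earD by simp
        moreover have "n \<le> m \<Longrightarrow> m mod n = m - n"
          using mb True n10 by (intro mod_shift) linarith+
        moreover have "m < n \<Longrightarrow> m mod n = m" using mb t b by (intro mod_id) auto
        ultimately have "m = n + 1" using mb t True by (cases "m < n") auto
        then have "e 1 8" using m t True periodic3(1)[of 1 8] unfolding e2 by simp
        moreover have "e 3 (n - 1)" using x True periodic2[of 3 "- 1"] unfolding flag_def by simp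
        ultimately show False using nocross[of 1 3 8 "n - 1"] n10 by auto
      next
        case False
        have g: "good s m"
          using flag_right_hub[of s m] x b False mb t m unfolding e1 by auto
        have "m \<noteq> x + 2" using g not_good[of s t 2] t b x by auto
        then have Q: "e m (x + 2)" using m by auto
        \<comment> \<open>Passing from segment \<open>s\<close> to \<open>s + 1\<close>, only the
          anchor \<open>5 * t\<close> stops being good. Once it is excluded, \<open>m\<close> is
          good for \<open>t\<close> as well and demands the missing flag.\<close>
        have "m mod n \<noteq> 5 * t"
        proof
          assume "m mod n = 5 * t"
          moreover have "n \<le> m \<Longrightarrow> m mod n = m - n"
            using mb t b nk by (intro mod_shift) linarith+
          moreover have "m < n \<Longrightarrow> m mod n = m" using mb t b by (intro mod_id) auto
          ultimately show False using mb t by (cases "m < n") auto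
        qed
        moreover obtain z where z: "z = m mod n" by simp
        ultimately have "z \<noteq> 5 * (s + 1)" using t by simp
        moreover have "z mod 5 = 0 \<and> 5 * s < z \<and> z \<le> 5 * k \<or> z = 0 \<and> r = 0 \<or>
            z < 5 * s \<and> (z mod 5 = 2 \<or> z mod 5 = 3)"
          using g unfolding good_def Let_def z by simp
        moreover have "\<lbrakk>z mod 5 = 0; 5 * s < z; z \<noteq> 5 * (s + 1)\<rbrakk> \<Longrightarrow> 5 * (s + 1) < z" by presburger
        ultimately have "good t m" unfolding good_def Let_def z[symmetric] t by auto
        moreover have "m \<noteq> 5 * t + 2" using \<open>m \<noteq> x + 2\<close> x t by auto
        ultimately have "flag t"
          using m Q mb t t1 b unfolding e2
          by (intro flagI2[of t m]) auto
        then show False using x by simp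
      qed
    qed
  next
    assume w: "t = 0 \<and> s = k - 1 \<and> n = 5 * k"
    then have xn: "x = n" and s1: "1 \<le> s" using x b st by auto
    have e2: "e j (x + 1) = e j 1" "e j (x + 2) = e j 2" "e j (x + 3) = e j 3" "e (x + 3) j = e 3 j"
       "e x j = e 0 j" for j
      unfolding xn using periodic3[of j] periodic3(1)[of _ j] periodic[of 0 j] by simp_all
    have no: False if "e y 2" "y = 5 * s + 2 \<or> y = 5 * s + 3 \<or> y = 5 * s + 4 \<or> y = 0" for y
      using ear_cases[of y] that w s1 by auto
    show False
      using n7 u SB SC
    proof (cases rule: center)
      case 1
      then show False using no unfolding e1 e2 by blast
    next
      case 2
      then have "e 3 (5 * s + 4)" unfolding e1 e2 by simp
      moreover have "5 * s + 4 = - 1 + n" using w by linarith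
      ultimately have "e 3 (- 1)" using periodic2[of 3 "- 1"] by simp
      then have "flag 0" unfolding flag_def by simp
      then show False using x w by simp
    next
      case 3
      then show False using no unfolding e1 e2 by blast
    next
      case 4
      then show False using no unfolding e1 e2 by blast
    next
      case (5 m)
      show False
      proof (cases "m = x + 2")
        case True
        then have "e 2 (5 * s + 4)" using 5(5) periodic3(1)[of 2] xn unfolding e1 by (simp add: add.commute)
        then show False using no[of "5 * s + 4"] commute[of 2 "5 * s + 4"] by simp
      next
        case False
        then have "e m 2" using 5 unfolding e2 by auto
        then have "m mod n = 1 \<or> m mod n = 3" using earD by simp
        moreover have "m mod n = m - n"
          using 5(1,2) xn n10 by (intro mod_shift) linarith+
        ultimately have "m = n + 3" using 5(1) xn by auto
        then show False using 5(8) xn irrefl by auto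
      qed
    qed
  qed
qed

text \<open>The hub \<open>v + 3\<close> of \<open>gap1_right\<close> is the next anchor if the
  segment is unflagged, so a flag was due; in a flagged segment it is \<open>5 * i + 7\<close>,
  which is good only if it is the ear. The first segment is settled by the ear directly.\<close>

lemma gap_right_conflict:
  assumes "unres u v" "S (u - 1)" "S (u + 1)" "rightish v i" "0 \<le> u" "u < n"
  shows False
proof -
  have b: "0 \<le> i" "i < k" "0 \<le> v" "v < n" using assms(4) nk unfolding rightish_def by auto
  have Sv: "S (v + 1)" "S (v - 2)" using rightish_S[OF assms(4)] by auto
  have "u \<noteq> v" using unresD(5)[OF assms(1)] by auto
  have *: "(u = v + 2 \<or> u + n = v + 2) \<and> e (v + 3) v \<and> e (v + 3) (v - 1) \<and> e (v + 3) (v - 2)"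
  proof (cases "u < v")
    case True
    then show ?thesis using gap1_right[OF n6 assms(1-3) Sv True] b assms by auto
  next
    case False
    have x: "v + n + 1 = v + 1 + n" "v + n - 2 = v - 2 + n" "v + n + 3 = v + 3 + n" "v + n - 1 = v - 1 + n" by auto
    have "unres u (v + n)" using assms(1) unres_shift2 by simp
    moreover have "S (v + n + 1)" "S (v + n - 2)" unfolding x using Sv S_periodic' by simp_all
    moreover have "u < v + n" "v + n < u + n" using False b assms \<open>u \<noteq> v\<close> by linarith+
    ultimately have "u + n = v + n + 2 \<and> e (v + n + 3) (v + n) \<and> e (v + n + 3) (v + n - 1) \<and> e (v + n + 3) (v + n - 2)"
      using gap1_right[OF n6 _ assms(2,3)] by blast
    then show ?thesis unfolding x periodic periodic2 by auto
  qed
  then have h: "e (v + 3) v" "e (v + 3) (v - 1)" "e (v + 3) (v - 2)" by auto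
  show False
  proof (cases "v = 5 * i + 2")
    case True
    then have nf: "\<not> flag i" using assms(4) unfolding rightish_def by auto
    have h': "e (5 * i + 5) (5 * i + 2)" "e (5 * i + 5) (5 * i + 1)" "e (5 * i + 5) (5 * i)"
      using h True by (simp_all add: algebra_simps)
    show False
    proof (cases "i = 0")
      case True
      then show False using ear_cases[of 5] h' n6 by auto
    next
      case False
      have "flag i"
        using h' False b good_anchor[of i "i + 1"] side'(4)[of "5 * i + 4" "5 * i + 3"] side'(5)[of "5 * i + 3" "5 * i + 2"] n6
        by (intro flagI1[of i "5 * i + 5"]) (auto simp: algebra_simps)
      then show False using nf by simp
    qed
  next
    case False
    then have v: "v = 5 * i + 4" "flag i" using assms(4) unfolding rightish_def by auto
    have h': "e (5 * i + 7) (5 * i + 2)" "e (5 * i + 7) (5 * i + 3)" "e (5 * i + 7) (5 * i + 4)"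
      using h v by (simp_all add: algebra_simps)
    show False
    proof (cases "i = 0")
      case True
      then have "7 mod n = 1 \<or> 7 mod n = 3" using earD[of 7] h' by simp
      then have "n = 6"
      proof -
        have "n = 6" if "7 < n" using that \<open>7 mod n = 1 \<or> 7 mod n = 3\<close> by simp
        moreover have "n \<noteq> 7" using \<open>7 mod n = 1 \<or> 7 mod n = 3\<close> by auto
        ultimately show ?thesis using n6 by linarith
      qed
      then have "u = 0" using * v True assms by auto
      then show False using unresD(1)[OF assms(1)] S_zero by simp
    next
      case False
      have "good i (5 * i + 7)" using flag_right_hub[of i "5 * i + 7"] h' v b n6 False by auto
      then have "(5 * i + 7) mod n = 2" using good_next[of i] b False by auto
      then have "e 2 (5 * i + 4)" using h'(3) cong1[of "5 * i + 7" 2] n6 by auto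
      then show False using ear_cases[of "5 * i + 4"] commute[of 2 "5 * i + 4"] v b False by auto
    qed
  qed
qed

text \<open>The hub \<open>v - 3\<close> is a candidate of the preceding segment in the unflagged
  case, so a flag was due, and the segment's own anchor in the flagged case, which
  \<open>flag_no_left_hub\<close> excludes.\<close>

lemma gap_left_conflict:
  assumes "unres u v" "S (u - 1)" "S (u + 1)" "leftish v i" "0 \<le> u" "u < n"
  shows False
proof -
  have b: "0 \<le> i" "i < k" "0 \<le> v" "v < n" using assms(4) nk unfolding leftish_def by auto
  have Sv: "S (v - 1)" "S (v + 2)" using leftish_S[OF assms(4)] by auto
  have "u \<noteq> v" using unresD(5)[OF assms(1)] by auto
  have h: "e (v - 3) v \<and> e (v - 3) (v + 1) \<and> e (v - 3) (v + 2)"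
  proof (cases "v < u")
    case True
    then show ?thesis using gap1_left[OF n6 assms(1-3) Sv True] b assms by auto
  next
    case False
    have x: "u + n + 1 = u + 1 + n" "u + n - 1 = u - 1 + n" by auto
    have "unres (u + n) v" using assms(1) unres_shift by simp
    moreover have "S (u + n - 1)" "S (u + n + 1)" unfolding x using assms S_periodic' by simp_all
    moreover have "v < u + n" "u + n < v + n" using False b assms \<open>u \<noteq> v\<close> by linarith+
    ultimately show ?thesis using gap1_left[OF n6 _ _ _ Sv] by blast
  qed
  show False
  proof (cases "v = 5 * i + 1")
    case True
    then have nf: "\<not> flag i" using assms(4) unfolding leftish_def by auto
    have h': "e (5 * i - 2) (5 * i + 1)" "e (5 * i - 2) (5 * i + 2)" "e (5 * i - 2) (5 * i + 3)"
      using h True by (simp_all add: algebra_simps)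
    show False
    proof (cases "i = 0")
      case True
      then have "e (- 2 + n) 2" using h' periodic[of "- 2" 2] by simp
      then show False using ear_cases[of "- 2 + n"] n6 by auto
    next
      case False
      have "good i (5 * i - 2)" using good_left[of "i - 1" i 3] b False by (simp add: algebra_simps)
      then have "flag i"
        using h' False b n6
        by (intro flagI2[of i "5 * i - 2 + n"]) (auto simp: periodic good_periodic)
      then show False using nf by simp
    qed
  next
    case False
    then have v: "v = 5 * i + 3" "flag i" using assms(4) unfolding leftish_def by auto
    then show False using flag_no_left_hub[of i] h b by (auto simp: algebra_simps)
  qed
qed

text \<open>The edges from the old anchor \<open>5 * i\<close> to \<open>5 * i + 2\<close> and
  \<open>5 * i + 3\<close> shut in the vertices under them.\<close>

lemma shifted_nb:
  assumes "shifted i"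
  shows "e (5 * i + 1) y \<Longrightarrow> y mod n = 5 * i \<or> y mod n = 5 * i + 2"
    and "e (5 * i + 2) y \<Longrightarrow> y mod n \<in> {5 * i, 5 * i + 1, 5 * i + 3}"
proof -
  have i: "1 \<le> i" "i < k" "e (5 * i) (5 * i + 2)" "e (5 * i) (5 * i + 3)"
    using assms unfolding shifted_def by auto
  have m: "(5 * i + c) mod n = 5 * i + c" if "0 \<le> c" "c \<le> 3" for c using i that nk by (intro mod_id) linarith+
  show "e (5 * i + 1) y \<Longrightarrow> y mod n = 5 * i \<or> y mod n = 5 * i + 2"
  proof -
    assume y: "e (5 * i + 1) y"
    obtain l where l: "5 * i \<le> l" "l < 5 * i + n" "l mod n = y mod n" using window by blast
    then have e: "e (5 * i + 1) l" using y cong1[of l y] commute by metis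
    then have "l \<le> 5 * i + 2" using confined[of "5 * i" "5 * i + 2" "5 * i + 1" l] i l n6 by auto
    moreover have "l \<noteq> 5 * i + 1" using e irrefl by auto
    ultimately have "l = 5 * i + 0 \<or> l = 5 * i + 2" using l by auto
    then show ?thesis using l m[of 0] m[of 2] by auto
  qed
  show "e (5 * i + 2) y \<Longrightarrow> y mod n \<in> {5 * i, 5 * i + 1, 5 * i + 3}"
  proof -
    assume y: "e (5 * i + 2) y"
    obtain l where l: "5 * i \<le> l" "l < 5 * i + n" "l mod n = y mod n" using window by blast
    then have e: "e (5 * i + 2) l" using y cong1[of l y] commute by metis
    then have "l \<le> 5 * i + 3" using confined[of "5 * i" "5 * i + 3" "5 * i + 2" l] i l n6 by auto
    moreover have "l \<noteq> 5 * i + 2" using e irrefl by auto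
    ultimately have "l = 5 * i + 0 \<or> l = 5 * i + 1 \<or> l = 5 * i + 3" using l by auto
    then show ?thesis using l m[of 0] m[of 1] m[of 3] by auto
  qed
qed

lemma shifted_nb':
  assumes "shifted i" "w = 5 * i + 1 \<or> w = 5 * i + 2" "e w y"
  obtains c where "0 \<le> c" "c \<le> 3" "y mod n = 5 * i + c"
proof -
  have "y mod n = 5 * i + 0 \<or> y mod n = 5 * i + 1 \<or> y mod n = 5 * i + 2 \<or> y mod n = 5 * i + 3"
    using shifted_nb[OF assms(1), of y] assms(2,3) by auto
  then show thesis using that[of 0] that[of 1] that[of 2] that[of 3] by linarith
qed

text \<open>The gap of three is harmless because it is nearly enclosed: the only landmark that
  \<open>5 * i + 1\<close> or \<open>5 * i + 2\<close> can see is \<open>5 * i + 3\<close>, while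
  \<open>5 * i\<close> sees three landmarks that no other vertex sees together.\<close>

lemma shifted_conflict:
  assumes "shifted i" "u \<in> {5 * i, 5 * i + 1, 5 * i + 2}" "0 \<le> v" "v < n" "unres u v"
  shows False
proof -
  note D = unresD[OF assms(5)]
  have i: "1 \<le> i" "i < k" "e (5 * i) (5 * i - 3)" "e (5 * i) (5 * i + 2)" "e (5 * i) (5 * i + 3)"
    "flag (i - 1)" "\<not> flag i"
    using assms unfolding shifted_def by auto
  have Si: "S (5 * i - 3)" "S (5 * i - 1)" "\<not> S (5 * i)" "\<not> S (5 * i + 1)" "\<not> S (5 * i + 2)" "S (5 * i + 3)"
    using S_seg[of i] S_seg[of "i - 1"] i assms(1) by (simp_all add: algebra_simps)
  \<comment> \<open>A second vertex joined to \<open>5 * i - 1\<close> would be shut in by the chord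
    from \<open>5 * i - 3\<close> to \<open>5 * i\<close>, out of reach of the landmark
    \<open>5 * i + 3\<close>.\<close>
  have uS: "u = 5 * i \<Longrightarrow> False" if "unres u v" for u v
  proof -
    assume u: "u = 5 * i"
    note D = unresD[OF that]
    have ev: "e v (5 * i - 3)" "e v (5 * i - 1)" "e v (5 * i + 3)"
      using D(3) Si i side'(2)[of "5 * i"] unfolding u by auto
    obtain l where l: "5 * i - 3 \<le> l" "l < 5 * i - 3 + n" "l mod n = v mod n" using window by blast
    have el: "e l (5 * i - 3)" "e l (5 * i - 1)" "e l (5 * i + 3)" using ev cong1[OF l(3)] by auto
    have "l \<le> 5 * i"
      using confined[of "5 * i - 3" "5 * i" "5 * i - 1" l] i(3) el(2) l n6
        commute[of "5 * i" "5 * i - 3"] commute[of l "5 * i - 1"] by auto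
    moreover have "l \<noteq> 5 * i" using D(5) l(3) u by auto
    moreover have "l \<noteq> 5 * i - 3" using el irrefl by auto
    moreover have "\<not> (5 * i - 3 < l \<and> l < 5 * i)"
    proof
      assume a: "5 * i - 3 < l \<and> l < 5 * i"
      show False
      proof (cases "n = 6")
        case True
        then show False using i nk by linarith
      next
        case False
        then show False
          using nocross[of "5 * i - 3" l "5 * i" "5 * i + 3"] a i(3) el(3) n6 commute[of "5 * i" "5 * i - 3"] by auto
      qed
    qed
    ultimately show False using l by linarith
  qed
  show False
  proof (cases "u = 5 * i")
    case True
    then show False using uS assms(5) by blast
  next
    case u0: False
    have u12: "u = 5 * i + 1 \<or> u = 5 * i + 2" using u0 assms(2) by auto
    show False
      using assms(3,4) D(2)
    proof (cases rule: classify)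
      case (4 j)
      have j: "1 \<le> j" "j < k" "flag (j - 1)" using 4(1) unfolding shifted_def by auto
      have v0: "v \<noteq> 5 * j"
      proof
        assume v: "v = 5 * j"
        have ev: "e v (5 * j - 3)" "S (5 * j - 3)" "e v (5 * j - 1)" "S (5 * j - 1)"
          using 4(1) v S_seg[of "j - 1"] j side'(2)[of "5 * j"] unfolding shifted_def by (auto simp: algebra_simps)
        have mods: "(5 * j - 3) mod n = 5 * (j - 1) + 2" "(5 * j - 1) mod n = 5 * (j - 1) + 4"
          using j nk by (simp_all add: mod_pos_pos_trivial)
        have eu: "e u (5 * j - 3)" "e u (5 * j - 1)" using D(4) ev by auto
        obtain c where "0 \<le> c" "c \<le> 3" "(5 * j - 1) mod n = 5 * i + c"
          using shifted_nb'[OF assms(1) u12 eu(2)] .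
        then show False using five_unique[of i c "j - 1" 4] mods by auto
      qed
      have ij: "i \<noteq> j"
      proof
        assume "i = j"
        then have "{u, v} = {5 * i + 1, 5 * i + 2}" using u0 v0 4(2) assms(2) D(5) by auto
        moreover have "e (5 * i + 2) (5 * i + 3)" "\<not> e (5 * i + 1) (5 * i + 3)"
          using side'(4)[of "5 * i + 3" "5 * i + 2"] shifted_nb(1)[OF assms(1), of "5 * i + 3"] i nk
          by (auto simp: mod_pos_pos_trivial)
        ultimately show False using D(3)[OF Si(6)] D(4)[OF Si(6)] by (auto simp: doubleton_eq_iff)
      qed
      have m3: "(5 * i + 3) mod n = 5 * i + 3" "(5 * j + 3) mod n = 5 * j + 3" using i j nk by (auto simp: mod_pos_pos_trivial)
      have Sj: "S (5 * j + 3)" using S_seg[of j] 4(1) j unfolding shifted_def by auto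
      have eb: "e (5 * i + 2) (5 * i + 3)" "e (5 * j + 2) (5 * j + 3)"
        using side'(4)[of "5 * i + 3" "5 * i + 2"] side'(4)[of "5 * j + 3" "5 * j + 2"] by auto
      have "u \<noteq> 5 * i + 2"
      proof
        assume "u = 5 * i + 2"
        then have "e v (5 * i + 3)" using D(3)[OF Si(6)] eb by auto
        moreover have "v = 5 * j + 1 \<or> v = 5 * j + 2" using v0 4(2) by auto
        ultimately obtain c where "0 \<le> c" "c \<le> 3" "(5 * i + 3) mod n = 5 * j + c"
          using shifted_nb'[OF 4(1)] by blast
        then show False using five_unique[of i 3 j c] m3 ij by auto
      qed
      moreover have "v \<noteq> 5 * j + 2"
      proof
        assume "v = 5 * j + 2"
        then have "e u (5 * j + 3)" using D(4)[OF Sj] eb by auto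
        then obtain c where "0 \<le> c" "c \<le> 3" "(5 * j + 3) mod n = 5 * i + c"
          using shifted_nb'[OF assms(1) u12] by blast
        then show False using five_unique[of i c j 3] m3 ij by auto
      qed
      ultimately have uv: "u = 5 * i + 1" "v = 5 * j + 1" using assms(2) 4(2) u0 v0 by auto
      have mi: "(5 * i - 1) mod n = 5 * (i - 1) + 4" using i nk by (simp add: mod_pos_pos_trivial)
      \<comment> \<open>\<open>u\<close> is two steps from the moved anchor
        \<open>5 * i - 1\<close>, so \<open>v\<close> must be too. The chord from
        \<open>5 * i - 3\<close> to \<open>5 * i\<close> admits a middle vertex only for
        \<open>j = i - 1\<close>, but the shift of segment \<open>i\<close> needs the flag of
        \<open>i - 1\<close> and the shift of \<open>j\<close> forbids it.\<close>
      have nv: "\<not> e v (5 * i - 1)"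
        using shifted_nb(1)[OF 4(1), of "5 * i - 1"] uv mi five_unique[of "i - 1" 4 j 0] five_unique[of "i - 1" 4 j 2] by auto
      obtain m where m: "e v m" "e m (5 * i - 1)"
        using unres_close[OF unres_sym[OF assms(5)] Si(2) _ _ nv, of "5 * i" 0] uv
          side'(3)[of "5 * i"] side'(2)[of "5 * i"] by auto
      have mm: "m mod n = 5 * j \<or> m mod n = 5 * j + 2" using shifted_nb(1)[OF 4(1)] m uv by auto
      obtain l where l: "5 * i - 3 \<le> l" "l < 5 * i - 3 + n" "l mod n = m mod n" using window by blast
      have el: "e l (5 * i - 1)" using m cong1[OF l(3)] by simp
      have "l \<le> 5 * i"
        using confined[of "5 * i - 3" "5 * i" "5 * i - 1" l] i(3) el l n6
          commute[of "5 * i" "5 * i - 3"] commute[of l "5 * i - 1"] by auto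
      moreover have "l mod n = l" using calculation l i nk by (intro mod_id) linarith+
      ultimately have "5 * i - 3 \<le> 5 * j \<and> 5 * j \<le> 5 * i \<or> 5 * i - 3 \<le> 5 * j + 2 \<and> 5 * j + 2 \<le> 5 * i" using mm l by auto
      then have "j = i - 1" using ij by linarith
      then show False using 4(1) i unfolding shifted_def by auto
    next
      case (1 j)
      have Sv: "S (v + 1)" "e v (v + 1)" using rightish_S[OF 1] side by auto
      have "e u (v + 1)" using D(4) Sv by auto
      then have "(v + 1) mod n = 5 * i + 3"
      proof -
        have "(v + 1) mod n \<in> {5 * i, 5 * i + 1, 5 * i + 2, 5 * i + 3}"
          using shifted_nb[OF assms(1)] \<open>e u (v + 1)\<close> assms(2) u0 by auto
        moreover have "S ((v + 1) mod n)" using Sv S_cong[of "(v + 1) mod n" "v + 1"] by simp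
        ultimately show ?thesis using Si by auto
      qed
      moreover have "(v + 1) mod n = (if v + 1 = n then 0 else v + 1)" using assms(3,4) by auto
      ultimately have "v = 5 * i + 2" using i by (auto split: if_splits)
      then show False using 1 assms(1) five_unique[of i 2 j 2] five_unique[of i 2 j 4] unfolding rightish_def by auto
    next
      case (2 j)
      have Sv: "S (v - 1)" "e v (v - 1)" using leftish_S[OF 2] side'(2)[of v] by auto
      have v1: "(v - 1) mod n = v - 1" using 2 nk unfolding leftish_def by (intro mod_id) auto
      have "e u (v - 1)" using D(4) Sv by auto
      then obtain c where c: "0 \<le> c" "c \<le> 3" "v - 1 = 5 * i + c"
        using shifted_nb'[OF assms(1) u12, of "v - 1"] v1 by auto
      have "S (5 * i + c)" using Sv(1) c(3) by simp
      moreover have "c = 0 \<or> c = 1 \<or> c = 2 \<or> c = 3" using c by linarith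
      ultimately have "c = 3" using Si by auto
      then have "v = 5 * i + 4" using c by simp
      then show False using 2 five_unique[of i 4 j 1] five_unique[of i 4 j 3] unfolding leftish_def by auto
    next
      case 3
      have eu: "e u (v - 1)" "e u (v + 1)" using D(4) 3 side'(2)[of v] side[of v] by auto
      have A: "x mod n = 5 * i + 3" if "S x" "e u x" for x
      proof -
        have "x mod n \<in> {5 * i, 5 * i + 1, 5 * i + 2, 5 * i + 3}"
          using shifted_nb[OF assms(1)] that assms(2) u0 by auto
        moreover have "S (x mod n)" using that S_cong[of "x mod n" x] by simp
        ultimately show ?thesis using Si by auto
      qed
      have "(v - 1) mod n = (v + 1) mod n" using A[OF 3(1) eu(1)] A[OF 3(2) eu(2)] by simp
      then have "n dvd 2" using mod_eq_dvd_iff[of "v + 1" n "v - 1"] by simp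
      then show False using n6 zdvd_imp_le[of n 2] by simp
    qed
  qed
qed

theorem resolved:
  assumes "0 \<le> u" "u < n" "0 \<le> v" "v < n"
  shows "\<not> unres u v"
proof
  assume uv: "unres u v"
  note vu = unres_sym[OF uv]
  note D = unresD[OF uv]
  have ne: "u \<noteq> v" using D(5) by auto
  \<comment> \<open>A right end and a left end can only flank a common vertex, possibly across index
    \<open>n\<close>.\<close>
  have RL: False if "rightish a i" "leftish b j" "unres a b" "0 \<le> a" "a < n" "0 \<le> b" "b < n" for a b i j
  proof -
    have s: "S (a + 1)" "S (b - 1)" using rightish_S[OF that(1)] leftish_S[OF that(2)] by auto
    have "b = a + 2 \<or> b + n = a + 2"
    proof (cases "a < b")
      case True
      then show ?thesis using right_left[OF that(3) s] that by auto
    next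
      case False
      have "a \<noteq> b" using unresD(5)[OF that(3)] by auto
      then have l: "a < b + n" "b + n < a + n" using False that by linarith+
      have x: "b + n - 1 = b - 1 + n" by simp
      have sb: "S (b + n - 1)" unfolding x S_periodic' by (rule s(2))
      have "unres a (b + n)" using that(3) unres_shift2 by simp
      then show ?thesis using right_left[OF _ s(1) sb l] by simp
    qed
    then have "b = a + 1 + 1 \<or> b + n = a + 1 + 1" by linarith
    then show False
      using center_conflict[of "a + 1" i b j] that(1-3) by simp
  qed
  show False
    using assms(1,2) D(1)
  proof (cases rule: classify)
    case (4 i)
    then show False using shifted_conflict[OF 4(1,2) assms(3,4) uv] by simp
  next
    case (1 i)
    note u = 1
    show False using assms(3,4) D(2)
    proof (cases rule: classify)
      case (4 j) then show False using shifted_conflict[OF 4(1,2) assms(1,2) vu] by simp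
    next
      case (1 j)
      then show False
        using right_right_conflict[OF u 1 _ assms(4) uv] right_right_conflict[OF 1 u _ assms(2) vu] ne by linarith
    next
      case (2 j) then show False using RL u uv assms by blast
    next
      case 3 then show False using gap_right_conflict[OF vu 3 u assms(3,4)] by simp
    qed
  next
    case (2 i)
    note u = 2
    show False using assms(3,4) D(2)
    proof (cases rule: classify)
      case (4 j) then show False using shifted_conflict[OF 4(1,2) assms(1,2) vu] by simp
    next
      case (2 j)
      then show False
        using left_left_conflict[OF u 2 _ assms(4) uv] left_left_conflict[OF 2 u _ assms(2) vu] ne by linarith
    next
      case (1 j) then show False using RL u vu assms by blast
    next
      case 3 then show False using gap_left_conflict[OF vu 3 u assms(3,4)] by simp
    qed
  next
    case 3
    note u = 3
    show False using assms(3,4) D(2)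
    proof (cases rule: classify)
      case (4 j) then show False using shifted_conflict[OF 4(1,2) assms(1,2) vu] by simp
    next
      case (1 j) then show False using gap_right_conflict[OF uv u 1 assms(1,2)] by simp
    next
      case (2 j) then show False using gap_left_conflict[OF uv u 2 assms(1,2)] by simp
    next
      case 3
      then show False
        using gap1_gap1[OF n6 uv u 3] gap1_gap1[OF n6 vu 3 u] ne assms by linarith
    qed
  qed
qed

end

section \<open>Outerplanar drawings and crossing-free orders\<close>


lemma frontier_outside_not_inside:
  fixes D :: "complex set"
  assumes "x \<in> frontier (outside D)" "K \<subseteq> D" "open (inside K)"
  shows "x \<notin> inside K"
proof
  assume "x \<in> inside K"
  moreover have "x \<in> closure (outside D)" using assms(1) by (simp add: frontier_def)
  ultimately have "inside K \<inter> outside D \<noteq> {}"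
    using assms(3) by (meson disjoint_iff open_Int_closure_eq_empty)
  then show False using outside_mono[OF assms(2)] inside_Int_outside[of K] by blast
qed

lemma two_arcs_loop:
  fixes g h :: "real \<Rightarrow> complex"
  assumes "arc g" "arc h" "pathstart h = pathstart g" "pathfinish h = pathfinish g"
    "path_image g \<inter> path_image h = {pathstart g, pathfinish g}"
  shows "simple_path (g +++ reversepath h)" "pathfinish (g +++ reversepath h) = pathstart (g +++ reversepath h)"
    "path_image (g +++ reversepath h) = path_image g \<union> path_image h"
  using assms by (auto simp: simple_path_join_loop_eq arc_reversepath path_image_join)

lemma two_arcs_inside:
  fixes g h :: "real \<Rightarrow> complex"
  assumes "arc g" "arc h" "pathstart h = pathstart g" "pathfinish h = pathfinish g"
    "path_image g \<inter> path_image h = {pathstart g, pathfinish g}"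
  shows "inside (path_image g \<union> path_image h) \<noteq> {}" "open (inside (path_image g \<union> path_image h))"
    "connected (inside (path_image g \<union> path_image h))" "open (outside (path_image g \<union> path_image h))"
    "frontier (inside (path_image g \<union> path_image h)) = path_image g \<union> path_image h"
  using Jordan_inside_outside[OF two_arcs_loop(1,2)[OF assms]] unfolding two_arcs_loop(3)[OF assms] by auto

lemma winding_number_two_arcs:
  fixes g h :: "real \<Rightarrow> complex"
  assumes "arc g" "arc h" "pathstart h = pathstart g" "pathfinish h = pathfinish g"
    "z \<notin> path_image g" "z \<notin> path_image h"
  shows "winding_number (g +++ reversepath h) z = winding_number g z - winding_number h z"
  using assms by (simp add: winding_number_join winding_number_reversepath arc_imp_path)

lemma connected_in_outside:
  fixes K T :: "complex set"
  assumes "connected T" "T \<inter> K = {}" "open (inside K)" "open (outside K)" "x \<in> T" "x \<in> outside K"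
  shows "T \<subseteq> outside K"
proof -
  have "T \<subseteq> inside K \<union> outside K" using assms(2) inside_Un_outside[of K] by blast
  then show ?thesis
    using connectedD[OF assms(1,3,4)] inside_Int_outside[of K] assms(5,6) by blast
qed

text \<open>A boundary point of the inside of \<open>K\<close> that lies outside \<open>L\<close>
  has points of this inside nearby; connectedness then carries the whole inside of \<open>K\<close>
  along.\<close>

lemma inside_between:
  fixes K L :: "complex set"
  assumes "connected (inside K)" "frontier (inside K) = K" "inside K \<inter> L = {}"
    "open (inside L)" "open (outside L)" "x \<in> K" "x \<in> outside L"
  shows "inside K \<subseteq> outside L"
proof -
  have "x \<in> closure (inside K)" using assms(2,6) unfolding frontier_def by blast
  then have "inside K \<inter> outside L \<noteq> {}"
    using assms(5,7) by (metis disjoint_iff open_Int_closure_eq_empty inf_commute)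
  then show ?thesis using connected_in_outside[OF assms(1,3,4,5)] by blast
qed

text \<open>If no arc lay inside the loop of the other two, the inside of the first loop would lie outside
  the other two, contradicting additivity of winding numbers.\<close>

lemma theta_arcs:
  fixes g1 g2 g3 :: "real \<Rightarrow> complex"
  assumes arcs: "arc g1" "arc g2" "arc g3"
    and ends: "pathstart g1 = p" "pathfinish g1 = q" "pathstart g2 = p" "pathfinish g2 = q"
      "pathstart g3 = p" "pathfinish g3 = q"
    and int: "path_image g1 \<inter> path_image g2 = {p, q}" "path_image g2 \<inter> path_image g3 = {p, q}"
      "path_image g1 \<inter> path_image g3 = {p, q}"
    and x1: "x1 \<in> path_image g1 - {p, q}" "x1 \<notin> inside (path_image g2 \<union> path_image g3)"
    and x2: "x2 \<in> path_image g2 - {p, q}" "x2 \<notin> inside (path_image g1 \<union> path_image g3)"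
    and x3: "x3 \<in> path_image g3 - {p, q}" "x3 \<notin> inside (path_image g1 \<union> path_image g2)"
  shows False
proof -
  note J12 = two_arcs_inside[OF arcs(1,2), unfolded ends, simplified, OF int(1)]
  note J23 = two_arcs_inside[OF arcs(2,3), unfolded ends, simplified, OF int(2)]
  note J13 = two_arcs_inside[OF arcs(1,3), unfolded ends, simplified, OF int(3)]
  have out: "x \<in> outside K" if "x \<notin> K" "x \<notin> inside K" for x :: complex and K
    using that inside_Un_outside[of K] by blast
  have n: "x1 \<notin> path_image g2 \<union> path_image g3" "x2 \<notin> path_image g1 \<union> path_image g3"
    "x3 \<notin> path_image g1 \<union> path_image g2"
    using x1(1) x2(1) x3(1) int by blast+
  note o1 = out[OF n(1) x1(2)] and o2 = out[OF n(2) x2(2)] and o3 = out[OF n(3) x3(2)]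
  have "path_image g3 - {p, q} \<subseteq> outside (path_image g1 \<union> path_image g2)"
  proof (rule connected_in_outside[OF _ _ J12(2,4) x3(1) o3])
    show "connected (path_image g3 - {p, q})"
      using connected_simple_path_endless[OF arc_imp_simple_path[OF arcs(3)]] ends by simp
    show "(path_image g3 - {p, q}) \<inter> (path_image g1 \<union> path_image g2) = {}" using int by blast
  qed
  moreover have "{p, q} \<subseteq> path_image g1" using ends pathstart_in_path_image[of g1] pathfinish_in_path_image[of g1] by auto
  moreover have "inside (path_image g1 \<union> path_image g2) \<inter> (path_image g1 \<union> path_image g2) = {}"
    using inside_no_overlap[of "path_image g1 \<union> path_image g2"] by blast
  ultimately have d: "inside (path_image g1 \<union> path_image g2) \<inter> path_image g1 = {}"
      "inside (path_image g1 \<union> path_image g2) \<inter> path_image g2 = {}"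
      "inside (path_image g1 \<union> path_image g2) \<inter> path_image g3 = {}"
    using inside_Int_outside[of "path_image g1 \<union> path_image g2"] by blast+
  have "inside (path_image g1 \<union> path_image g2) \<subseteq> outside (path_image g2 \<union> path_image g3)"
    by (rule inside_between[OF J12(3,5) _ J23(2,4) _ o1]) (use d x1(1) in blast)+
  moreover have "inside (path_image g1 \<union> path_image g2) \<subseteq> outside (path_image g1 \<union> path_image g3)"
    by (rule inside_between[OF J12(3,5) _ J13(2,4) _ o2]) (use d x2(1) in blast)+
  moreover obtain w where w: "w \<in> inside (path_image g1 \<union> path_image g2)" using J12(1) by blast
  ultimately have wo: "w \<in> outside (path_image g2 \<union> path_image g3)" "w \<in> outside (path_image g1 \<union> path_image g3)" by auto
  have wn: "w \<notin> path_image g1" "w \<notin> path_image g2" "w \<notin> path_image g3" using w d by blast+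
  note L12 = two_arcs_loop[OF arcs(1,2), unfolded ends, simplified, OF int(1)]
  note L23 = two_arcs_loop[OF arcs(2,3), unfolded ends, simplified, OF int(2)]
  note L13 = two_arcs_loop[OF arcs(1,3), unfolded ends, simplified, OF int(3)]
  have "winding_number (g2 +++ reversepath g3) w = 0"
    by (rule winding_number_zero_in_outside[OF simple_path_imp_path[OF L23(1)]])
      (use L23(3) wo ends in auto)
  moreover have "winding_number (g1 +++ reversepath g3) w = 0"
    by (rule winding_number_zero_in_outside[OF simple_path_imp_path[OF L13(1)]])
      (use L13(3) wo ends in auto)
  ultimately have "winding_number (g1 +++ reversepath g2) w = 0"
    using winding_number_two_arcs[of g1 g2 w] winding_number_two_arcs[of g2 g3 w]
      winding_number_two_arcs[of g1 g3 w] arcs ends wn by simp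
  moreover have "cmod (winding_number (g1 +++ reversepath g2) w) = 1"
    by (rule simple_closed_path_norm_winding_number_inside[OF L12(1)]) (use L12(3) w ends in auto)
  ultimately show False by simp
qed

text \<open>The arc \<open>g3\<close> splits the inside of the loop of \<open>g1\<close> and
  \<open>g2\<close>. The open arc \<open>l\<close> is connected and avoids \<open>g3\<close>, so it
  stays in one of the two parts; its end point on the opposite side then lies in the closure of that
  part, although it is neither in that part nor on its boundary.\<close>

lemma crossing_chords_arcs:
  fixes g1 g2 g3 l :: "real \<Rightarrow> complex"
  assumes arcs: "arc g1" "arc g2" "arc g3" "arc l"
    and ends: "pathstart g1 = p" "pathfinish g1 = q" "pathstart g2 = p" "pathfinish g2 = q"
      "pathstart g3 = p" "pathfinish g3 = q" "pathstart l = b" "pathfinish l = d"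
    and int: "path_image g1 \<inter> path_image g2 = {p, q}" "path_image g2 \<inter> path_image g3 = {p, q}"
      "path_image g1 \<inter> path_image g3 = {p, q}"
    and l: "path_image l \<inter> (path_image g1 \<union> path_image g2) = {b, d}" "path_image l \<inter> path_image g3 = {}"
    and b: "b \<in> path_image g1 - {p, q}" "b \<notin> inside (path_image g2 \<union> path_image g3)"
    and d: "d \<in> path_image g2 - {p, q}" "d \<notin> inside (path_image g1 \<union> path_image g3)"
    and c3: "path_image g3 \<inter> inside (path_image g1 \<union> path_image g2) \<noteq> {}"
    and cl: "path_image l \<inter> inside (path_image g1 \<union> path_image g2) \<noteq> {}"
  shows False
proof -
  note J12 = two_arcs_inside[OF arcs(1,2), unfolded ends, simplified, OF int(1)]
  note J23 = two_arcs_inside[OF arcs(2,3), unfolded ends, simplified, OF int(2)]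
  note J13 = two_arcs_inside[OF arcs(1,3), unfolded ends, simplified, OF int(3)]
  have pq: "p \<noteq> q" using arc_distinct_ends[OF arcs(1)] ends by simp
  obtain disj: "inside (path_image g1 \<union> path_image g3) \<inter> inside (path_image g2 \<union> path_image g3) = {}"
    and un: "inside (path_image g1 \<union> path_image g3) \<union> inside (path_image g2 \<union> path_image g3) \<union>
      (path_image g3 - {p, q}) = inside (path_image g1 \<union> path_image g2)"
    by (rule split_inside_simple_closed_curve[OF arc_imp_simple_path[OF arcs(1)] ends(1,2)
        arc_imp_simple_path[OF arcs(2)] ends(3,4) arc_imp_simple_path[OF arcs(3)] ends(5,6) pq int(1,3,2) c3])
  let ?l = "path_image l - {b, d}"
  have conn: "connected ?l"
    using connected_simple_path_endless[OF arc_imp_simple_path[OF arcs(4)]] ends by simp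
  have dis: "?l \<inter> (path_image g1 \<union> path_image g2) = {}" "?l \<inter> path_image g3 = {}" using l by blast+
  have "?l \<subseteq> inside (path_image g1 \<union> path_image g2) \<union> outside (path_image g1 \<union> path_image g2)"
    using dis(1) inside_Un_outside[of "path_image g1 \<union> path_image g2"] by blast
  moreover have "?l \<inter> inside (path_image g1 \<union> path_image g2) \<noteq> {}"
    using cl l inside_no_overlap[of "path_image g1 \<union> path_image g2"] by blast
  ultimately have "?l \<subseteq> inside (path_image g1 \<union> path_image g2)"
    using connectedD[OF conn J12(2,4)] inside_Int_outside[of "path_image g1 \<union> path_image g2"] by blast
  then have "?l \<subseteq> inside (path_image g1 \<union> path_image g3) \<union> inside (path_image g2 \<union> path_image g3)"
    using un dis(2) by blast
  then consider "?l \<subseteq> inside (path_image g1 \<union> path_image g3)" | "?l \<subseteq> inside (path_image g2 \<union> path_image g3)"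
    using connectedD[OF conn J13(2) J23(2)] disj by blast
  moreover have cl2: "{b, d} \<subseteq> closure ?l"
  proof -
    have "?l = l ` {0<..<1}"
      using simple_path_endless[OF arc_imp_simple_path[OF arcs(4)]] ends by simp
    moreover have "l ` closure {0<..<1} \<subseteq> closure (l ` {0<..<1})"
      by (rule image_closure_subset)
        (use arc_imp_path[OF arcs(4)] closure_subset[of "l ` {0<..<1}"] in \<open>auto simp: path_def\<close>)
    ultimately have "path_image l \<subseteq> closure ?l" unfolding path_image_def by simp
    then show ?thesis using ends pathstart_in_path_image[of l] pathfinish_in_path_image[of l] by auto
  qed
  ultimately show False
  proof cases
    case 1
    then have "d \<in> closure (inside (path_image g1 \<union> path_image g3))" using cl2 closure_mono by blast
    then have "d \<in> inside (path_image g1 \<union> path_image g3) \<union> (path_image g1 \<union> path_image g3)"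
      using J13 closure_Un_frontier by metis
    then show False using d int by blast
  next
    case 2
    then have "b \<in> closure (inside (path_image g2 \<union> path_image g3))" using cl2 closure_mono by blast
    then have "b \<in> inside (path_image g2 \<union> path_image g3) \<union> (path_image g2 \<union> path_image g3)"
      using J23 closure_Un_frontier by metis
    then show False using b int by blast
  qed
qed

section \<open>Paths of the graph drawn as arcs\<close>

fun path_edges :: "'a list \<Rightarrow> 'a set set" where
  "path_edges (x # y # zs) = insert {x, y} (path_edges (y # zs))"
| "path_edges _ = {}"

definition graph_path :: "'a set set \<Rightarrow> 'a list \<Rightarrow> bool" where
  "graph_path E xs \<longleftrightarrow> xs \<noteq> [] \<and> distinct xs \<and> successively (\<lambda>x y. {x, y} \<in> E) xs"

lemma path_edges_append: "path_edges (xs @ b # ys) = path_edges (xs @ [b]) \<union> path_edges (b # ys)"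
  by (induction xs rule: path_edges.induct) auto

lemma path_edges_subset: "e \<in> path_edges xs \<Longrightarrow> e \<subseteq> set xs"
  by (induction xs rule: path_edges.induct) auto

lemma path_edges_graph: "successively (\<lambda>x y. {x, y} \<in> E) xs \<Longrightarrow> path_edges xs \<subseteq> E"
  by (induction xs rule: path_edges.induct) auto

lemma path_edges_Union: "length xs \<ge> 2 \<Longrightarrow> \<Union> (path_edges xs) = set xs"
proof (induction xs rule: path_edges.induct)
  case (1 x y zs)
  then show ?case by (cases zs) auto
qed auto

text \<open>Keeps paths with the same two ends edge-disjoint, since an edge common to them could
  only join these ends.\<close>

lemma path_edges_ends:
  assumes "distinct xs" "length xs \<ge> 3"
  shows "{hd xs, last xs} \<notin> path_edges xs"
proof -
  obtain x y z zs where xs: "xs = x # y # z # zs"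
    using assms(2) by (auto simp: numeral_3_eq_3 Suc_le_length_iff)
  have "x \<notin> set (y # z # zs)" "last (y # z # zs) \<noteq> y" using assms(1) unfolding xs by auto
  moreover have "last xs \<in> set (y # z # zs)" unfolding xs using last_in_set[of "y # z # zs"] by simp
  ultimately show ?thesis
    using path_edges_subset[of "{hd xs, last xs}" "y # z # zs"] unfolding xs
    by (auto simp: doubleton_eq_iff)
qed

locale outer_drawing =
  fixes V :: "'a set" and E :: "'a set set" and pos :: "'a \<Rightarrow> complex" and crv :: "'a set \<Rightarrow> real \<Rightarrow> complex"
  assumes edges: "\<And>f. f \<in> E \<Longrightarrow> f \<subseteq> V"
    and drawing: "plane_drawing V E pos crv"
    and outer: "\<And>v. v \<in> V \<Longrightarrow> pos v \<in> frontier (outside (drawing_points V E pos crv))"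
begin

definition trace :: "'a list \<Rightarrow> complex set" where
  "trace xs = (\<Union>f\<in>path_edges xs. path_image (crv f))"

lemma pos_inj: "x \<in> V \<Longrightarrow> y \<in> V \<Longrightarrow> pos x = pos y \<Longrightarrow> x = y"
  using drawing unfolding plane_drawing_def inj_on_def by blast

lemma crv_arc: "f \<in> E \<Longrightarrow> arc (crv f)"
  and crv_ends: "f \<in> E \<Longrightarrow> {pathstart (crv f), pathfinish (crv f)} = pos ` f"
  and crv_vertices: "f \<in> E \<Longrightarrow> path_image (crv f) \<inter> pos ` V = pos ` f"
  and crv_disjoint: "f \<in> E \<Longrightarrow> g \<in> E \<Longrightarrow> f \<noteq> g \<Longrightarrow> path_image (crv f) \<inter> path_image (crv g) \<subseteq> pos ` (f \<inter> g)"
  using drawing unfolding plane_drawing_def by blast+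

lemma edge_arc:
  assumes "{x, y} \<in> E"
  obtains g where "arc g" "pathstart g = pos x" "pathfinish g = pos y" "path_image g = path_image (crv {x, y})"
proof (cases "pathstart (crv {x, y}) = pos x")
  case True
  moreover have "pathfinish (crv {x, y}) = pos y"
    using crv_ends[OF assms] True arc_distinct_ends[OF crv_arc[OF assms]] by (auto simp: doubleton_eq_iff)
  ultimately show ?thesis using that crv_arc[OF assms] by blast
next
  case False
  then have "pathstart (crv {x, y}) = pos y" "pathfinish (crv {x, y}) = pos x"
    using crv_ends[OF assms] by (auto simp: doubleton_eq_iff)
  then show ?thesis
    using that[of "reversepath (crv {x, y})"] crv_arc[OF assms] by (simp add: arc_reversepath)
qed

lemma trace_inter:
  assumes "path_edges xs \<subseteq> E" "path_edges ys \<subseteq> E" "path_edges xs \<inter> path_edges ys = {}"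
  shows "trace xs \<inter> trace ys \<subseteq> pos ` (set xs \<inter> set ys)"
proof
  fix z assume "z \<in> trace xs \<inter> trace ys"
  then obtain f g where fg: "f \<in> path_edges xs" "g \<in> path_edges ys" "z \<in> path_image (crv f)" "z \<in> path_image (crv g)"
    unfolding trace_def by blast
  then have "z \<in> pos ` (f \<inter> g)" using crv_disjoint[of f g] assms by blast
  then show "z \<in> pos ` (set xs \<inter> set ys)" using path_edges_subset fg by blast
qed

lemma trace_vertices:
  assumes "path_edges xs \<subseteq> E" "length xs \<ge> 2"
  shows "trace xs \<inter> pos ` V = pos ` set xs"
proof -
  have "trace xs \<inter> pos ` V = (\<Union>f\<in>path_edges xs. path_image (crv f) \<inter> pos ` V)" unfolding trace_def by blast
  also have "\<dots> = (\<Union>f\<in>path_edges xs. pos ` f)"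
    by (rule SUP_cong[OF refl]) (use crv_vertices assms(1) in blast)
  also have "\<dots> = pos ` set xs" unfolding path_edges_Union[OF assms(2), symmetric] by blast
  finally show ?thesis .
qed

lemma trace_subset: "path_edges xs \<subseteq> E \<Longrightarrow> trace xs \<subseteq> drawing_points V E pos crv"
  unfolding trace_def drawing_points_def by blast

lemma path_arc:
  assumes "graph_path E xs" "length xs \<ge> 2"
  obtains g where "arc g" "pathstart g = pos (hd xs)" "pathfinish g = pos (last xs)" "path_image g = trace xs"
proof -
  have "\<exists>g. arc g \<and> pathstart g = pos (hd xs) \<and> pathfinish g = pos (last xs) \<and> path_image g = trace xs"
    using assms
  proof (induction xs rule: path_edges.induct)
    case (1 x y zs)
    have E: "{x, y} \<in> E" using 1(2) unfolding graph_path_def by simp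
    obtain g where g: "arc g" "pathstart g = pos x" "pathfinish g = pos y" "path_image g = path_image (crv {x, y})"
      using edge_arc[OF E] by blast
    show ?case
    proof (cases zs)
      case Nil
      then show ?thesis using g unfolding trace_def by auto
    next
      case (Cons z ws)
      have gp: "graph_path E (y # zs)" using 1(2) unfolding graph_path_def by simp
      obtain h where h: "arc h" "pathstart h = pos y" "pathfinish h = pos (last (y # zs))" "path_image h = trace (y # zs)"
        using 1(1)[OF gp] Cons by auto
      have pe: "path_edges [x, y] \<subseteq> E" "path_edges (y # zs) \<subseteq> E"
        using E path_edges_graph[of E "y # zs"] gp unfolding graph_path_def by auto
      have dx: "x \<notin> set (y # zs)" using 1(2) unfolding graph_path_def by simp
      then have "{x, y} \<notin> path_edges (y # zs)" using path_edges_subset by blast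
      then have "trace [x, y] \<inter> trace (y # zs) \<subseteq> pos ` (set [x, y] \<inter> set (y # zs))"
        using trace_inter[OF pe] by simp
      also have "set [x, y] \<inter> set (y # zs) = {y}" using dx by auto
      finally have "path_image g \<inter> path_image h \<subseteq> {pathstart h}"
        using g h unfolding trace_def by simp
      then have "arc (g +++ h)" using arc_join g h by metis
      moreover have "path_image (g +++ h) = trace (x # y # zs)"
        using g h by (simp add: path_image_join trace_def)
      ultimately show ?thesis using g h by (intro exI[of _ "g +++ h"]) auto
    qed
  qed auto
  then show thesis using that by blast
qed

lemma not_inside:
  assumes "v \<in> V" "path_edges xs \<subseteq> E" "path_edges ys \<subseteq> E" "open (inside (trace xs \<union> trace ys))"
  shows "pos v \<notin> inside (trace xs \<union> trace ys)"
  using frontier_outside_not_inside[OF outer[OF assms(1)] _ assms(4)] trace_subset[OF assms(2)] trace_subset[OF assms(3)]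
  by blast

lemma path_edges_E: "graph_path E xs \<Longrightarrow> path_edges xs \<subseteq> E"
  unfolding graph_path_def using path_edges_graph by blast

lemma graph_path_V: "graph_path E xs \<Longrightarrow> length xs \<ge> 2 \<Longrightarrow> set xs \<subseteq> V"
  using path_edges_Union[of xs] path_edges_E[of xs] edges by blast

lemma trace_inter_ends:
  assumes "graph_path E xs" "graph_path E ys" "length xs \<ge> 3" "length ys \<ge> 2"
    and "hd xs = u" "last xs = v" "hd ys = u" "last ys = v" "set xs \<inter> set ys = {u, v}"
  shows "trace xs \<inter> trace ys = {pos u, pos v}"
proof -
  have "path_edges xs \<inter> path_edges ys = {}"
  proof (rule ccontr)
    assume "path_edges xs \<inter> path_edges ys \<noteq> {}"
    then obtain f where f: "f \<in> path_edges xs" "f \<in> path_edges ys" by blast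
    then have sub: "f \<subseteq> {u, v}" using path_edges_subset assms(9) by blast
    have "card f = 2" using f(1) assms(1) unfolding graph_path_def
      by (induction xs rule: path_edges.induct) auto
    moreover have "card {u, v} \<le> 2" by (cases "u = v") auto
    ultimately have "f = {u, v}" using card_seteq[of "{u, v}" f] sub by simp
    then show False using f path_edges_ends[of xs] assms unfolding graph_path_def by auto
  qed
  then have "trace xs \<inter> trace ys \<subseteq> {pos u, pos v}"
    using trace_inter[OF path_edges_E[OF assms(1)] path_edges_E[OF assms(2)]] assms(9) by auto
  moreover have "pos ` set xs \<subseteq> trace xs" "pos ` set ys \<subseteq> trace ys"
    using trace_vertices[OF path_edges_E[OF assms(1)]] trace_vertices[OF path_edges_E[OF assms(2)]] assms by auto
  ultimately show ?thesis using assms(9) by blast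
qed

lemma middle_vertex:
  assumes w: "graph_path E ws" "length ws \<ge> 3" "hd ws = u" "last ws = v"
  shows "\<exists>x\<in>V. pos x \<in> trace ws - {pos u, pos v}"
proof -
  have V: "set ws \<subseteq> V" using graph_path_V[OF w(1)] w(2) by simp
  obtain x y rest where e: "ws = x # y # rest" "rest \<noteq> []"
    using w(2) by (auto simp: numeral_3_eq_3 Suc_le_length_iff)
  have x: "x = u" "v \<in> set rest" using w(3,4) e by auto
  have "distinct ws" using w(1) unfolding graph_path_def by simp
  then have y: "y \<noteq> u" "y \<noteq> v" using e x by auto
  have yV: "y \<in> V" "u \<in> V" "v \<in> V" using V e x by auto
  have "pos y \<in> trace ws"
    using trace_vertices[OF path_edges_E[OF w(1)]] w(2) e by auto
  then show ?thesis using pos_inj[OF yV(1,2)] pos_inj[OF yV(1,3)] y yV(1) by (intro bexI[of _ y]) auto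
qed

text \<open>The first two paths have inner vertices, which lie on the outer face and hence not
  inside any loop of edges. By \<open>theta_arcs\<close> the third path is the enclosed one; it may
  be a single edge, as only a point \<open>w\<close> of it is used.\<close>

lemma theta_arcs_in_drawing:
  assumes gp: "graph_path E xs" "graph_path E ys" "graph_path E zs"
    and len: "length xs \<ge> 3" "length ys \<ge> 3" "length zs \<ge> 2"
    and hd: "hd xs = u" "hd ys = u" "hd zs = u" and last: "last xs = v" "last ys = v" "last zs = v"
    and int: "set xs \<inter> set ys = {u, v}" "set ys \<inter> set zs = {u, v}" "set xs \<inter> set zs = {u, v}"
    and w: "w \<in> trace zs - {pos u, pos v}"
  shows "w \<in> inside (trace xs \<union> trace ys)"
proof (rule ccontr)
  assume n: "w \<notin> inside (trace xs \<union> trace ys)"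
  note E = gp[THEN path_edges_E]
  obtain g1 where g1: "arc g1" "pathstart g1 = pos u" "pathfinish g1 = pos v" "path_image g1 = trace xs"
    using path_arc[OF gp(1)] len hd last by auto
  obtain g2 where g2: "arc g2" "pathstart g2 = pos u" "pathfinish g2 = pos v" "path_image g2 = trace ys"
    using path_arc[OF gp(2)] len hd last by auto
  obtain g3 where g3: "arc g3" "pathstart g3 = pos u" "pathfinish g3 = pos v" "path_image g3 = trace zs"
    using path_arc[OF gp(3)] len hd last by auto
  have i12: "trace xs \<inter> trace ys = {pos u, pos v}"
    using trace_inter_ends[OF gp(1,2)] len hd last int by auto
  have i23: "trace ys \<inter> trace zs = {pos u, pos v}"
    using trace_inter_ends[OF gp(2,3)] len hd last int by auto
  have i13: "trace xs \<inter> trace zs = {pos u, pos v}"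
    using trace_inter_ends[OF gp(1,3)] len hd last int by auto
  obtain x1 where x1: "x1 \<in> V" "pos x1 \<in> trace xs - {pos u, pos v}"
    using middle_vertex[OF gp(1) len(1) hd(1) last(1)] by blast
  obtain x2 where x2: "x2 \<in> V" "pos x2 \<in> trace ys - {pos u, pos v}"
    using middle_vertex[OF gp(2) len(2) hd(2) last(2)] by blast
  have op: "open (inside (trace ys \<union> trace zs))" "open (inside (trace xs \<union> trace zs))"
    using two_arcs_inside(2)[of g2 g3] two_arcs_inside(2)[of g1 g3] g1 g2 g3 i23 i13 by simp_all
  show False
    using theta_arcs[OF g1(1) g2(1) g3(1) g1(2,3) g2(2,3) g3(2,3), of "pos x1" "pos x2" w]
      not_inside[OF x1(1) E(2,3) op(1)] not_inside[OF x2(1) E(1,3) op(2)] x1 x2 w n i12 i23 i13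
    unfolding g1(4) g2(4) g3(4) by auto
qed

text \<open>Excludes subdivisions of K_{2,3}: the third path would be enclosed by the other two
  together with its inner vertex.\<close>

lemma no_theta:
  assumes gp: "graph_path E xs" "graph_path E ys" "graph_path E zs"
    and len: "length xs \<ge> 3" "length ys \<ge> 3" "length zs \<ge> 3"
    and hd: "hd xs = u" "hd ys = u" "hd zs = u" and last: "last xs = v" "last ys = v" "last zs = v"
    and int: "set xs \<inter> set ys = {u, v}" "set ys \<inter> set zs = {u, v}" "set xs \<inter> set zs = {u, v}"
  shows False
proof -
  obtain y where yV: "y \<in> V" and "pos y \<in> trace zs - {pos u, pos v}"
    using middle_vertex[OF gp(3) len(3) hd(3) last(3)] by blast
  then have "pos y \<in> inside (trace xs \<union> trace ys)"
    using theta_arcs_in_drawing[OF gp len(1,2) _ hd last int] len(3) by auto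
  moreover have "open (inside (trace xs \<union> trace ys))"
  proof -
    obtain g1 where g1: "arc g1" "pathstart g1 = pos u" "pathfinish g1 = pos v" "path_image g1 = trace xs"
      using path_arc[OF gp(1)] len hd last by auto
    obtain g2 where g2: "arc g2" "pathstart g2 = pos u" "pathfinish g2 = pos v" "path_image g2 = trace ys"
      using path_arc[OF gp(2)] len hd last by auto
    have "trace xs \<inter> trace ys = {pos u, pos v}"
      using trace_inter_ends[OF gp(1,2)] len hd last int by auto
    then show ?thesis using two_arcs_inside(2)[of g1 g2] g1 g2 by simp
  qed
  ultimately show False using not_inside[OF yV path_edges_E[OF gp(1)] path_edges_E[OF gp(2)]] by blast
qed

end

lemma graph_path_rev: "graph_path E (rev xs) = graph_path E xs"
  unfolding graph_path_def by (simp add: successively_rev insert_commute)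

lemma graph_path_append:
  "graph_path E (xs @ ys) \<longleftrightarrow> (if xs = [] then graph_path E ys else if ys = [] then graph_path E xs else
     graph_path E xs \<and> graph_path E ys \<and> {last xs, hd ys} \<in> E \<and> set xs \<inter> set ys = {})"
  unfolding graph_path_def by (auto simp: successively_append_iff)

lemma graph_path_Cons:
  "graph_path E (x # xs) \<longleftrightarrow> xs = [] \<or> graph_path E xs \<and> {x, hd xs} \<in> E \<and> x \<notin> set xs"
  unfolding graph_path_def by (auto simp: successively_Cons)

lemma graph_path_prefix: "graph_path E (xs @ ys) \<Longrightarrow> xs \<noteq> [] \<Longrightarrow> graph_path E xs"
  and graph_path_suffix: "graph_path E (xs @ ys) \<Longrightarrow> ys \<noteq> [] \<Longrightarrow> graph_path E ys"
  unfolding graph_path_append by (simp_all split: if_splits)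

lemma path_edges_rev: "path_edges (rev xs) = path_edges xs"
proof (induction xs rule: path_edges.induct)
  case (1 x y zs)
  then show ?case using path_edges_append[of "rev zs" y "[x]"] by (auto simp: insert_commute)
qed auto

text \<open>Two adjacent vertices count as a cycle, which gives the search for a longest cycle its
  starting point.\<close>

definition graph_cycle :: "'a set set \<Rightarrow> 'a list \<Rightarrow> bool" where
  "graph_cycle E xs \<longleftrightarrow> graph_path E xs \<and> length xs \<ge> 2 \<and> {last xs, hd xs} \<in> E"

lemma graph_cycle_rotate: "graph_cycle E (xs @ ys) \<Longrightarrow> graph_cycle E (ys @ xs)"
  unfolding graph_cycle_def graph_path_append
  by (cases "xs = []"; cases "ys = []") (auto simp: graph_path_append Int_commute)

context outer_drawing begin

text \<open>A chord is a third path between two vertices of the cycle, so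
  \<open>theta_arcs_in_drawing\<close> places it inside.\<close>

lemma chord_inside:
  assumes gp: "graph_path E xs" "graph_path E ys" and ac: "{a, c} \<in> E" "a \<noteq> c"
    and len: "length xs \<ge> 3" "length ys \<ge> 3"
    and "hd xs = a" "hd ys = a" "last xs = c" "last ys = c" "set xs \<inter> set ys = {a, c}"
  shows "path_image (crv {a, c}) \<inter> inside (trace xs \<union> trace ys) \<noteq> {}"
    "trace xs \<inter> path_image (crv {a, c}) = {pos a, pos c}" "trace ys \<inter> path_image (crv {a, c}) = {pos a, pos c}"
proof -
  have gz: "graph_path E [a, c]" using ac unfolding graph_path_def by simp
  have t: "trace [a, c] = path_image (crv {a, c})" unfolding trace_def by simp
  have mem: "a \<in> set xs" "c \<in> set xs" "a \<in> set ys" "c \<in> set ys" using assms by auto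
  have i: "set ys \<inter> set [a, c] = {a, c}" "set xs \<inter> set [a, c] = {a, c}" using mem by auto
  obtain g where g: "arc g" "pathstart g = pos a" "pathfinish g = pos c" "path_image g = path_image (crv {a, c})"
    using edge_arc[OF ac(1)] by blast
  have "path_image g - {pos a, pos c} \<noteq> {}"
    using nonempty_simple_path_endless[OF arc_imp_simple_path[OF g(1)]] g by simp
  then obtain w where "w \<in> trace [a, c] - {pos a, pos c}" using g t by auto
  moreover from this have "w \<in> inside (trace xs \<union> trace ys)"
    using theta_arcs_in_drawing[OF gp gz len, of a c w] assms i by auto
  ultimately show "path_image (crv {a, c}) \<inter> inside (trace xs \<union> trace ys) \<noteq> {}" using t by blast
  show "trace xs \<inter> path_image (crv {a, c}) = {pos a, pos c}" "trace ys \<inter> path_image (crv {a, c}) = {pos a, pos c}"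
    using trace_inter_ends[OF gp(1) gz len(1), of a c] trace_inter_ends[OF gp(2) gz len(2), of a c] assms i t by simp_all
qed

text \<open>Both chords run inside the cycle, where the first separates the ends of the second. This
  excludes the subdivisions of K_4 formed by a cycle and two interleaved chords.\<close>

lemma no_crossing_chords:
  assumes "graph_cycle E (a # q @ b # r @ c # s @ d # t)" "{a, c} \<in> E" "{b, d} \<in> E"
  shows False
proof -
  let ?C = "a # q @ b # r @ c # s @ d # t"
  have gC: "graph_path E ?C" using assms(1) unfolding graph_cycle_def by simp
  then have dist: "distinct ?C" unfolding graph_path_def by simp
  have rot: "graph_path E (c # s @ d # t @ a # q @ b # r)"
    using graph_cycle_rotate[of E "a # q @ b # r" "c # s @ d # t"] assms(1) unfolding graph_cycle_def by simp
  \<comment> \<open>The first two are the parts into which the chord from \<open>a\<close> to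
    \<open>c\<close> divides the cycle, the last two those for the chord from \<open>b\<close> to
    \<open>d\<close>; some are reversed so that the ends match.\<close>
  let ?x = "a # q @ b # r @ [c]" and ?y = "rev (c # s @ d # t @ [a])"
    and ?z = "b # r @ c # s @ [d]" and ?w = "rev (d # t @ a # q @ [b])"
  have g1: "graph_path E ?x"
    by (rule graph_path_prefix[of E _ "s @ d # t"]) (use gC in simp_all)
  have "graph_path E (c # s @ d # t @ [a])"
    by (rule graph_path_prefix[of E _ "q @ b # r"]) (use rot in simp_all)
  then have g2: "graph_path E ?y" unfolding graph_path_rev .
  have bt: "graph_path E (b # r @ c # s @ d # t)"
    by (rule graph_path_suffix[of E "a # q"]) (use gC in simp_all)
  have g3: "graph_path E ?z"
    by (rule graph_path_prefix[of E _ t]) (use bt in simp_all)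
  have dr: "graph_path E (d # t @ a # q @ b # r)"
    by (rule graph_path_suffix[of E "c # s"]) (use rot in simp_all)
  have "graph_path E (d # t @ a # q @ [b])"
    by (rule graph_path_prefix[of E _ r]) (use dr in simp_all)
  then have g4: "graph_path E ?w" unfolding graph_path_rev .
  note g = g1 g2 g3 g4
  have ne: "a \<noteq> c" "b \<noteq> d" "{a, c} \<noteq> {b, d}" "{a, c} \<inter> {b, d} = {}" using dist by auto
  have "set ?x = {a, c} \<union> set (q @ b # r)" "set ?y = {a, c} \<union> set (s @ d # t)"
    "set ?z = {b, d} \<union> set (r @ c # s)" "set ?w = {b, d} \<union> set (t @ a # q)" by auto
  moreover have "set (q @ b # r) \<inter> set (s @ d # t) = {}" "set (r @ c # s) \<inter> set (t @ a # q) = {}"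
    "a \<notin> set (q @ b # r) \<union> set (s @ d # t)" "c \<notin> set (q @ b # r) \<union> set (s @ d # t)"
    "b \<notin> set (r @ c # s) \<union> set (t @ a # q)" "d \<notin> set (r @ c # s) \<union> set (t @ a # q)"
    using dist by auto
  ultimately have sxy: "set ?x \<inter> set ?y = {a, c}" and szw: "set ?z \<inter> set ?w = {b, d}" by blast+
  have len: "length ?x \<ge> 3" "length ?y \<ge> 3" "length ?z \<ge> 3" "length ?w \<ge> 3" by simp_all
  have he: "hd ?x = a" "hd ?y = a" "last ?x = c" "last ?y = c" "hd ?z = b" "hd ?w = b" "last ?z = d" "last ?w = d"
    by simp_all
  note ac = chord_inside[OF g1 g2 assms(2) ne(1) len(1,2) he(1-4) sxy]
    and bd = chord_inside[OF g3 g4 assms(3) ne(2) len(3,4) he(5-8) szw]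
  have pe: "path_edges ?x = path_edges (a # q @ [b]) \<union> path_edges (b # r @ [c])"
    "path_edges ?y = path_edges (c # s @ [d]) \<union> path_edges (d # t @ [a])"
    "path_edges ?z = path_edges (b # r @ [c]) \<union> path_edges (c # s @ [d])"
    "path_edges ?w = path_edges (d # t @ [a]) \<union> path_edges (a # q @ [b])"
    unfolding path_edges_rev
    using path_edges_append[of "a # q" b "r @ [c]"] path_edges_append[of "c # s" d "t @ [a]"]
      path_edges_append[of "b # r" c "s @ [d]"] path_edges_append[of "d # t" a "q @ [b]"] by simp_all
  have un: "trace ?z \<union> trace ?w = trace ?x \<union> trace ?y"
    unfolding trace_def pe by (simp only: UN_Un Un_ac)
  have xy: "trace ?x \<inter> trace ?y = {pos a, pos c}"
    using trace_inter_ends[OF g1 g2 len(1) _ he(1,3,2,4) sxy] len by simp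
  have V: "b \<in> V" "d \<in> V" "a \<in> V" "c \<in> V" using edges assms(2,3) by auto
  have pn: "pos b \<noteq> pos a" "pos b \<noteq> pos c" "pos d \<noteq> pos a" "pos d \<noteq> pos c"
    using pos_inj[OF V(1,3)] pos_inj[OF V(1,4)] pos_inj[OF V(2,3)] pos_inj[OF V(2,4)] dist by auto
  have bx: "pos b \<in> trace ?x" "pos d \<in> trace ?y"
    using trace_vertices[OF path_edges_E[OF g1]] trace_vertices[OF path_edges_E[OF g2]] len by auto
  have cr: "path_image (crv {b, d}) \<inter> path_image (crv {a, c}) = {}"
    using crv_disjoint[OF assms(3,2)] ne by auto
  obtain k1 where k1: "arc k1" "pathstart k1 = pos a" "pathfinish k1 = pos c" "path_image k1 = trace ?x"
    using path_arc[OF g(1)] by auto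
  obtain k2 where k2: "arc k2" "pathstart k2 = pos a" "pathfinish k2 = pos c" "path_image k2 = trace ?y"
    using path_arc[OF g(2)] by auto
  obtain k3 where k3: "arc k3" "pathstart k3 = pos a" "pathfinish k3 = pos c" "path_image k3 = path_image (crv {a, c})"
    using edge_arc[OF assms(2)] by blast
  obtain l where l: "arc l" "pathstart l = pos b" "pathfinish l = pos d" "path_image l = path_image (crv {b, d})"
    using edge_arc[OF assms(3)] by blast
  have gz: "graph_path E [a, c]" using assms(2) ne unfolding graph_path_def by simp
  have tz: "trace [a, c] = path_image (crv {a, c})" unfolding trace_def by simp
  have "open (inside (trace ?y \<union> trace [a, c]))" "open (inside (trace ?x \<union> trace [a, c]))"
    using two_arcs_inside(2)[of k2 k3] two_arcs_inside(2)[of k1 k3] k1 k2 k3 ac(2,3) tz by simp_all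
  then have n: "pos b \<notin> inside (trace ?y \<union> trace [a, c])" "pos d \<notin> inside (trace ?x \<union> trace [a, c])"
    using not_inside[OF V(1) path_edges_E[OF g(2)] path_edges_E[OF gz]]
      not_inside[OF V(2) path_edges_E[OF g(1)] path_edges_E[OF gz]] by blast+
  show False
  proof (rule crossing_chords_arcs[OF k1(1) k2(1) k3(1) l(1) k1(2,3) k2(2,3) k3(2,3) l(2,3)])
    show "path_image k1 \<inter> path_image k2 = {pos a, pos c}" using xy k1 k2 by simp
    show "path_image k2 \<inter> path_image k3 = {pos a, pos c}" using ac k3 k2 by simp
    show "path_image k1 \<inter> path_image k3 = {pos a, pos c}" using ac k3 k1 by simp
    show "path_image l \<inter> (path_image k1 \<union> path_image k2) = {pos b, pos d}"
      unfolding k1(4) k2(4) l(4) un[symmetric] using bd(2,3) by blast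
    show "path_image l \<inter> path_image k3 = {}" using cr l k3 by simp
    show "pos b \<in> path_image k1 - {pos a, pos c}" "pos d \<in> path_image k2 - {pos a, pos c}"
      using bx pn k1 k2 by auto
    show "pos b \<notin> inside (path_image k2 \<union> path_image k3)" "pos d \<notin> inside (path_image k1 \<union> path_image k3)"
      using n k1 k2 k3 tz by simp_all
    show "path_image k3 \<inter> inside (path_image k1 \<union> path_image k2) \<noteq> {}" using ac(1) k1 k2 k3 by simp
    show "path_image l \<inter> inside (path_image k1 \<union> path_image k2) \<noteq> {}"
      using bd(1) k1 k2 l un by simp
  qed
qed

end

section \<open>Crossing-free circular orders of outerplanar graphs\<close>

definition noncrossing :: "'a set set \<Rightarrow> 'a list \<Rightarrow> bool" where
  "noncrossing E xs \<longleftrightarrow>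
     (\<forall>i k j l. i < k \<and> k < j \<and> j < l \<and> l < length xs \<longrightarrow> \<not> ({xs ! i, xs ! j} \<in> E \<and> {xs ! k, xs ! l} \<in> E))"

lemma noncrossing_rotate1:
  assumes "noncrossing E (x # ys)"
  shows "noncrossing E (ys @ [x])"
  unfolding noncrossing_def
proof (intro allI impI notI)
  fix i k j l
  assume a: "i < k \<and> k < j \<and> j < l \<and> l < length (ys @ [x])"
    and E: "{(ys @ [x]) ! i, (ys @ [x]) ! j} \<in> E \<and> {(ys @ [x]) ! k, (ys @ [x]) ! l} \<in> E"
  show False
  proof (cases "l < length ys")
    case True
    then show False
      using assms[unfolded noncrossing_def, rule_format, of "Suc i" "Suc k" "Suc j" "Suc l"] a E
      by (simp add: nth_append)
  next
    case False
    then have "l = length ys" using a by simp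
    then show False
      using assms[unfolded noncrossing_def, rule_format, of 0 "Suc i" "Suc k" "Suc j"] a E
      by (simp add: nth_append insert_commute)
  qed
qed

lemma noncrossing_rotate: "noncrossing E (xs @ ys) \<Longrightarrow> noncrossing E (ys @ xs)"
proof (induction xs arbitrary: ys)
  case (Cons x xs)
  then have "noncrossing E (xs @ ys @ [x])" using noncrossing_rotate1[of E x "xs @ ys"] by simp
  then show ?case using Cons.IH[of "ys @ [x]"] by simp
qed simp

text \<open>Two circular orders sharing at most one vertex \<open>w\<close> are glued at \<open>w\<close>.\<close>

lemma noncrossing_glue:
  assumes "noncrossing E (xs @ ws)" "noncrossing E (ws @ ys)" "length ws \<le> 1"
    and sep: "\<And>x y. x \<in> set xs \<Longrightarrow> y \<in> set ys \<Longrightarrow> {x, y} \<notin> E"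
  shows "noncrossing E (xs @ ws @ ys)"
  unfolding noncrossing_def
proof (intro allI impI notI)
  fix i k j l
  let ?zs = "xs @ ws @ ys"
  assume a: "i < k \<and> k < j \<and> j < l \<and> l < length ?zs"
    and E: "{?zs ! i, ?zs ! j} \<in> E \<and> {?zs ! k, ?zs ! l} \<in> E"
  have side: "j' < length xs + length ws \<or> i' \<ge> length xs"
    if "i' < j'" "j' < length ?zs" "{?zs ! i', ?zs ! j'} \<in> E" for i' j'
  proof (rule ccontr)
    assume "\<not> ?thesis"
    then have "?zs ! i' \<in> set xs" "?zs ! j' \<in> set ys" using that by (auto simp: nth_append)
    then show False using sep that(3) by blast
  qed
  have L: "?zs ! m = (xs @ ws) ! m" if "m < length xs + length ws" for m using that by (auto simp: nth_append)
  have R: "?zs ! m = (ws @ ys) ! (m - length xs)" if "length xs \<le> m" for m using that by (simp add: nth_append)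
  have ij: "j < length xs + length ws \<or> i \<ge> length xs" and kl: "l < length xs + length ws \<or> k \<ge> length xs"
    using side[of i j] side[of k l] a E by auto
  show False
  proof (cases "l < length xs + length ws")
    case True
    then show False
      using assms(1)[unfolded noncrossing_def, rule_format, of i k j l] a E L[of i] L[of j] L[of k] L[of l] by simp
  next
    case False
    then have "k \<ge> length xs" using kl by simp
    then have "i \<ge> length xs" using ij a assms(3) by linarith
    then have "i - length xs < k - length xs \<and> k - length xs < j - length xs \<and>
        j - length xs < l - length xs \<and> l - length xs < length (ws @ ys)"
      and "length xs \<le> j" "length xs \<le> l" using a by auto
    then show False
      using assms(2)[unfolded noncrossing_def, rule_format, of "i - length xs" "k - length xs" "j - length xs" "l - length xs"]
        E R[of i] R[of j] R[of k] R[of l] \<open>k \<ge> length xs\<close> \<open>i \<ge> length xs\<close> by simp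
  qed
qed

lemma split_four:
  assumes "i < k" "k < j" "j < l" "l < length xs"
  obtains p q r s t where "xs = p @ xs ! i # q @ xs ! k # r @ xs ! j # s @ xs ! l # t"
proof -
  have D: "drop m xs = take (m' - m) (drop m xs) @ xs ! m' # drop (Suc m') xs" if "m \<le> m'" "m' < length xs" for m m'
    using that by (metis Cons_nth_drop_Suc append_take_drop_id drop_drop le_add_diff_inverse2)
  have "xs = take i xs @ xs ! i # drop (Suc i) xs" using assms by (simp add: id_take_nth_drop)
  moreover note D[of "Suc i" k] D[of "Suc k" j] D[of "Suc j" l]
  ultimately show ?thesis using that assms by (metis Suc_leI order.strict_trans)
qed

lemma reach_path:
  assumes "(a, b) \<in> {(x, y). x \<in> U \<and> y \<in> U \<and> {x, y} \<in> E}\<^sup>*" "a \<in> U"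
  obtains ps where "graph_path E ps" "hd ps = a" "last ps = b" "set ps \<subseteq> U"
proof -
  have "\<exists>ps. graph_path E ps \<and> hd ps = a \<and> last ps = b \<and> set ps \<subseteq> U"
    using assms(1)
  proof (induction rule: rtrancl_induct)
    case base
    then show ?case using assms(2) by (intro exI[of _ "[a]"]) (simp add: graph_path_def)
  next
    case (step y z)
    then obtain ps where ps: "graph_path E ps" "hd ps = a" "last ps = y" "set ps \<subseteq> U" by blast
    show ?case
    proof (cases "z \<in> set ps")
      case True
      then obtain p1 p2 where p: "ps = p1 @ z # p2" by (meson split_list)
      then have "graph_path E (p1 @ [z])"
        using ps(1) graph_path_append[of E "p1 @ [z]" p2] by (auto split: if_splits)
      then show ?thesis using ps p by (intro exI[of _ "p1 @ [z]"]) (auto simp: hd_append)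
    next
      case False
      then have "graph_path E (ps @ [z])"
        using ps step(2) by (auto simp: graph_path_append graph_path_Cons)
      moreover have "ps \<noteq> []" using ps unfolding graph_path_def by simp
      ultimately show ?thesis using ps step(2) by (intro exI[of _ "ps @ [z]"]) auto
    qed
  qed
  then show thesis using that by blast
qed

context outer_drawing begin

lemma cycle_noncrossing:
  assumes "graph_cycle E C"
  shows "noncrossing E C"
  unfolding noncrossing_def
proof (intro allI impI notI)
  fix i k j l
  assume a: "i < k \<and> k < j \<and> j < l \<and> l < length C" and e: "{C ! i, C ! j} \<in> E \<and> {C ! k, C ! l} \<in> E"
  obtain p q r s t where C: "C = p @ C ! i # q @ C ! k # r @ C ! j # s @ C ! l # t"
    using split_four[of i k j l C] a by blast
  have "graph_cycle E ((C ! i # q @ C ! k # r @ C ! j # s @ C ! l # t) @ p)"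
    using graph_cycle_rotate assms C by metis
  then show False using no_crossing_chords[of "C ! i" q "C ! k" r "C ! j" s "C ! l" "t @ p"] e by simp
qed

text \<open>A separation along at most one vertex. On two or more vertices its absence means
  2-connectedness, with a single edge included.\<close>

definition separated :: "'a set \<Rightarrow> bool" where
  "separated W \<longleftrightarrow> (\<exists>A B w. A \<union> B = W \<and> A \<noteq> W \<and> B \<noteq> W \<and> A \<inter> B \<subseteq> {w} \<and>
     (\<forall>x\<in>A - B. \<forall>y\<in>B - A. {x, y} \<notin> E))"

text \<open>A component \<open>D\<close> of the vertices off the cycle is attached to the cycle at
  two vertices at least, or it could be separated. A path through \<open>D\<close> and the two parts
  of the cycle would form a forbidden theta curve, so one of these parts is a single edge and the
  path can replace it.\<close>

lemma cycle_extends: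
  assumes C: "graph_cycle E C" "set C \<subset> W" "W \<subseteq> V" and ns: "\<not> separated W"
  shows "\<exists>C'. graph_cycle E C' \<and> set C' \<subseteq> W \<and> length C < length C'"
proof -
  obtain x where x: "x \<in> W - set C" using C(2) by blast
  let ?U = "W - set C"
  let ?R = "{(y, z). y \<in> ?U \<and> z \<in> ?U \<and> {y, z} \<in> E}"
  define D where "D = ?R\<^sup>* `` {x}"
  define N where "N = {c \<in> set C. \<exists>d\<in>D. {c, d} \<in> E}"
  have DU: "D \<subseteq> ?U"
  proof
    fix y assume "y \<in> D"
    then have "(x, y) \<in> ?R\<^sup>*" unfolding D_def by simp
    then show "y \<in> ?U" by (induction rule: rtrancl_induct) (use x in auto)
  qed
  have xD: "x \<in> D" unfolding D_def by simp
  have Dclosed: "z \<in> D" if "y \<in> D" "z \<in> ?U" "{y, z} \<in> E" for y z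
  proof -
    have "(x, y) \<in> ?R\<^sup>*" "(y, z) \<in> ?R" using that DU unfolding D_def by auto
    then show ?thesis unfolding D_def by (meson Image_singleton_iff rtrancl.rtrancl_into_rtrancl)
  qed
  have len: "length C \<ge> 2" "distinct C" "graph_path E C" using C(1) unfolding graph_cycle_def graph_path_def by auto
  have "\<exists>u v. u \<in> N \<and> v \<in> N \<and> u \<noteq> v"
  proof (rule ccontr)
    assume "\<not> ?thesis"
    then obtain w where w: "N \<subseteq> {w}" by blast
    have "set C \<noteq> {}" "\<not> set C \<subseteq> {w}"
    proof -
      have "card (set C) \<ge> 2" using len distinct_card by metis
      then show "set C \<noteq> {}" "\<not> set C \<subseteq> {w}" using card_mono[of "{w}" "set C"] by auto
    qed
    then obtain c where c: "c \<in> set C" "c \<noteq> w" by blast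
    have "separated W" unfolding separated_def
    proof (intro exI conjI)
      show "(D \<union> N) \<union> (W - D) = W" using DU C(2) unfolding N_def by auto
      show "D \<union> N \<noteq> W" using c DU w C(2) by auto
      show "W - D \<noteq> W" using xD DU by auto
      show "(D \<union> N) \<inter> (W - D) \<subseteq> {w}" using w by auto
      show "\<forall>x\<in>D \<union> N - (W - D). \<forall>y\<in>W - D - (D \<union> N). {x, y} \<notin> E"
      proof (intro ballI notI)
        fix y z assume y: "y \<in> D \<union> N - (W - D)" and z: "z \<in> W - D - (D \<union> N)" and e: "{y, z} \<in> E"
        have yD: "y \<in> D" using y C(2) unfolding N_def by auto
        show False
        proof (cases "z \<in> set C")
          case True
          then have "z \<in> N" using yD e insert_commute[of y z] unfolding N_def by auto
          then show False using z by simp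
        next
          case False
          then show False using Dclosed[OF yD _ e] z by simp
        qed
      qed
    qed
    then show False using ns by simp
  qed
  then obtain u v where uv: "u \<in> N" "v \<in> N" "u \<noteq> v" by blast
  obtain d1 d2 where d: "d1 \<in> D" "{u, d1} \<in> E" "d2 \<in> D" "{v, d2} \<in> E" using uv unfolding N_def by blast
  have "sym ?R" by (auto simp: sym_def insert_commute)
  then have "(d1, x) \<in> ?R\<^sup>*" using d(1) unfolding D_def by (meson Image_singleton_iff symD sym_rtrancl)
  moreover have "(x, d2) \<in> ?R\<^sup>*" using d(3) unfolding D_def by simp
  ultimately have "(d1, d2) \<in> ?R\<^sup>*" by (rule rtrancl_trans)
  then obtain ps where ps: "graph_path E ps" "hd ps = d1" "last ps = d2" "set ps \<subseteq> ?U"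
    using reach_path[of d1 d2 ?U E] d(1) DU by blast
  have psne: "ps \<noteq> []" using ps unfolding graph_path_def by simp
  have uvC: "u \<in> set C" "v \<in> set C" using uv unfolding N_def by auto
  obtain p1 p2 where p: "C = p1 @ u # p2" using uvC(1) by (meson split_list)
  have C1: "graph_cycle E (u # p2 @ p1)" using C(1) graph_cycle_rotate[of E p1 "u # p2"] p by simp
  have "v \<in> set (p2 @ p1)" using uvC(2) uv(3) p by auto
  then obtain c1 c2 where c: "p2 @ p1 = c1 @ v # c2" by (meson split_list)
  have cyc: "graph_cycle E (u # c1 @ v # c2)" using C1 c by simp
  have lenC: "length C = length c1 + length c2 + 2"
    using arg_cong[OF c, of length] p by simp
  have setC: "set C = {u, v} \<union> set c1 \<union> set c2" using arg_cong[OF c, of set] p by auto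
  have gc: "graph_path E (u # c1 @ v # c2)" "{last (v # c2), u} \<in> E" using cyc unfolding graph_cycle_def by auto
  have dist: "distinct (u # c1 @ v # c2)" using gc(1) unfolding graph_path_def by simp
  have disj: "set ps \<inter> set (u # c1 @ v # c2) = {}" using ps(4) setC by auto
  have gX: "graph_path E (u # c1 @ [v])"
    using gc(1) graph_path_append[of E "u # c1 @ [v]" c2] by (auto split: if_splits)
  have gv: "graph_path E (v # c2)"
    using gc(1) graph_path_append[of E "u # c1" "v # c2"] by (auto split: if_splits)
  have gZ: "graph_path E (u # ps @ [v])"
  proof -
    have up: "graph_path E ([u] @ ps)"
      using ps(1,2) d(2) psne disj by (subst graph_path_append) (simp add: graph_path_def)
    have "graph_path E (([u] @ ps) @ [v])"
      using up ps(3) d(4) psne disj uv(3) insert_commute[of v d2]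
      by (subst graph_path_append) (simp add: graph_path_Cons)
    then show ?thesis by simp
  qed
  consider "c1 = []" | "c2 = []" | "c1 \<noteq> []" "c2 \<noteq> []" by blast
  then show ?thesis
  proof cases
    case 1
    have "graph_path E (u # ps @ v # c2)"
    proof -
      have up: "graph_path E (u # ps)"
        using graph_path_prefix[of E "u # ps" "[v]"] gZ by simp
      moreover have "set (u # ps) \<inter> set (v # c2) = {}" using disj dist by auto
      ultimately have "graph_path E ((u # ps) @ (v # c2))"
        using gv ps(3) d(4) psne insert_commute[of v d2]
        by (subst graph_path_append) simp
      then show ?thesis by simp
    qed
    then have "graph_cycle E (u # ps @ v # c2)" using gc(2) unfolding graph_cycle_def by auto
    moreover have "length C < length (u # ps @ v # c2)" using lenC 1 psne by (cases ps) auto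
    moreover have "set (u # ps @ v # c2) \<subseteq> W" using ps(4) setC C(2) by auto
    ultimately show ?thesis by blast
  next
    case 2
    have "graph_path E ((u # c1 @ [v]) @ rev ps)"
      using gX graph_path_rev[of E ps] ps d psne disj
      by (subst graph_path_append) (auto simp: hd_rev)
    moreover have "{last (rev ps), u} \<in> E" using ps d psne by (simp add: last_rev insert_commute)
    ultimately have "graph_cycle E ((u # c1 @ [v]) @ rev ps)" using psne unfolding graph_cycle_def by auto
    moreover have "length C < length ((u # c1 @ [v]) @ rev ps)" using lenC 2 psne by (cases ps) auto
    moreover have "set ((u # c1 @ [v]) @ rev ps) \<subseteq> W" using ps(4) setC C(2) by auto
    ultimately show ?thesis by blast
  next
    case 3
    have gY: "graph_path E (u # rev c2 @ [v])"
    proof -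
      have "graph_path E ((v # c2) @ [u])"
        using gv gc(2) dist by (subst graph_path_append) (auto simp: graph_path_Cons)
      then show ?thesis using graph_path_rev[of E "v # c2 @ [u]"] by simp
    qed
    have "False"
      by (rule no_theta[OF gX gY gZ, of u v])
        (use 3 psne dist disj in \<open>auto simp: Suc_le_eq numeral_3_eq_3\<close>)
    then show ?thesis ..
  qed
qed

text \<open>A longest cycle passes through all of \<open>W\<close> by \<open>cycle_extends\<close>,
  and chords of a cycle do not cross, so the order along it is crossing-free.\<close>

lemma unseparated_noncrossing:
  assumes "finite W" "W \<subseteq> V" "card W \<ge> 2" "\<not> separated W"
  shows "\<exists>xs. distinct xs \<and> set xs = W \<and> noncrossing E xs"
proof -
  obtain w where w: "w \<in> W" using assms(3) by fastforce
  have "{w} \<union> (W - {w}) = W" "W - {w} \<noteq> W" "{w} \<noteq> W" "{w} \<inter> (W - {w}) \<subseteq> {w}" using w assms(3) by auto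
  then have "\<not> (\<forall>x\<in>{w} - (W - {w}). \<forall>y\<in>(W - {w}) - {w}. {x, y} \<notin> E)"
    using assms(4) w unfolding separated_def by blast
  then obtain y where y: "y \<in> W" "y \<noteq> w" "{w, y} \<in> E" by auto
  have "graph_cycle E [w, y]" using y unfolding graph_cycle_def graph_path_def by (auto simp: insert_commute)
  then have ex: "\<exists>C. graph_cycle E C \<and> set C \<subseteq> W" using w y by (intro exI[of _ "[w, y]"]) auto
  have bound: "length C \<le> card W" if "graph_cycle E C \<and> set C \<subseteq> W" for C
    using that card_mono[OF assms(1), of "set C"] distinct_card[of C] unfolding graph_cycle_def graph_path_def by simp
  obtain C where C: "graph_cycle E C" "set C \<subseteq> W" and max: "\<And>C'. graph_cycle E C' \<and> set C' \<subseteq> W \<Longrightarrow> length C' \<le> length C"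
    using ex_has_greatest_nat[of "\<lambda>C. graph_cycle E C \<and> set C \<subseteq> W" _ length "Suc (card W)"] ex bound
    by (metis le_imp_less_Suc)
  have "set C = W"
    using cycle_extends[OF C(1) _ assms(2,4)] C(2) max by (metis linorder_not_less psubsetI)
  then show ?thesis using C cycle_noncrossing unfolding graph_cycle_def graph_path_def by blast
qed

text \<open>Induction over separations along at most one vertex: the parts are ordered separately
  and their orders are joined.\<close>

lemma exists_noncrossing_order:
  assumes "finite W" "W \<subseteq> V"
  shows "\<exists>xs. distinct xs \<and> set xs = W \<and> noncrossing E xs"
  using assms
proof (induction "card W" arbitrary: W rule: less_induct)
  case less
  consider "card W \<le> 1" | "card W \<ge> 2" "\<not> separated W" | "separated W" by linarith
  then show ?case
  proof cases
    case 1
    then have "card W = 0 \<or> card W = 1" by linarith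
    then have "W = {} \<or> (\<exists>w. W = {w})" using less(2) card_1_singleton_iff[of W] by simp
    then show ?thesis
    proof
      assume "W = {}"
      then show ?thesis by (intro exI[of _ "[]"]) (simp add: noncrossing_def)
    next
      assume "\<exists>w. W = {w}"
      then obtain w where "W = {w}" ..
      then show ?thesis by (intro exI[of _ "[w]"]) (simp add: noncrossing_def)
    qed
  next
    case 2
    then show ?thesis using unseparated_noncrossing less(2,3) by blast
  next
    case 3
    then obtain A B w where AB: "A \<union> B = W" "A \<noteq> W" "B \<noteq> W" "A \<inter> B \<subseteq> {w}"
      and sep: "\<And>x y. x \<in> A - B \<Longrightarrow> y \<in> B - A \<Longrightarrow> {x, y} \<notin> E"
      unfolding separated_def by blast
    have sub: "A \<subset> W" "B \<subset> W" using AB by auto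
    obtain xs where xs: "distinct xs" "set xs = A" "noncrossing E xs"
      using less(1)[OF psubset_card_mono[OF less(2) sub(1)] finite_subset[OF psubset_imp_subset[OF sub(1)] less(2)]]
        sub(1) less(3) by blast
    obtain ys where ys: "distinct ys" "set ys = B" "noncrossing E ys"
      using less(1)[OF psubset_card_mono[OF less(2) sub(2)] finite_subset[OF psubset_imp_subset[OF sub(2)] less(2)]]
        sub(2) less(3) by blast
    show ?thesis
    proof (cases "A \<inter> B = {}")
      case True
      have "noncrossing E (xs @ [] @ ys)"
        using noncrossing_glue[of E xs "[]" ys] xs ys sep True by auto
      then show ?thesis using xs ys True AB by (intro exI[of _ "xs @ ys"]) auto
    next
      case False
      then have w: "A \<inter> B = {w}" using AB by auto
      have "w \<in> set xs" "w \<in> set ys" using w xs(2) ys(2) by auto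
      then obtain x1 x2 y1 y2 where x: "xs = x1 @ w # x2" and y: "ys = y1 @ w # y2" by (meson split_list)
      \<comment> \<open>Rotation moves the shared vertex to the end of one order and to the start of
        the other, as \<open>noncrossing_glue\<close> requires.\<close>
      have n1: "noncrossing E ((x2 @ x1) @ [w])" using noncrossing_rotate[of E "x1 @ [w]" x2] xs x by simp
      have n2: "noncrossing E ([w] @ (y2 @ y1))" using noncrossing_rotate[of E y1 "w # y2"] ys y by simp
      have sx: "set (x2 @ x1) = A - {w}" and sy: "set (y2 @ y1) = B - {w}" using xs ys x y by auto
      have sp: "{p, q} \<notin> E" if "p \<in> set (x2 @ x1)" "q \<in> set (y2 @ y1)" for p q
        using sep[of p q] that w unfolding sx sy by blast
      have "noncrossing E ((x2 @ x1) @ [w] @ (y2 @ y1))"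
        by (rule noncrossing_glue[OF n1 n2 _ sp]) simp_all
      moreover have "distinct ((x2 @ x1) @ [w] @ (y2 @ y1))" using xs ys x y w by auto
      moreover have "set ((x2 @ x1) @ [w] @ (y2 @ y1)) = W" using xs ys x y AB by auto
      ultimately show ?thesis by blast
    qed
  qed
qed

end

theorem outerplanar_noncrossing_order:
  assumes "outerplanar V E" "simple_graph V E"
  shows "\<exists>xs. distinct xs \<and> set xs = V \<and> noncrossing E xs"
proof -
  obtain pos crv where "plane_drawing V E pos crv"
    "\<forall>v\<in>V. pos v \<in> frontier (outside (drawing_points V E pos crv))"
    using assms(1) unfolding outerplanar_def by blast
  then interpret outer_drawing V E pos crv
    using assms(2) unfolding simple_graph_def by unfold_locales auto
  show ?thesis using exists_noncrossing_order[of V] assms(2) unfolding simple_graph_def by blast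
qed

section \<open>Outerplanar drawings of crossing-free orders\<close>

text \<open>Placing the vertices on a parabola makes all intersection tests polynomial: a point \<open>z\<close> of the
  chord from \<open>a\<close> to \<open>b\<close> lies \<open>(Re z - a) * (b - Re z)\<close> above the parabola.\<close>

definition parabola :: "real \<Rightarrow> complex" where
  "parabola a = Complex a (a\<^sup>2)"

lemma parabola_inj: "parabola a = parabola b \<longleftrightarrow> a = b"
  unfolding parabola_def by auto

lemma parabola_chord:
  assumes "z \<in> closed_segment (parabola a) (parabola b)" "a \<le> b"
  shows "a \<le> Re z" "Re z \<le> b" "Im z = (Re z)\<^sup>2 + (Re z - a) * (b - Re z)"
proof -
  obtain t where t: "0 \<le> t" "t \<le> 1" "z = (1 - t) *\<^sub>R parabola a + t *\<^sub>R parabola b"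
    using assms(1) unfolding closed_segment_def by auto
  have re: "Re z = a + t * (b - a)" and im: "Im z = (1 - t) * a\<^sup>2 + t * b\<^sup>2"
    unfolding t(3) parabola_def by (simp_all add: algebra_simps)
  show "a \<le> Re z" using t assms(2) unfolding re by simp
  have "t * (b - a) \<le> 1 * (b - a)" using t assms(2) by (intro mult_right_mono) auto
  then show "Re z \<le> b" unfolding re by simp
  show "Im z = (Re z)\<^sup>2 + (Re z - a) * (b - Re z)"
    unfolding re im by (simp add: algebra_simps power2_eq_square)
qed

lemma parabola_chord_vertex:
  assumes "parabola v \<in> closed_segment (parabola a) (parabola b)" "a \<le> b"
  shows "v = a \<or> v = b"
  using parabola_chord(3)[OF assms] unfolding parabola_def by auto

text \<open>Where both chords exist, the longer one is strictly higher above the parabola, except at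
  an end that they share.\<close>

lemma parabola_chords_nested:
  assumes "z \<in> closed_segment (parabola a) (parabola b)" "z \<in> closed_segment (parabola c) (parabola d)"
    and "a \<le> c" "c < d" "d \<le> b" "(a, b) \<noteq> (c, d)"
  shows "\<exists>x. z = parabola x \<and> x \<in> {a, b} \<inter> {c, d}"
proof -
  have ab: "a \<le> b" and cd: "c \<le> d" using assms by auto
  note h1 = parabola_chord[OF assms(1) ab] and h2 = parabola_chord[OF assms(2) cd]
  let ?x = "Re z"
  have eq: "(?x - a) * (b - ?x) = (?x - c) * (d - ?x)" using h1(3) h2(3) by simp
  have "?x = b \<and> b = d \<or> ?x = a \<and> a = c"
  proof (cases "a < c")
    case True
    have "?x = b"
    proof (rule ccontr)
      assume "?x \<noteq> b"
      then have "(?x - c) * (b - ?x) < (?x - a) * (b - ?x)" using h1 True by (intro mult_strict_right_mono) auto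
      moreover have "(?x - c) * (d - ?x) \<le> (?x - c) * (b - ?x)" using h2 assms by (intro mult_left_mono) auto
      ultimately show False using eq by simp
    qed
    then show ?thesis using h2 assms by auto
  next
    case False
    then have ac: "a = c" "d < b" using assms by auto
    have "?x = a"
    proof (rule ccontr)
      assume "?x \<noteq> a"
      then have "(?x - a) * (d - ?x) < (?x - a) * (b - ?x)" using h1 ac by (intro mult_strict_left_mono) auto
      then show False using eq ac by simp
    qed
    then show ?thesis using ac by simp
  qed
  moreover have "z = parabola ?x" if "?x = b \<or> ?x = a"
    using h1(3) that unfolding parabola_def by (auto simp: complex_eq_iff)
  ultimately show ?thesis by (intro exI[of _ ?x]) auto
qed

lemma parabola_chords:
  assumes z: "z \<in> closed_segment (parabola a) (parabola b)" "z \<in> closed_segment (parabola c) (parabola d)"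
    and "a < b" "c < d" "\<not> (a < c \<and> c < b \<and> b < d)" "\<not> (c < a \<and> a < d \<and> d < b)" "(a, b) \<noteq> (c, d)"
  shows "\<exists>x. z = parabola x \<and> x \<in> {a, b} \<inter> {c, d}"
proof -
  have ab: "a \<le> b" and cd: "c \<le> d" using assms by auto
  note h1 = parabola_chord[OF assms(1) ab] and h2 = parabola_chord[OF assms(2) cd]
  consider "b \<le> c" | "d \<le> a" | "a \<le> c" "d \<le> b" | "c \<le> a" "b \<le> d" using assms by linarith
  then show ?thesis
  proof cases
    case 1
    then have "Re z = b" "b = c" using h1 h2 by auto
    then show ?thesis using h1(3) unfolding parabola_def by (intro exI[of _ b]) (auto simp: complex_eq_iff)
  next
    case 2
    then have "Re z = a" "a = d" using h1 h2 by auto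
    then show ?thesis using h1(3) unfolding parabola_def by (intro exI[of _ a]) (auto simp: complex_eq_iff)
  next
    case 3
    then show ?thesis using parabola_chords_nested[OF z] assms by auto
  next
    case 4
    then show ?thesis using parabola_chords_nested[OF z(2,1)] assms by auto
  qed
qed

text \<open>The vertical ray below the vertex avoids everything on or above the parabola and is
  unbounded, so it lies outside and approaches the vertex.\<close>

lemma parabola_exposed:
  assumes D: "\<And>z. z \<in> D \<Longrightarrow> (Re z)\<^sup>2 \<le> Im z" and v: "parabola v \<in> D"
  shows "parabola v \<in> frontier (outside D)"
proof -
  let ?R = "(\<lambda>y. Complex v y) ` {..<v\<^sup>2}"
  have "?R \<subseteq> - D" using D by force
  moreover have conn: "connected ?R"
  proof -
    have "continuous_on {..<v\<^sup>2} (\<lambda>y. Complex v y)"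
      unfolding Complex_eq by (intro continuous_intros)
    then show ?thesis by (intro connected_continuous_image) (auto intro: convex_connected)
  qed
  moreover have unb: "\<not> bounded ?R"
  proof
    assume "bounded ?R"
    then obtain B where B: "\<And>z. z \<in> ?R \<Longrightarrow> norm z \<le> B" unfolding bounded_iff by auto
    let ?y = "- \<bar>B\<bar> - 1"
    have "?y < v\<^sup>2" using zero_le_power2[of v] by linarith
    then have "norm (Complex v ?y) \<le> B" using B by blast
    moreover have "\<bar>?y\<bar> \<le> norm (Complex v ?y)" using abs_Im_le_cmod[of "Complex v ?y"] by simp
    ultimately show False by linarith
  qed
  ultimately have out: "Complex v y \<in> outside D" if "y < v\<^sup>2" for y
  proof -
    have y: "Complex v y \<in> ?R" using that by blast
    then have "?R \<subseteq> connected_component_set (- D) (Complex v y)"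
      using \<open>?R \<subseteq> - D\<close> conn by (intro connected_component_maximal) auto
    then have "\<not> bounded (connected_component_set (- D) (Complex v y))"
      using unb bounded_subset by blast
    then show ?thesis using y \<open>?R \<subseteq> - D\<close> unfolding outside_def by auto
  qed
  have "parabola v \<in> closure (outside D)"
    unfolding closure_approachable
  proof (intro allI impI)
    fix d :: real assume "0 < d"
    moreover have "dist (Complex v (v\<^sup>2 - d / 2)) (parabola v) = \<bar>d / 2\<bar>"
      unfolding parabola_def dist_complex_def by (simp add: cmod_def)
    ultimately show "\<exists>y\<in>outside D. dist y (parabola v) < d"
      using out[of "v\<^sup>2 - d / 2"] by (intro bexI[of _ "Complex v (v\<^sup>2 - d / 2)"]) auto
  qed
  moreover have "parabola v \<notin> interior (outside D)"
    using v interior_subset[of "outside D"] unfolding outside_def by auto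
  ultimately show ?thesis unfolding frontier_def by blast
qed

text \<open>This brings maximality into play: a missing edge that crosses nothing in the order could
  be added without losing outerplanarity.\<close>

theorem noncrossing_outerplanar:
  assumes sg: "simple_graph V E" and xs: "distinct xs" "set xs = V" "noncrossing E xs"
  shows "outerplanar V E"
proof -
  define idx where "idx = inv_into {..<length xs} ((!) xs)"
  define pos where "pos = (\<lambda>v. parabola (real (idx v)))"
  define crv where "crv = (\<lambda>f. linepath (parabola (real (Min (idx ` f)))) (parabola (real (Max (idx ` f)))))"
  have inj: "inj_on ((!) xs) {..<length xs}" using xs(1) by (simp add: inj_on_nth)
  have idx: "idx (xs ! i) = i" if "i < length xs" for i
    unfolding idx_def using inv_into_f_f[OF inj] that by simp
  have edge: "\<exists>i j. i < j \<and> j < length xs \<and> f = {xs ! i, xs ! j}" if "f \<in> E" for f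
  proof -
    have "f \<subseteq> V" "card f = 2" using sg that unfolding simple_graph_def by auto
    then obtain u v where uv: "f = {u, v}" "u \<noteq> v" "u \<in> set xs" "v \<in> set xs" using xs(2) by (auto simp: card_2_iff)
    then obtain i j where "i < length xs" "j < length xs" "xs ! i = u" "xs ! j = v" by (meson in_set_conv_nth)
    then show ?thesis using uv by (cases i j rule: linorder_cases) (auto simp: insert_commute)
  qed
  have crv: "crv {xs ! i, xs ! j} = linepath (parabola (real i)) (parabola (real j))" if "i < j" "j < length xs" for i j
    using that idx[of i] idx[of j] unfolding crv_def by (simp add: min_def max_def)
  have pos: "pos (xs ! i) = parabola (real i)" if "i < length xs" for i unfolding pos_def using idx[OF that] by simp
  have posV: "\<exists>i<length xs. v = xs ! i" if "v \<in> V" for v using that xs(2) by (metis in_set_conv_nth)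
  have drawing: "plane_drawing V E pos crv"
    unfolding plane_drawing_def
  proof (intro conjI ballI impI)
    show "inj_on pos V"
    proof (rule inj_onI)
      fix u v assume "u \<in> V" "v \<in> V" "pos u = pos v"
      then show "u = v" using posV[of u] posV[of v] pos by (auto simp: parabola_inj)
    qed
  next
    fix f assume "f \<in> E"
    then obtain i j where f: "i < j" "j < length xs" "f = {xs ! i, xs ! j}" using edge by blast
    have pf: "pos ` f = {parabola i, parabola j}" unfolding f(3) using pos f by simp
    show "arc (crv f)" unfolding f(3) crv[OF f(1,2)] using f parabola_inj by (intro arc_linepath) simp
    show "{pathstart (crv f), pathfinish (crv f)} = pos ` f"
      unfolding pf unfolding f(3) crv[OF f(1,2)] by simp
    show "path_image (crv f) \<inter> pos ` V = pos ` f"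
    proof
      show "pos ` f \<subseteq> path_image (crv f) \<inter> pos ` V"
      proof -
        have "xs ! i \<in> V" "xs ! j \<in> V" using f xs(2) by auto
        then have "pos (xs ! i) \<in> pos ` V" "pos (xs ! j) \<in> pos ` V" by blast+
        moreover have "path_image (crv f) = closed_segment (parabola i) (parabola j)"
          unfolding f(3) crv[OF f(1,2)] by simp
        ultimately show ?thesis unfolding pf using pos f(1,2) by simp
      qed
      show "path_image (crv f) \<inter> pos ` V \<subseteq> pos ` f"
      proof
        fix z assume z: "z \<in> path_image (crv f) \<inter> pos ` V"
        then obtain m where m: "m < length xs" "z = parabola (real m)" using posV pos by force
        then have "real m = real i \<or> real m = real j"
          using parabola_chord_vertex[of "real m" "real i" "real j"] z f unfolding f(3) crv[OF f(1,2)] by simp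
        then show "z \<in> pos ` f" unfolding pf using m by auto
      qed
    qed
  next
    fix f g assume "f \<in> E" "g \<in> E" and ne: "f \<noteq> g"
    then obtain i j k l where f: "i < j" "j < length xs" "f = {xs ! i, xs ! j}" "{xs ! i, xs ! j} \<in> E"
      and g: "k < l" "l < length xs" "g = {xs ! k, xs ! l}" "{xs ! k, xs ! l} \<in> E" using edge by metis
    show "path_image (crv f) \<inter> path_image (crv g) \<subseteq> pos ` (f \<inter> g)"
    proof
      fix z assume z: "z \<in> path_image (crv f) \<inter> path_image (crv g)"
      have "\<not> (i < k \<and> k < j \<and> j < l)" "\<not> (k < i \<and> i < l \<and> l < j)"
        using xs(3) f g unfolding noncrossing_def by blast+
      moreover have "(i, j) \<noteq> (k, l)" using ne f g by auto
      ultimately obtain x where x: "z = parabola x" "x \<in> {real i, real j} \<inter> {real k, real l}"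
        using parabola_chords[of z i j k l] z f g crv by auto
      then obtain m where m: "x = real m" "m \<in> {i, j}" "m \<in> {k, l}" by auto
      then have "m < length xs" "xs ! m \<in> f \<inter> g" using f g by auto
      then show "z \<in> pos ` (f \<inter> g)" using x m pos by (intro image_eqI[of _ pos "xs ! m"]) auto
    qed
  qed
  have D: "(Re z)\<^sup>2 \<le> Im z" if zD: "z \<in> drawing_points V E pos crv" for z
  proof -
    consider v where "v \<in> V" "z = pos v" | f where "f \<in> E" "z \<in> path_image (crv f)"
      using zD unfolding drawing_points_def by blast
    then show ?thesis
    proof cases
      case 1
      then show ?thesis unfolding pos_def parabola_def by simp
    next
      case 2
      then obtain i j where f: "i < j" "j < length xs" "f = {xs ! i, xs ! j}" using edge by blast
      then have "z \<in> closed_segment (parabola (real i)) (parabola (real j))" using 2 crv by simp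
      then have h: "real i \<le> Re z" "Re z \<le> real j" "Im z = (Re z)\<^sup>2 + (Re z - real i) * (real j - Re z)"
        using parabola_chord[of z "real i" "real j"] f by auto
      then have "0 \<le> (Re z - real i) * (real j - Re z)" by (intro mult_nonneg_nonneg) auto
      then show ?thesis using h by simp
    qed
  qed
  have "pos v \<in> frontier (outside (drawing_points V E pos crv))" if "v \<in> V" for v
    using parabola_exposed[of "drawing_points V E pos crv" "real (idx v)"] D that
    unfolding pos_def drawing_points_def by blast
  then show ?thesis unfolding outerplanar_def using drawing by blast
qed

section \<open>Position of an ear and number of landmarks\<close>

lemma (in triangulated_polygon) translated: "triangulated_polygon n (\<lambda>i j. e (i + c) (j + c))"
proof
  show "3 \<le> n" by (rule n3)
  show "e (i + n + c) (j + c) = e (i + c) (j + c)" for i j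
    using periodic[of "i + c" "j + c"] by (simp add: algebra_simps)
  show "e (i + c) (j + c) \<Longrightarrow> e (j + c) (i + c)" for i j by (rule sym)
  show "\<not> e (i + c) (i + c)" for i by (rule irrefl)
  show "i < k \<Longrightarrow> k < j \<Longrightarrow> j < l \<Longrightarrow> l < i + n \<Longrightarrow> e (i + c) (j + c) \<Longrightarrow> e (k + c) (l + c) \<Longrightarrow> False" for i k j l
    using nocross[of "i + c" "k + c" "j + c" "l + c"] by simp
  show "\<exists>k l. i < k \<and> k < j \<and> j < l \<and> l < i + n \<and> e (k + c) (l + c)"
    if ij: "i < j" "j < i + n" "\<not> e (i + c) (j + c)" for i j
  proof -
    obtain k l where "i + c < k" "k < j + c" "j + c < l" "l < i + c + n" "e k l"
      using maximal[of "i + c" "j + c"] ij by auto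
    then show ?thesis by (intro exI[of _ "k - c"] exI[of _ "l - c"]) auto
  qed
qed

text \<open>A shortest chord, seen from a fixed starting point, cuts off an ear.\<close>

lemma (in triangulated_polygon) ear_exists:
  obtains p where "0 \<le> p" "p < n" "\<And>y. e p y \<Longrightarrow> y mod n = (p - 1) mod n \<or> y mod n = (p + 1) mod n"
proof -
  define P where "P d = (\<exists>i. e i (i + int d) \<and> 2 \<le> d \<and> int d < n)" for d :: nat
  \<comment> \<open>The side between \<open>n - 1\<close> and 0, measured the long way round, shows
    that the minimum is taken over a nonempty set.\<close>
  have "e 0 (0 + int (nat (n - 1)))" using side[of "- 1"] periodic2[of 0 "- 1"] commute[of 0 "- 1"] n3 by simp
  then have "P (nat (n - 1))" unfolding P_def using n3 by (intro exI[of _ 0]) auto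
  then have Pd: "P (LEAST d. P d)" by (rule LeastI)
  define d where "d = (LEAST d. P d)"
  obtain i where i: "e i (i + int d)" "2 \<le> d" "int d < n" using Pd unfolding P_def d_def by blast
  have least: "\<not> P c" if "c < d" for c using that not_less_Least unfolding d_def by blast
  have "d = 2"
  proof (rule ccontr)
    assume "d \<noteq> 2"
    then have d3: "3 \<le> d" using i by simp
    \<comment> \<open>The missing chord over \<open>i + 1\<close> is crossed by an edge that starts
      at \<open>i + 1\<close>. The chord from \<open>i\<close> to \<open>i + int d\<close> confines
      this edge, which makes it shorter than the minimum.\<close>
    then have "\<not> e i (i + 2)" using least[of 2] i unfolding P_def by auto
    then obtain x y where xy: "i < x" "x < i + 2" "i + 2 < y" "y < i + n" "e x y"
      using maximal[of i "i + 2"] i d3 by auto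
    then have x: "x = i + 1" by simp
    have "y \<le> i + int d" using confined[of i "i + int d" "i + 1" y] i xy x d3 by auto
    moreover have "P (nat (y - x))" unfolding P_def
      using xy x i calculation by (intro exI[of _ x]) auto
    moreover have "nat (y - x) < d" using calculation(1) x xy by (simp add: nat_less_iff)
    ultimately show False using least[of "nat (y - x)"] by blast
  qed
  then have c: "e i (i + 2)" using i by simp
  define p where "p = (i + 1) mod n"
  have nb: "y mod n = i mod n \<or> y mod n = (i + 2) mod n" if y: "e (i + 1) y" for y
  proof -
    obtain l where l: "i \<le> l" "l < i + n" "l mod n = y mod n" using window by blast
    then have el: "e (i + 1) l" using y cong1[of l y "i + 1"] commute[of "i + 1"] by simp
    then have "l \<le> i + 2" using confined[of i "i + 2" "i + 1" l] c l n3 i \<open>d = 2\<close> by auto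
    moreover have "l \<noteq> i + 1" using el irrefl by auto
    ultimately have "l = i \<or> l = i + 2" using l by linarith
    then show ?thesis using l(3) by auto
  qed
  show thesis
  proof (rule that[of p])
    show "0 \<le> p" "p < n" unfolding p_def using n3 by auto
    show "y mod n = (p - 1) mod n \<or> y mod n = (p + 1) mod n" if "e p y" for y
    proof -
      have "e (i + 1) y" using that unfolding p_def mod1 .
      moreover have "(p - 1) mod n = i mod n" "(p + 1) mod n = (i + 2) mod n"
        unfolding p_def by (simp_all add: mod_simps add.assoc)
      ultimately show ?thesis using nb by simp
    qed
  qed
qed

text \<open>For \<open>n\<close> equal to 3, 4 or 5 two landmarks are allowed; with an ear at 2 the
  vertices 0 and \<open>n - 1\<close> will do.\<close>

definition solution :: "int \<Rightarrow> (int \<Rightarrow> int \<Rightarrow> bool) \<Rightarrow> int set" where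
  "solution n e = (if n \<le> 5 then {0, n - 1} else eared_polygon.landmarks n e)"

context eared_polygon begin

lemma k_pos: "0 < k"
  using n6 nk by linarith

lemma landmarks_bound: "landmarks \<subseteq> {0..<n}"
proof
  fix x assume "x \<in> landmarks"
  then consider i where "0 \<le> i" "i < k" "x = (if shifted i then 5 * i - 1 else 5 * i)"
    | i where "0 \<le> i" "i < k" "x = (if flag i then 5 * i + 2 else 5 * i + 3)"
    | "0 < r" "x = 5 * k" | "2 < r" "x = 5 * k + 2"
    unfolding landmarks_def by (auto split: if_split_asm)
  then show "x \<in> {0..<n}"
    using nk k_pos by cases (auto dest: shifted_bound)
qed

lemma card_landmarks: "int (card landmarks) = 2 * k + (if 0 < r then 1 else 0) + (if 2 < r then 1 else 0)"
proof -
  let ?a = "\<lambda>i. if shifted i then 5 * i - 1 else 5 * i" and ?c = "\<lambda>i. if flag i then 5 * i + 2 else 5 * i + 3"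
  let ?A = "?a ` {0..<k}" and ?C = "?c ` {0..<k}"
  let ?P = "if 0 < r then {5 * k} else {}" and ?Q = "if 2 < r then {5 * k + 2} else {}"
  have inj: "inj_on ?a {0..<k}" "inj_on ?c {0..<k}" by (auto simp: inj_on_def split: if_splits)
  have "card ?A = card {0..<k}" "card ?C = card {0..<k}" by (rule card_image[OF inj(1)], rule card_image[OF inj(2)])
  then have c: "card ?A = nat k" "card ?C = nat k" by simp_all
  have "?A \<inter> ?C = {}"
  proof -
    have "?a i \<noteq> ?c j" for i j by (cases "shifted i"; cases "flag j"; simp; presburger)
    then show ?thesis by blast
  qed
  moreover have "x < 5 * k" if "x \<in> ?A \<union> ?C" for x using that by (auto split: if_splits)
  then have "(?A \<union> ?C) \<inter> (?P \<union> ?Q) = {}" by (fastforce split: if_splits)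
  moreover have "?P \<inter> ?Q = {}" by auto
  ultimately have "card (?A \<union> ?C \<union> (?P \<union> ?Q)) = card ?A + card ?C + (card ?P + card ?Q)"
    by (subst card_Un_disjoint; simp)+
  moreover have "landmarks = ?A \<union> ?C \<union> (?P \<union> ?Q)" unfolding landmarks_def k_def r_def by blast
  ultimately show ?thesis using c k_pos by simp
qed

end

text \<open>Both residues are taken modulo \<open>n\<close> in order to cover \<open>n = 3\<close>,
  where index 3 denotes vertex 0.\<close>

locale ear_at_two = triangulated_polygon +
  assumes ear2: "e 2 y \<Longrightarrow> y mod n = 1 mod n \<or> y mod n = 3 mod n"
begin

lemma eared: "6 \<le> n \<Longrightarrow> eared_polygon n e"
  using ear2 by unfold_locales auto

lemma solution_bound: "solution n e \<subseteq> {0..<n}"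
  using eared_polygon.landmarks_bound[OF eared] n3 unfolding solution_def by auto

lemma card_solution: "int (card (solution n e)) = \<lceil>2 * real_of_int n / 5\<rceil>"
proof (cases "n \<le> 5")
  case True
  then consider "n = 3" | "n = 4" | "n = 5" using n3 by linarith
  then have "\<lceil>2 * real_of_int n / 5\<rceil> = 2" by cases (auto simp: ceiling_eq_iff)
  then show ?thesis using True n3 unfolding solution_def by auto
next
  case False
  interpret P: eared_polygon n e using False eared by simp
  \<comment> \<open>\<open>2 * n / 5\<close> is \<open>2 * k + 2 * r / 5\<close>, and for
    \<open>r\<close> from 0 to 4 the last term rounds up to 0, 1, 1, 2, 2.\<close>
  have "\<lceil>2 * real_of_int n / 5\<rceil> = 2 * P.k + (if 0 < P.r then 1 else 0) + (if 2 < P.r then 1 else 0)"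
  proof -
    have "real_of_int n = 5 * real_of_int P.k + real_of_int P.r"
      using arg_cong[OF P.nk(3), of real_of_int] by simp
    moreover have "P.r = 0 \<or> P.r = 1 \<or> P.r = 2 \<or> P.r = 3 \<or> P.r = 4" using P.nk(4,5) by linarith
    ultimately show ?thesis by (intro ceiling_unique) auto
  qed
  then show ?thesis using P.card_landmarks False unfolding solution_def by simp
qed

text \<open>For \<open>n\<close> at most 5 few pairs avoid both landmarks. Adjacency to 0 and
  \<open>n - 1\<close> tells them apart: the ear sees neither for \<open>n = 5\<close>, and
  otherwise two edges would cross.\<close>

lemma small_resolved:
  assumes "n \<le> 5" "0 \<le> u" "u < n" "0 \<le> v" "v < n" "u < v"
  shows "\<not> unresolved (\<lambda>x. x mod n \<in> solution n e) u v"
proof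
  assume un: "unresolved (\<lambda>x. x mod n \<in> solution n e) u v"
  have sol: "solution n e = {0, n - 1}" using assms unfolding solution_def by simp
  have nn: "u \<noteq> 0" "v \<noteq> 0" "u \<noteq> n - 1" "v \<noteq> n - 1"
    using un assms unfolding unresolved_def sol by auto
  have *: "e u s = e v s" if "s mod n \<in> {0, n - 1}" for s
    using un[unfolded unresolved_def sol, THEN conjunct2, THEN conjunct2, THEN conjunct2, rule_format, OF that]
    by (rule conjunct1)
  have "(n - 1) mod n = n - 1" using n3 by (intro mod_pos_pos_trivial) auto
  then have S: "e u 0 = e v 0" "e u (n - 1) = e v (n - 1)"
    using *[of 0] *[of "n - 1"] by simp_all
  have e10: "e 1 0" using side[of 0] commute by auto
  have ear: "e 2 y \<Longrightarrow> y = 1 \<or> y = 3" if "0 \<le> y" "y < n" "3 < n" for y using ear2[of y] that by auto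
  have n45: "n = 4 \<and> u = 1 \<and> v = 2 \<or> n = 5 \<and> (u = 1 \<and> v = 2 \<or> u = 1 \<and> v = 3 \<or> u = 2 \<and> v = 3)"
    using nn assms by auto
  have "\<not> (u = 1 \<and> v = 2)" using S(1) e10 ear[of 0] n45 by auto
  moreover have "\<not> (n = 5 \<and> u = 2 \<and> v = 3)" using S(2) side[of 3] ear[of 4] by auto
  moreover have "\<not> (n = 5 \<and> u = 1 \<and> v = 3)"
  proof
    assume a: "n = 5 \<and> u = 1 \<and> v = 3"
    then have "e 0 3" "e 1 4" using S side[of 3] e10 commute[of 0 3] by auto
    then show False using nocross[of 0 1 3 4] a by auto
  qed
  ultimately show False using n45 by auto
qed

lemma solution_resolved:
  assumes "0 \<le> u" "u < n" "0 \<le> v" "v < n"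
  shows "\<not> unresolved (\<lambda>x. x mod n \<in> solution n e) u v"
proof (cases "n \<le> 5")
  case True
  have "unresolved S u v = unresolved S v u" for S unfolding unresolved_def by auto
  moreover have "\<not> unresolved S u u" for S unfolding unresolved_def by simp
  ultimately show ?thesis using small_resolved[OF True] assms by (metis linorder_neqE_linordered_idom)
next
  case False
  interpret P: eared_polygon n e using False eared by simp
  have "(\<lambda>x. x mod n \<in> solution n e) = P.S" unfolding P.S_def solution_def using False by simp
  then show ?thesis using P.resolved assms by simp
qed

end

section \<open>Distances up to two\<close>

context
  fixes V :: "'a set" and E :: "'a set set"
  assumes conn: "connected_graph V E"
begin

lemma gdist_path:
  assumes "u \<in> V" "v \<in> V"
  obtains p where "path_between V E u p v" "length p = gdist V E u v + 1"
proof -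
  obtain p where p: "path_between V E u p v" using conn assms unfolding connected_graph_def by blast
  then have "p \<noteq> []" unfolding path_between_def by simp
  then have "\<exists>q. path_between V E u q v \<and> length q = (length p - 1) + 1" using p by (intro exI[of _ p]) simp
  then have "\<exists>q. path_between V E u q v \<and> length q = gdist V E u v + 1"
    unfolding gdist_def by (rule LeastI)
  then show thesis using that by blast
qed

lemma gdist_le: "path_between V E u p v \<Longrightarrow> length p = d + 1 \<Longrightarrow> gdist V E u v \<le> d"
  unfolding gdist_def by (rule Least_le) blast

lemma edge_distinct: "{u, v} \<in> E \<Longrightarrow> u \<noteq> v \<and> u \<in> V \<and> v \<in> V"
  using conn unfolding connected_graph_def simple_graph_def by fastforce

lemma gdist_zero: "u \<in> V \<Longrightarrow> v \<in> V \<Longrightarrow> gdist V E u v = 0 \<longleftrightarrow> u = v"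
proof
  assume uv: "u \<in> V" "v \<in> V" "gdist V E u v = 0"
  obtain p where "path_between V E u p v" "length p = gdist V E u v + 1" by (rule gdist_path[OF uv(1,2)])
  moreover from this have "length p = 1" using uv(3) by simp
  ultimately show "u = v" unfolding path_between_def by (cases p) auto
next
  assume "u \<in> V" "v \<in> V" "u = v"
  then show "gdist V E u v = 0" using gdist_le[of u "[u]" v 0] unfolding path_between_def by simp
qed

lemma gdist_one: "u \<in> V \<Longrightarrow> v \<in> V \<Longrightarrow> gdist V E u v = 1 \<longleftrightarrow> {u, v} \<in> E"
proof
  assume uv: "u \<in> V" "v \<in> V" "gdist V E u v = 1"
  obtain p where p: "path_between V E u p v" "length p = gdist V E u v + 1" by (rule gdist_path[OF uv(1,2)])
  have "length p = 2" using p(2) uv(3) by simp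
  then obtain x y where "p = [x, y]" by (auto simp: numeral_2_eq_2 length_Suc_conv)
  then show "{u, v} \<in> E" using p unfolding path_between_def by auto
next
  assume uv: "u \<in> V" "v \<in> V" "{u, v} \<in> E"
  then have "path_between V E u [u, v] v" using edge_distinct[of u v] unfolding path_between_def by simp
  then have "gdist V E u v \<le> 1" using gdist_le[of u "[u, v]" v 1] by simp
  moreover have "gdist V E u v \<noteq> 0" using gdist_zero[OF uv(1,2)] edge_distinct[OF uv(3)] by simp
  ultimately show "gdist V E u v = 1" by linarith
qed

lemma gdist_two:
  assumes "u \<in> V" "v \<in> V" "u \<noteq> v"
  shows "gdist V E u v \<le> 2 \<longleftrightarrow> {u, v} \<in> E \<or> (\<exists>w. {u, w} \<in> E \<and> {w, v} \<in> E)"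
proof
  assume "gdist V E u v \<le> 2"
  moreover have "gdist V E u v \<noteq> 0" using gdist_zero assms by simp
  moreover have "{u, v} \<in> E \<or> (\<exists>w. {u, w} \<in> E \<and> {w, v} \<in> E)" if d: "gdist V E u v = 2"
  proof -
    obtain p where p: "path_between V E u p v" "length p = gdist V E u v + 1" by (rule gdist_path[OF assms(1,2)])
    have "length p = 3" using p(2) d by simp
    then obtain x y z where "p = [x, y, z]" by (auto simp: numeral_3_eq_3 length_Suc_conv)
    then show ?thesis using p unfolding path_between_def by auto
  qed
  moreover have "gdist V E u v = 1 \<or> gdist V E u v = 2" using calculation(1,2) by linarith
  ultimately show "{u, v} \<in> E \<or> (\<exists>w. {u, w} \<in> E \<and> {w, v} \<in> E)"
    using gdist_one[OF assms(1,2)] by blast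
next
  assume "{u, v} \<in> E \<or> (\<exists>w. {u, w} \<in> E \<and> {w, v} \<in> E)"
  then show "gdist V E u v \<le> 2"
  proof
    assume "{u, v} \<in> E"
    then show ?thesis using gdist_one[OF assms(1,2)] by simp
  next
    assume "\<exists>w. {u, w} \<in> E \<and> {w, v} \<in> E"
    then obtain w where w: "{u, w} \<in> E" "{w, v} \<in> E" by blast
    then have "path_between V E u [u, w, v] v"
      using edge_distinct[of u w] edge_distinct[of w v] assms(3) unfolding path_between_def by auto
    then show ?thesis using gdist_le[of u "[u, w, v]" v 2] by simp
  qed
qed

end

section \<open>A maximal outerplanar graph as a triangulated polygon\<close>

locale boundary_order =
  fixes V :: "'a set" and E :: "'a set set" and xs :: "'a list" and n :: int
  assumes mop: "maximal_outerplanar V E"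
    and xs: "distinct xs" "set xs = V" "noncrossing E xs"
    and n: "n = int (length xs)" "3 \<le> n"
begin

lemma conn: "connected_graph V E" and simple: "simple_graph V E"
  using mop unfolding maximal_outerplanar_def connected_graph_def by auto

definition vert :: "int \<Rightarrow> 'a" where
  "vert i = xs ! nat (i mod n)"

definition adj :: "int \<Rightarrow> int \<Rightarrow> bool" where
  "adj i j \<longleftrightarrow> {vert i, vert j} \<in> E"

lemma mod_bound: "0 \<le> i mod n" "i mod n < n" "nat (i mod n) < length xs"
proof -
  show b: "0 \<le> i mod n" "i mod n < n" using n(2) by simp_all
  then show "nat (i mod n) < length xs" using n(1) by linarith
qed

lemma vert_V: "vert i \<in> V"
proof -
  show ?thesis unfolding vert_def using xs(2) mod_bound(3)[of i] by auto
qed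

lemma vert_eq: "vert i = vert j \<longleftrightarrow> i mod n = j mod n"
proof -
  show ?thesis unfolding vert_def nth_eq_iff_index_eq[OF xs(1) mod_bound(3) mod_bound(3)]
    using mod_bound[of i] mod_bound[of j] by (simp add: eq_nat_nat_iff)
qed

lemma vert_surj: "v \<in> V \<Longrightarrow> \<exists>i. 0 \<le> i \<and> i < n \<and> v = vert (i + c)"
proof -
  assume "v \<in> V"
  then obtain m where m: "m < length xs" "v = xs ! m" using xs(2) by (metis in_set_conv_nth)
  have "vert (((int m - c) mod n) + c) = v"
    unfolding vert_def using m n by (simp add: mod_simps)
  then show ?thesis using mod_bound[of "int m - c"] by blast
qed

lemma vert_nat: "m < length xs \<Longrightarrow> vert (int m) = xs ! m"
  unfolding vert_def using n by simp

lemma adj_mod: "adj (i mod n) (j mod n) = adj i j"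
  unfolding adj_def vert_def by simp

lemma no_cross_mod:
  assumes "0 \<le> i" "i < k" "k < j" "j < l" "l < n" "adj i j" "adj k l"
  shows False
proof -
  have "{xs ! nat i, xs ! nat j} \<in> E" "{xs ! nat k, xs ! nat l} \<in> E"
    using assms unfolding adj_def vert_def by simp_all
  moreover have "nat i < nat k" "nat k < nat j" "nat j < nat l" "nat l < length xs" using assms n by linarith+
  ultimately show False using xs(3) unfolding noncrossing_def by blast
qed

lemma adj_sym: "adj i j = adj j i"
  unfolding adj_def by (simp add: insert_commute)

lemma adj_add: "adj (i + n) j = adj i j" "adj i (j + n) = adj i j" "adj (i + n * c) j = adj i j" "adj i (j + n * c) = adj i j"
  unfolding adj_def vert_def by simp_all

lemma adj_shift: "adj (i - n * c) (j - n * c) = adj i j"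
  using adj_add(3)[where i = "i - n * c" and c = c and j = "j - n * c"]
    adj_add(4)[where i = i and j = "j - n * c" and c = c] by simp

lemma adj_minus: "adj (i - n) j = adj i j" "adj i (j - n) = adj i j"
  using adj_add(1)[of "i - n" j] adj_add(2)[of i "j - n"] by simp_all

sublocale triangulated_polygon n adj
proof
  show "3 \<le> n" by (rule n(2))
  show "adj (i + n) j = adj i j" for i j by (rule adj_add)
  show "adj i j \<Longrightarrow> adj j i" for i j using adj_sym by blast
  show "\<not> adj i i" for i using simple unfolding adj_def simple_graph_def by fastforce
  show False if a: "i < k" "k < j" "j < l" "l < i + n" "adj i j" "adj k l" for i k j l
  proof -
    define c where "c = i div n"
    have i: "i = i mod n + n * c" unfolding c_def by simp
    define i' k' j' l' where "i' = i - n * c" "k' = k - n * c" "j' = j - n * c" "l' = l - n * c"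
    note d = this
    have e: "adj i' j'" "adj k' l'"
      unfolding d adj_shift by (rule a(5), rule a(6))
    have b: "0 \<le> i'" "i' < n" "i' < k'" "k' < j'" "j' < l'" "l' < i' + n"
      using a i n pos_mod_sign[of n i] pos_mod_bound[of n i] unfolding d by linarith+
    \<comment> \<open>Indices that have passed \<open>n\<close> are reduced and moved to the front;
      this rotates the four indices, and they still interleave.\<close>
    consider "l' < n" | "n \<le> l'" "j' < n" | "n \<le> j'" "k' < n" | "n \<le> k'" by linarith
    then show False
    proof cases
      case 1 then show False using no_cross_mod[of i' k' j' l'] b e by simp
    next
      case 2 then show False
        using no_cross_mod[of "l' - n" i' k' j'] b e adj_minus(1)[of l' k'] adj_sym[of k' l'] by simp
    next
      case 3 then show False
        using no_cross_mod[of "j' - n" "l' - n" i' k'] b e adj_minus(1)[of j' i'] adj_sym[of i' j']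
          adj_minus(1)[of l' k'] adj_sym[of k' l'] by simp
    next
      case 4 then show False
        using no_cross_mod[of "k' - n" "j' - n" "l' - n" i'] b e adj_minus(1)[of j' i'] adj_sym[of i' j']
          adj_minus(1)[of k' "l' - n"] adj_minus(2)[of k' l'] by simp
    qed
  qed
  show "\<exists>k l. i < k \<and> k < j \<and> j < l \<and> l < i + n \<and> adj k l"
    if a: "i < j" "j < i + n" "\<not> adj i j" for i j
  proof -
    define c where "c = i div n"
    have i: "i = i mod n + n * c" unfolding c_def by simp
    define i' j' where "i' = i - n * c" "j' = j - n * c"
    note d = this
    have b: "0 \<le> i'" "i' < n" "i' < j'" "j' < i' + n"
      using a i n pos_mod_sign[of n i] pos_mod_bound[of n i] unfolding d by linarith+
    have m: "i mod n = i'" "j mod n = (if j' < n then j' else j' - n)"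
    proof -
      have "i mod n = i' mod n" "j mod n = j' mod n" unfolding d by (simp_all add: mod_diff_eq[symmetric])
      moreover have "j' mod n = j' - n" if "n \<le> j'"
        using that b mod_pos_pos_trivial[of "j' - n" n] minus_mod_self2[of j' n] by simp
      ultimately show "i mod n = i'" "j mod n = (if j' < n then j' else j' - n)" using b by auto
    qed
    let ?u = "vert i" and ?v = "vert j"
    have ne: "?u \<noteq> ?v" unfolding vert_eq m using b by auto
    have "{?u, ?v} \<notin> E" using a(3) unfolding adj_def .
    \<comment> \<open>Adding the missing edge must create a crossing in the order \<open>xs\<close>.
      As there was none before, the new edge takes part in it.\<close>
    then have "\<not> outerplanar V (insert {?u, ?v} E)"
      using mop vert_V ne unfolding maximal_outerplanar_def by blast
    moreover have "simple_graph V (insert {?u, ?v} E)"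
      using simple vert_V ne unfolding simple_graph_def by auto
    ultimately have "\<not> noncrossing (insert {?u, ?v} E) xs"
      using noncrossing_outerplanar xs by blast
    then obtain p x q y where pq: "p < x" "x < q" "q < y" "y < length xs"
      and E: "{xs ! p, xs ! q} \<in> insert {?u, ?v} E" "{xs ! x, xs ! y} \<in> insert {?u, ?v} E"
      unfolding noncrossing_def by blast
    have V4: "vert (int p) = xs ! p" "vert (int q) = xs ! q" "vert (int x) = xs ! x" "vert (int y) = xs ! y"
      using pq by (simp_all add: vert_nat)
    have nb: "\<not> ({xs ! p, xs ! q} \<in> E \<and> {xs ! x, xs ! y} \<in> E)" using xs(3) pq unfolding noncrossing_def by blast
    have two: "{xs ! p, xs ! q} \<noteq> {xs ! x, xs ! y}"
      using xs(1) pq by (auto simp: doubleton_eq_iff nth_eq_iff_index_eq)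
    \<comment> \<open>\<open>p'\<close> and \<open>q'\<close> are the ends of the new edge, and the
      edge from \<open>x'\<close> to \<open>y'\<close> crosses it. If the index of \<open>j\<close>
      passes \<open>n\<close>, its reduction comes before that of \<open>i\<close>, so
      \<open>x'\<close> and \<open>y'\<close> exchange their sides.\<close>
    have key: ?thesis if "{vert p', vert q'} = {?u, ?v}" "adj x' y'" "0 \<le> p'" "p' < x'" "x' < q'" "q' < n"
        "0 \<le> y'" "y' < n" "y' < p' \<or> q' < y'" for p' q' x' y'
    proof -
      have pm: "p' mod n = p'" "q' mod n = q'" using that by auto
      have s: "(p' = i mod n \<and> q' = j mod n) \<or> (p' = j mod n \<and> q' = i mod n)"
        using that(1) pm unfolding doubleton_eq_iff vert_eq by auto
      define y2 where "y2 = (if q' < y' then y' else y' + n)"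
      have ay: "adj x' y2" "adj y2 x'" "adj y2 (x' + n)" unfolding y2_def using that(2) adj_add adj_sym by auto
      show ?thesis
      proof (cases "j' < n")
        case True
        then have "p' = i'" "q' = j'" using s m b that by auto
        then show ?thesis
          using ay(1) that b adj_add(3)[of x' c] adj_add(4)[of _ y2 c] unfolding d y2_def
          by (intro exI[of _ "x' + n * c"] exI[of _ "y2 + n * c"]) (auto simp: d y2_def)
      next
        case False
        then have "p' = j' - n" "q' = i'" using s m b that by auto
        then show ?thesis
          using ay(3) that b adj_add(3)[of y2 c] adj_add(4)[of _ "x' + n" c] False unfolding d y2_def
          by (intro exI[of _ "y2 + n * c"] exI[of _ "x' + n + n * c"]) (auto simp: d y2_def)
      qed
    qed
    show ?thesis
    proof (cases "{xs ! p, xs ! q} \<in> E")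
      case True
      then have "{xs ! x, xs ! y} = {?u, ?v}" using E nb by auto
      moreover have "adj (int q) (int p)" using True V4 unfolding adj_def by (simp add: insert_commute)
      ultimately show ?thesis using key[of "int x" "int y" "int q" "int p"] pq V4 n by auto
    next
      case False
      then have "{xs ! p, xs ! q} = {?u, ?v}" using E by auto
      moreover from this have "adj (int x) (int y)" using E two V4 unfolding adj_def by auto
      ultimately show ?thesis using key[of "int p" "int q" "int x" "int y"] pq V4 n by auto
    qed
  qed
qed

text \<open>The translation by \<open>p - 2\<close> brings the ear to index 2. If all distances to
  \<open>L\<close> agree, then so do adjacency and distance at most 2, and this is all that
  \<open>unresolved\<close> asks for.\<close>

theorem solution_resolving:
  assumes ear: "\<And>y. adj p y \<Longrightarrow> y mod n = (p - 1) mod n \<or> y mod n = (p + 1) mod n"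
  defines "e \<equiv> \<lambda>i j. adj (i + (p - 2)) (j + (p - 2))"
  defines "L \<equiv> (\<lambda>i. vert (i + (p - 2))) ` solution n e"
  shows "ear_at_two n e" "resolving_set V E L" "int (card L) = \<lceil>2 * real (card V) / 5\<rceil>"
proof -
  let ?c = "p - 2"
  interpret T: triangulated_polygon n e unfolding e_def by (rule translated)
  show at2: "ear_at_two n e"
  proof
    fix y assume "e 2 y"
    then have "(y + ?c) mod n = (1 + ?c) mod n \<or> (y + ?c) mod n = (3 + ?c) mod n"
      using ear[of "y + ?c"] unfolding e_def by (simp add: algebra_simps)
    then show "y mod n = 1 mod n \<or> y mod n = 3 mod n"
      by (simp add: mod_eq_dvd_iff)
  qed
  interpret T2: ear_at_two n e by (rule at2)
  have inj: "inj_on (\<lambda>i. vert (i + ?c)) {0..<n}"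
  proof (rule inj_onI)
    fix i j assume "i \<in> {0..<n}" "j \<in> {0..<n}" "vert (i + ?c) = vert (j + ?c)"
    then show "i = j" unfolding vert_eq by (auto simp: mod_eq_dvd_iff zdvd_not_zless dest: zdvd_not_zless)
       (metis diff_self eq_iff_diff_eq_0 mod_eq_dvd_iff mod_pos_pos_trivial)
  qed
  have "card V = length xs" using xs distinct_card by fastforce
  then show "int (card L) = \<lceil>2 * real (card V) / 5\<rceil>"
    unfolding L_def using card_image[OF inj_on_subset[OF inj T2.solution_bound]] T2.card_solution n(1) by simp
  show "resolving_set V E L"
    unfolding resolving_set_def
  proof (intro conjI ballI impI)
    show "L \<subseteq> V" unfolding L_def using vert_V by auto
    fix u v assume uv: "u \<in> V" "v \<in> V" "u \<noteq> v"
    obtain i j where i: "0 \<le> i" "i < n" "u = vert (i + ?c)" and j: "0 \<le> j" "j < n" "v = vert (j + ?c)"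
      using vert_surj[OF uv(1), of ?c] vert_surj[OF uv(2), of ?c] by blast
    show "\<exists>x\<in>L. resolves V E x u v"
    proof (rule ccontr)
      assume "\<not> ?thesis"
      then have eq: "gdist V E u s = gdist V E v s" if "s \<in> L" for s using that unfolding resolves_def by blast
      let ?S = "\<lambda>x. x mod n \<in> solution n e"
      have SL: "vert (s + ?c) \<in> L" if "?S s" for s
      proof -
        have "vert (s + ?c) = vert (s mod n + ?c)" unfolding vert_eq by (simp add: mod_simps)
        then show ?thesis unfolding L_def using that by auto
      qed
      have nu: "u \<notin> L" using eq[of u] gdist_zero[OF conn uv(1) uv(1)] gdist_zero[OF conn uv(2) uv(1)] uv(3) by auto
      have nv: "v \<notin> L" using eq[of v] gdist_zero[OF conn uv(1) uv(2)] gdist_zero[OF conn uv(2) uv(2)] uv(3) by auto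
      have cl: "T.close m s \<longleftrightarrow> gdist V E (vert (m + ?c)) (vert (s + ?c)) \<le> 2"
        if ne: "vert (m + ?c) \<noteq> vert (s + ?c)" for m s
      proof -
        have "(\<exists>w. e m w \<and> e w s) \<longleftrightarrow> (\<exists>w. {vert (m + ?c), w} \<in> E \<and> {w, vert (s + ?c)} \<in> E)"
        proof
          assume "\<exists>w. e m w \<and> e w s"
          then show "\<exists>w. {vert (m + ?c), w} \<in> E \<and> {w, vert (s + ?c)} \<in> E" unfolding e_def adj_def by blast
        next
          assume "\<exists>w. {vert (m + ?c), w} \<in> E \<and> {w, vert (s + ?c)} \<in> E"
          then obtain w where w: "{vert (m + ?c), w} \<in> E" "{w, vert (s + ?c)} \<in> E" by blast
          then have "w \<in> V" using edge_distinct[OF conn] by blast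
          then obtain x where "w = vert (x + ?c)" using vert_surj by blast
          then show "\<exists>w. e m w \<and> e w s" using w unfolding e_def adj_def by blast
        qed
        then show ?thesis
          unfolding T.close_def gdist_two[OF conn vert_V vert_V ne] by (simp add: e_def adj_def)
      qed
      have "T.unresolved ?S i j"
        unfolding T.unresolved_def
      proof (intro conjI allI impI)
        show "\<not> ?S i" using SL[of i] nu i(3) by auto
        show "\<not> ?S j" using SL[of j] nv j(3) by auto
        show "i mod n \<noteq> j mod n" using i j uv(3) by auto
        fix s assume s: "?S s"
        have ne: "vert (i + ?c) \<noteq> vert (s + ?c)" "vert (j + ?c) \<noteq> vert (s + ?c)" using SL[OF s] nu nv i j by auto
        show "e i s = e j s"
          using eq[OF SL[OF s]] gdist_one[OF conn uv(1) vert_V, of "s + ?c"] gdist_one[OF conn uv(2) vert_V, of "s + ?c"] i(3) j(3)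
          unfolding e_def adj_def by simp
        show "T.close i s = T.close j s"
          unfolding cl[OF ne(1)] cl[OF ne(2)] using eq[OF SL[OF s]] i(3) j(3) by simp
      qed
      then show False using T2.solution_resolved[OF i(1,2) j(1,2)] by blast
    qed
  qed
qed

end

theorem resolving_set_exists:
  assumes "maximal_outerplanar V E" "card V \<ge> 3"
  shows "\<exists>S. S \<subseteq> V \<and> resolving_set V E S \<and> int (card S) = \<lceil>2 * real (card V) / 5\<rceil>"
proof -
  have "outerplanar V E" "simple_graph V E"
    using assms(1) unfolding maximal_outerplanar_def connected_graph_def by auto
  then obtain xs where xs: "distinct xs" "set xs = V" "noncrossing E xs"
    using outerplanar_noncrossing_order by blast
  then have "3 \<le> int (length xs)" using assms(2) distinct_card by fastforce
  then interpret boundary_order V E xs "int (length xs)"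
    using assms(1) xs by unfold_locales auto
  show ?thesis
  proof (rule ear_exists)
    fix p
    assume p: "\<And>y. adj p y \<Longrightarrow> y mod int (length xs) = (p - 1) mod int (length xs) \<or> y mod int (length xs) = (p + 1) mod int (length xs)"
    note S = solution_resolving(2,3)[OF p]
    show ?thesis using S(1)[unfolded resolving_set_def, THEN conjunct1] S by (intro exI conjI)
  qed
qed

section \<open>A linear-time program\<close>

definition run :: "nat \<Rightarrow> cmd \<Rightarrow> state \<Rightarrow> (nat \<Rightarrow> state \<Rightarrow> bool) \<Rightarrow> bool" where
  "run W c s P \<longleftrightarrow> (\<exists>t s'. exec W c s t s' \<and> P t s')"

lemma run_Skip: "P 1 s \<Longrightarrow> run W Skip s P"
  unfolding run_def by (blast intro: exec.intros)

lemma run_Put: "k \<le> W \<Longrightarrow> P 1 (r(x := k), m) \<Longrightarrow> run W (Put x k) (r, m) P"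
  unfolding run_def by (blast intro: exec.intros)

lemma run_Add: "r y + r z \<le> W \<Longrightarrow> P 1 (r(x := r y + r z), m) \<Longrightarrow> run W (Add x y z) (r, m) P"
  unfolding run_def by (blast intro: exec.intros)

lemma run_Sub: "P 1 (r(x := r y - r z), m) \<Longrightarrow> run W (Sub x y z) (r, m) P"
  unfolding run_def by (blast intro: exec.intros)

lemma run_Load: "P 1 (r(x := m (r a)), m) \<Longrightarrow> run W (Load x a) (r, m) P"
  unfolding run_def by (blast intro: exec.intros)

lemma run_Store: "P 1 (r, m(r a := r x)) \<Longrightarrow> run W (Store a x) (r, m) P"
  unfolding run_def by (blast intro: exec.intros)

lemma run_Seq: "run W c1 s (\<lambda>t1 s'. run W c2 s' (\<lambda>t2. P (t1 + t2))) \<Longrightarrow> run W (Seq c1 c2) s P"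
  unfolding run_def by (blast intro: exec.intros)

lemma run_If:
  "(r x < r y \<Longrightarrow> run W c1 (r, m) (\<lambda>t. P (t + 1))) \<Longrightarrow> (\<not> r x < r y \<Longrightarrow> run W c2 (r, m) (\<lambda>t. P (t + 1))) \<Longrightarrow>
    run W (IfLess x y c1 c2) (r, m) P"
  unfolding run_def by (cases "r x < r y") (blast intro: exec.intros)+

lemma run_While_False: "\<not> r x < r y \<Longrightarrow> P 1 (r, m) \<Longrightarrow> run W (WhileLess x y c) (r, m) P"
  unfolding run_def by (blast intro: exec.intros)

lemma run_While_True:
  "r x < r y \<Longrightarrow> run W c (r, m) (\<lambda>t1 s'. run W (WhileLess x y c) s' (\<lambda>t2. P (t1 + t2 + 1))) \<Longrightarrow>
    run W (WhileLess x y c) (r, m) P"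
  unfolding run_def by (blast intro: exec.intros)

lemma run_mono: "run W c s P \<Longrightarrow> (\<And>t s'. P t s' \<Longrightarrow> Q t s') \<Longrightarrow> run W c s Q"
  unfolding run_def by blast

lemmas run_straight = run_Seq run_Put run_Add run_Sub run_Load run_Store

text \<open>An abstract machine whose instructions consult the adjacency lists directly. Its states consist
  of registers, vertex labels and an output list.\<close>

datatype instr =
    First nat nat
  | Second nat nat
  | Last nat nat
  | Degree nat nat
  | Edge nat nat nat
  | Get nat nat
  | Mark nat nat
  | Out nat
  | Sel nat nat nat nat
  | And nat nat nat
  | Or nat nat nat
  | AndNot nat nat nat
  | Const nat nat
  | Inc nat
  | Dec nat nat

type_synonym astate = "(nat \<Rightarrow> nat) \<times> (nat \<Rightarrow> nat) \<times> nat list"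

fun sem :: "nat list list \<Rightarrow> instr \<Rightarrow> astate \<Rightarrow> astate" where
  "sem adj (First x y) (r, l, out) = (r(x := adj ! r y ! 0), l, out)"
| "sem adj (Second x y) (r, l, out) = (r(x := adj ! r y ! Suc 0), l, out)"
| "sem adj (Last x y) (r, l, out) = (r(x := last (adj ! r y)), l, out)"
| "sem adj (Degree x y) (r, l, out) = (r(x := length (adj ! r y)), l, out)"
| "sem adj (Edge x y z) (r, l, out) = (r(x := of_bool (r z \<in> set (adj ! r y))), l, out)"
| "sem adj (Get x y) (r, l, out) = (r(x := l (r y)), l, out)"
| "sem adj (Mark x k) (r, l, out) = (r, l(r x := k), out)"
| "sem adj (Out x) (r, l, out) = (r, l, out @ [r x])"
| "sem adj (Sel x c y z) (r, l, out) = (r(x := if 0 < r c then r y else r z), l, out)"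
| "sem adj (And x y z) (r, l, out) = (r(x := of_bool (0 < r y \<and> 0 < r z)), l, out)"
| "sem adj (Or x y z) (r, l, out) = (r(x := of_bool (0 < r y \<or> 0 < r z)), l, out)"
| "sem adj (AndNot x y z) (r, l, out) = (r(x := of_bool (0 < r y \<and> \<not> 0 < r z)), l, out)"
| "sem adj (Const x k) (r, l, out) = (r(x := k), l, out)"
| "sem adj (Inc x) (r, l, out) = (r(x := r x + 1), l, out)"
| "sem adj (Dec x k) (r, l, out) = (r(x := r x - k), l, out)"

fun defined :: "nat list list \<Rightarrow> nat \<Rightarrow> instr \<Rightarrow> astate \<Rightarrow> bool" where
  "defined adj W (First x y) (r, l, out) \<longleftrightarrow> r y < length adj"
| "defined adj W (Second x y) (r, l, out) \<longleftrightarrow> r y < length adj"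
| "defined adj W (Last x y) (r, l, out) \<longleftrightarrow> r y < length adj"
| "defined adj W (Degree x y) (r, l, out) \<longleftrightarrow> r y < length adj"
| "defined adj W (Edge x y z) (r, l, out) \<longleftrightarrow> r y < length adj"
| "defined adj W (Get x y) (r, l, out) \<longleftrightarrow> r y < length adj"
| "defined adj W (Mark x k) (r, l, out) \<longleftrightarrow> r x < length adj \<and> k \<le> W"
| "defined adj W (Out x) (r, l, out) \<longleftrightarrow> length out < length adj"
| "defined adj W (Sel x c y z) (r, l, out) \<longleftrightarrow> r y \<le> W \<and> r z \<le> W"
| "defined adj W (And x y z) (r, l, out) \<longleftrightarrow> True"
| "defined adj W (Or x y z) (r, l, out) \<longleftrightarrow> True"
| "defined adj W (AndNot x y z) (r, l, out) \<longleftrightarrow> True"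
| "defined adj W (Const x k) (r, l, out) \<longleftrightarrow> k \<le> W"
| "defined adj W (Inc x) (r, l, out) \<longleftrightarrow> r x < W"
| "defined adj W (Dec x k) (r, l, out) \<longleftrightarrow> k \<le> W"

text \<open>Reading one entry of an adjacency list takes at most 6 units, loop test included;
  everything else about an instruction fits into 10.\<close>

fun cost :: "nat list list \<Rightarrow> instr \<Rightarrow> astate \<Rightarrow> nat" where
  "cost adj (Edge x y z) (r, l, out) = 10 + 6 * length (adj ! r y)"
| "cost adj i s = 10"

text \<open>Register \<open>x\<close> of the abstract machine is register \<open>x + 10\<close>. Register 8 holds the address of the
  labels; registers 2 to 7 are scratch.\<close>

fun code :: "instr \<Rightarrow> cmd" where
  "code (First x y) = Seq (Put 2 1) (Seq (Add 3 2 (y + 10)) (Seq (Load 3 3) (Load (x + 10) 3)))"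
| "code (Second x y) =
    Seq (Put 2 1) (Seq (Add 3 2 (y + 10)) (Seq (Load 3 3) (Seq (Add 3 3 2) (Load (x + 10) 3))))"
| "code (Last x y) =
    Seq (Put 2 2) (Seq (Add 3 2 (y + 10)) (Seq (Load 3 3) (Seq (Put 2 1) (Seq (Sub 3 3 2) (Load (x + 10) 3)))))"
| "code (Degree x y) =
    Seq (Put 2 1) (Seq (Add 3 2 (y + 10)) (Seq (Load 4 3) (Seq (Add 3 3 2) (Seq (Load 5 3) (Sub (x + 10) 5 4)))))"
| "code (Edge x y z) =
    Seq (Put 2 1) (Seq (Add 3 2 (y + 10)) (Seq (Load 4 3) (Seq (Add 3 3 2) (Seq (Load 5 3) (Seq (Put 6 0)
      (Seq (WhileLess 4 5 (Seq (Load 7 4)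
        (Seq (IfLess 7 (z + 10) Skip (IfLess (z + 10) 7 Skip (Put 6 1))) (Add 4 4 2))))
      (Seq (Put 7 0) (Add (x + 10) 6 7))))))))"
| "code (Get x y) = Seq (Add 3 8 (y + 10)) (Load (x + 10) 3)"
| "code (Mark x k) = Seq (Put 2 k) (Seq (Add 3 8 (x + 10)) (Store 3 2))"
| "code (Out x) = Seq (Add 3 0 1) (Seq (Store 3 (x + 10)) (Seq (Put 2 1) (Add 1 1 2)))"
| "code (Sel x c y z) = Seq (Put 2 0) (IfLess 2 (c + 10) (Add (x + 10) (y + 10) 2) (Add (x + 10) (z + 10) 2))"
| "code (And x y z) = Seq (Put 2 0) (Seq (Put 3 0) (Seq
    (IfLess 2 (y + 10) (IfLess 2 (z + 10) (Put 3 1) Skip) Skip) (Add (x + 10) 3 2)))"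
| "code (Or x y z) = Seq (Put 2 0) (Seq (Put 3 0) (Seq
    (IfLess 2 (y + 10) (Put 3 1) (IfLess 2 (z + 10) (Put 3 1) Skip)) (Add (x + 10) 3 2)))"
| "code (AndNot x y z) = Seq (Put 2 0) (Seq (Put 3 0) (Seq
    (IfLess 2 (y + 10) (IfLess 2 (z + 10) Skip (Put 3 1)) Skip) (Add (x + 10) 3 2)))"
| "code (Const x k) = Put (x + 10) k"
| "code (Inc x) = Seq (Put 2 1) (Add (x + 10) (x + 10) 2)"
| "code (Dec x k) = Seq (Put 2 k) (Sub (x + 10) (x + 10) 2)"

fun block :: "instr list \<Rightarrow> cmd" where
  "block [] = Skip"
| "block (i # is) = Seq (code i) (block is)"

fun sems :: "nat list list \<Rightarrow> instr list \<Rightarrow> astate \<Rightarrow> astate" where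
  "sems adj [] a = a"
| "sems adj (i # is) a = sems adj is (sem adj i a)"

fun defineds :: "nat list list \<Rightarrow> nat \<Rightarrow> instr list \<Rightarrow> astate \<Rightarrow> bool" where
  "defineds adj W [] a \<longleftrightarrow> True"
| "defineds adj W (i # is) a \<longleftrightarrow> defined adj W i a \<and> defineds adj W is (sem adj i a)"

fun costs :: "nat list list \<Rightarrow> instr list \<Rightarrow> astate \<Rightarrow> nat" where
  "costs adj [] a = 1"
| "costs adj (i # is) a = cost adj i a + costs adj is (sem adj i a)"

lemma length_concat_take:
  "v < length ls \<Longrightarrow> length (concat (take (Suc v) ls)) = length (concat (take v ls)) + length (ls ! v)"
  by (simp add: take_Suc_conv_app_nth)

lemma concat_nth: "v < length ls \<Longrightarrow> i < length (ls ! v) \<Longrightarrow> concat ls ! (length (concat (take v ls)) + i) = ls ! v ! i"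
proof -
  assume v: "v < length ls" and i: "i < length (ls ! v)"
  have "concat ls = concat (take v ls) @ ls ! v @ concat (drop (Suc v) ls)"
    using id_take_nth_drop[OF v] by (metis concat.simps(2) concat_append)
  then show ?thesis using i by (simp add: nth_append)
qed

lemma length_concat_take_le: "length (concat (take v ls)) \<le> length (concat ls)"
  by (metis append_take_drop_id concat_append le_add1 length_append)

section \<open>Simulation of the abstract machine\<close>

locale ram_input =
  fixes adj :: "nat list list" and n W :: nat
  assumes n: "length adj = n" "0 < n"
    and adj: "\<And>v. v < n \<Longrightarrow> 2 \<le> length (adj ! v)" "\<And>v. v < n \<Longrightarrow> set (adj ! v) \<subseteq> {..<n}"
    and total: "length (concat adj) \<le> 4 * n"
    and W: "20 * n \<le> W"
begin

text \<open>The labels occupy the \<open>n\<close> cells behind the input, where the initial memory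
  is 0, and the output list follows them.\<close>

definition labels :: nat where "labels = n + 2 + length (concat adj)"

definition start :: "nat \<Rightarrow> nat" where "start v = n + 2 + length (concat (take v adj))"

definition input :: "(nat \<Rightarrow> nat) \<Rightarrow> bool" where
  "input m \<longleftrightarrow> m 0 = n \<and> (\<forall>v\<le>n. m (1 + v) = start v) \<and> (\<forall>v<n. \<forall>i<length (adj ! v). m (start v + i) = adj ! v ! i)"

text \<open>Machine registers 0 and 1 always hold the start and length of the output, so a final
  state can be read by \<open>output_set\<close> at once.\<close>

definition sim :: "state \<Rightarrow> astate \<Rightarrow> bool" where
  "sim s a \<longleftrightarrow> (case (s, a) of ((rr, m), (r, l, out)) \<Rightarrow>
    (\<forall>x. rr (x + 10) = r x) \<and> rr 8 = labels \<and> rr 0 = labels + n \<and> rr 1 = length out \<and> input m \<and>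
    (\<forall>v<n. m (labels + v) = l v) \<and> (\<forall>j<length out. m (labels + n + j) = out ! j))"

lemma start_Suc: "v < n \<Longrightarrow> start (Suc v) = start v + length (adj ! v)"
  unfolding start_def using length_concat_take[of v adj] n(1) by simp

lemma start_le: "start v \<le> labels"
  unfolding start_def labels_def using length_concat_take_le by simp

lemma start_bound: "v < n \<Longrightarrow> i < length (adj ! v) \<Longrightarrow> start v + i < labels"
  using start_Suc[of v] start_le[of "Suc v"] by simp

text \<open>Addresses stay below \<open>labels + 2 * n\<close>, as \<open>n\<close> labels are
  followed by at most \<open>n\<close> outputs. This is where the bound on the input length meets
  the word size.\<close>

lemma labels_le: "labels \<le> 5 * n + 2" "labels + 2 * n \<le> W"
  unfolding labels_def using total W n(2) by simp_all

lemma input_encode: "input (snd (initial_state (encode_adj adj)))"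
proof -
  have "encode_adj adj ! (1 + v) = start v" if "v \<le> n" for v
    unfolding encode_adj_def start_def using that n(1) by (simp add: nth_append del: upt_Suc)
  moreover have "encode_adj adj ! (start v + i) = adj ! v ! i" if "v < n" "i < length (adj ! v)" for v i
    unfolding encode_adj_def start_def using that n(1) concat_nth[of v adj i]
    by (simp add: nth_append nth_Cons' del: upt_Suc)
  moreover have "length (encode_adj adj) = labels" unfolding encode_adj_def labels_def using n(1) by simp
  moreover have "1 + v < labels" if "v \<le> n" for v unfolding labels_def using that by simp
  moreover have "encode_adj adj ! 0 = n" "0 < labels" unfolding encode_adj_def labels_def using n(1) by simp_all
  ultimately show ?thesis unfolding input_def initial_state_def using start_bound by auto
qed

lemma input_store: "input m \<Longrightarrow> labels \<le> a \<Longrightarrow> input (m(a := k))"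
proof -
  assume m: "input m" and a: "labels \<le> a"
  have "1 + v \<noteq> a" if "v \<le> n" for v using that a unfolding labels_def by simp
  moreover have "start v + i \<noteq> a" if "v < n" "i < length (adj ! v)" for v i using start_bound[OF that] a by simp
  moreover have "0 \<noteq> a" using a unfolding labels_def by simp
  ultimately show ?thesis using m unfolding input_def by auto
qed

text \<open>Induction on the number \<open>k\<close> of unread entries. The loop body takes at most
  5 units, since equality is decided by two failing comparisons; with the test this gives 6 per
  entry and 1 for leaving the loop.\<close>

lemma scan:
  fixes z :: nat
  defines "c \<equiv> WhileLess 4 5 (Seq (Load 7 4) (Seq (IfLess 7 (z + 10) Skip (IfLess (z + 10) 7 Skip (Put 6 1))) (Add 4 4 2)))"
  assumes m: "input m" and v: "v < n"
    and rr: "rr 2 = 1" "rr 5 = start v + length (adj ! v)" "rr 4 + k = rr 5" "k \<le> length (adj ! v)"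
    and P: "\<And>t rr'. t \<le> 6 * k + 1 \<Longrightarrow> (\<And>x. x \<notin> {4, 6, 7} \<Longrightarrow> rr' x = rr x) \<Longrightarrow>
      rr' 6 = (if rr (z + 10) \<in> set (drop (length (adj ! v) - k) (adj ! v)) then 1 else rr 6) \<Longrightarrow> P t (rr', m)"
  shows "run W c (rr, m) P"
  using rr P
proof (induction k arbitrary: rr P)
  case 0
  show ?case unfolding c_def
    by (rule run_While_False) (use 0 in auto)
next
  case (Suc k)
  let ?i = "length (adj ! v) - Suc k"
  have i: "rr 4 = start v + ?i" "?i < length (adj ! v)" using Suc.prems by auto
  have mi: "m (rr 4) = adj ! v ! ?i" using m v i unfolding input_def by auto
  have bound: "rr 4 + rr 2 \<le> W" using start_bound[OF v i(2)] i(1) Suc.prems(1) labels_le(2) n by simp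
  have drop: "drop ?i (adj ! v) = adj ! v ! ?i # drop (length (adj ! v) - k) (adj ! v)"
    using i(2) Suc.prems(4) Cons_nth_drop_Suc[of ?i "adj ! v"] by (simp add: Suc_diff_Suc)
  let ?f = "if adj ! v ! ?i = rr (z + 10) then 1 else rr 6"
  let ?rr = "rr(7 := adj ! v ! ?i, 6 := ?f, 4 := rr 4 + 1)"
  have rec: "run W c (?rr, m) P'" if "P' = (\<lambda>t. P (t1 + t + 1))" "t1 \<le> 5" for P' t1
  proof (rule Suc.IH)
    show "?rr 2 = 1" "?rr 5 = start v + length (adj ! v)" "?rr 4 + k = ?rr 5" "k \<le> length (adj ! v)"
      using Suc.prems by auto
    fix t rr'
    assume t: "t \<le> 6 * k + 1" "\<And>x. x \<notin> {4, 6, 7} \<Longrightarrow> rr' x = ?rr x"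
      "rr' 6 = (if ?rr (z + 10) \<in> set (drop (length (adj ! v) - k) (adj ! v)) then 1 else ?rr 6)"
    show "P' t (rr', m)" unfolding that(1)
    proof (rule Suc.prems(5))
      show "t1 + t + 1 \<le> 6 * Suc k + 1" using that(2) t(1) by simp
      show "rr' x = rr x" if "x \<notin> {4, 6, 7}" for x using t(2)[OF that] that by simp
      show "rr' 6 = (if rr (z + 10) \<in> set (drop ?i (adj ! v)) then 1 else rr 6)"
        unfolding drop t(3) by auto
    qed
  qed
  have upd: "rr(7 := adj ! v ! ?i, 4 := rr 4 + 1) = ?rr" if "adj ! v ! ?i \<noteq> rr (z + 10)" using that by auto
  have "run W (Seq (Load 7 4) (Seq (IfLess 7 (z + 10) Skip (IfLess (z + 10) 7 Skip (Put 6 1))) (Add 4 4 2)))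
    (rr, m) (\<lambda>t1 s'. t1 \<le> 5 \<and> s' = (?rr, m))"
    using bound mi Suc.prems(1) W n(2)
    by (intro run_straight run_If run_Skip) (auto simp: upd)
  then have "run W (Seq (Load 7 4) (Seq (IfLess 7 (z + 10) Skip (IfLess (z + 10) 7 Skip (Put 6 1))) (Add 4 4 2)))
    (rr, m) (\<lambda>t1 s'. run W c s' (\<lambda>t. P (t1 + t + 1)))"
    by (rule run_mono) (use rec in blast)
  then show ?case unfolding c_def using Suc.prems(3) by (intro run_While_True) auto
qed

lemma code_sim:
  assumes s: "sim s a" and d: "defined adj W i a"
  shows "run W (code i) s (\<lambda>t s'. t \<le> cost adj i a \<and> sim s' (sem adj i a))"
proof -
  obtain rr m r l out where sa: "s = (rr, m)" "a = (r, l, out)" by (metis prod.collapse)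
  have reg: "rr (x + 10) = r x" for x using s unfolding sim_def sa by simp
  have base: "rr 8 = labels" "rr 0 = labels + n" "rr 1 = length out" "input m" "\<And>v. v < n \<Longrightarrow> m (labels + v) = l v"
    "\<And>j. j < length out \<Longrightarrow> m (labels + n + j) = out ! j"
    using s unfolding sim_def sa by auto
  have mem: "m (Suc v) = start v" "m (Suc (Suc v)) = start v + length (adj ! v)" "m (start v) = adj ! v ! 0"
    "m (Suc (start v)) = adj ! v ! 1" "m (start v + length (adj ! v) - Suc 0) = last (adj ! v)" if "v < n" for v
  proof -
    show "m (Suc v) = start v" "m (Suc (Suc v)) = start v + length (adj ! v)"
      using base(4) that start_Suc[OF that] unfolding input_def by (force, metis Suc_eq_plus1_left Suc_leI)
    have e: "\<And>i. i < length (adj ! v) \<Longrightarrow> m (start v + i) = adj ! v ! i" using base(4) that unfolding input_def by blast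
    have ne: "0 < length (adj ! v)" "1 < length (adj ! v)" "adj ! v \<noteq> []" using adj(1)[OF that] by auto
    show "m (start v) = adj ! v ! 0" "m (Suc (start v)) = adj ! v ! 1" using e[OF ne(1)] e[OF ne(2)] by simp_all
    show "m (start v + length (adj ! v) - Suc 0) = last (adj ! v)"
      using e[of "length (adj ! v) - 1"] ne by (simp add: last_conv_nth)
  qed
  have le: "start v \<le> labels" "labels + 2 * n \<le> W" "20 * n \<le> W" for v using start_le labels_le W by auto
  have bd: "start v + length (adj ! v) \<le> labels" if "v < n" for v using start_le[of "Suc v"] start_Suc[OF that] by simp
  show ?thesis
  proof (cases i)
    case (First x y)
    then show ?thesis using d n mem[of "r y"] le base reg unfolding sa sim_def
      by (auto intro!: run_straight)
  next
    case (Second x y)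
    then show ?thesis using d n mem[of "r y"] le(2,3) le(1)[of "r y"] base reg unfolding sa sim_def
      by (auto intro!: run_straight)
  next
    case (Last x y)
    then show ?thesis using d n mem[of "r y"] le base reg unfolding sa sim_def
      by (auto intro!: run_straight)
  next
    case (Degree x y)
    then show ?thesis using d n mem[of "r y"] le base reg unfolding sa sim_def
      by (auto intro!: run_straight)
  next
    case (Edge x y z)
    have y: "r y < n" using d n Edge sa by simp
    show ?thesis unfolding Edge sa code.simps
    proof (rule run_Seq, rule run_Put, goal_cases)
      case 1 show ?case using le n by simp
    next
      case 2 show ?case
        apply (rule run_Seq, rule run_Add)
        subgoal using y le(2) n by (simp add: reg)
        apply (rule run_Seq, rule run_Load, rule run_Seq, rule run_Add)
        subgoal using y le(2) n by (simp add: reg)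
        apply (rule run_Seq, rule run_Load, rule run_Seq, rule run_Put)
        subgoal by simp
        apply (rule run_Seq, rule scan[OF base(4) y, where k = "length (adj ! r y)"])
        subgoal by simp
        subgoal using mem[OF y] by (simp add: reg)
        subgoal using mem[OF y] by (simp add: reg)
        subgoal by simp
        subgoal for t rr'
          using base reg le n unfolding sim_def by (intro run_straight) auto
        done
    qed
  next
    case (Get x y)
    then show ?thesis using d n le base reg unfolding sa sim_def
      by (auto intro!: run_straight)
  next
    case (Mark x k)
    then show ?thesis using d n le base reg input_store[OF base(4)] unfolding sa sim_def
      by (auto intro!: run_straight)
  next
    case (Out x)
    then show ?thesis using d n le base reg input_store[OF base(4)] unfolding sa sim_def
      by (auto intro!: run_straight simp: nth_append less_Suc_eq)
  next
    case (Sel x c y z)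
    then show ?thesis using d n le base reg unfolding sa sim_def
      by (auto intro!: run_straight run_If)
  next
    case (And x y z)
    show ?thesis unfolding And sa code.simps
      by (intro run_straight run_If run_Skip; insert le(3) n base reg; simp add: sim_def)
  next
    case (Or x y z)
    show ?thesis unfolding Or sa code.simps
      by (intro run_straight run_If run_Skip; insert le(3) n base reg; simp add: sim_def)
  next
    case (AndNot x y z)
    show ?thesis unfolding AndNot sa code.simps
      by (intro run_straight run_If run_Skip; insert le(3) n base reg; simp add: sim_def)
  next
    case (Const x k)
    then show ?thesis using d n le base reg unfolding sa sim_def
      by (auto intro!: run_straight)
  next
    case (Inc x)
    then show ?thesis using d n le base reg unfolding sa sim_def
      by (auto intro!: run_straight)
  next
    case (Dec x k)
    then show ?thesis using d n le base reg unfolding sa sim_def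
      by (auto intro!: run_straight)
  qed
qed

text \<open>Quantifying over all machine states that represent \<open>a\<close> leaves the scratch
  registers open, so that abstract steps can be chained.\<close>

definition reach :: "cmd \<Rightarrow> nat \<Rightarrow> astate \<Rightarrow> astate \<Rightarrow> bool" where
  "reach c T a b \<longleftrightarrow> (\<forall>s. sim s a \<longrightarrow> run W c s (\<lambda>t s'. t \<le> T \<and> sim s' b))"

lemma reach_Skip: "reach Skip 1 a a"
  unfolding reach_def by (auto intro: run_Skip)

lemma reach_Seq: "reach c T a b \<Longrightarrow> reach c' T' b b' \<Longrightarrow> reach (Seq c c') (T + T') a b'"
  unfolding reach_def
proof (intro allI impI run_Seq)
  fix s assume r: "\<forall>s. sim s a \<longrightarrow> run W c s (\<lambda>t s'. t \<le> T \<and> sim s' b)"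
    "\<forall>s. sim s b \<longrightarrow> run W c' s (\<lambda>t s'. t \<le> T' \<and> sim s' b')" "sim s a"
  show "run W c s (\<lambda>t1 s'. run W c' s' (\<lambda>t2 s'. t1 + t2 \<le> T + T' \<and> sim s' b'))"
  proof (rule run_mono)
    show "run W c s (\<lambda>t s'. t \<le> T \<and> sim s' b)" using r(1,3) by blast
    fix t s' assume t: "t \<le> T \<and> sim s' b"
    then have "run W c' s' (\<lambda>t s'. t \<le> T' \<and> sim s' b')" using r(2) by blast
    then show "run W c' s' (\<lambda>t2 s'. t + t2 \<le> T + T' \<and> sim s' b')" by (rule run_mono) (use t in auto)
  qed
qed

lemma sim_reg: "sim (rr, m) a \<Longrightarrow> rr (x + 10) = fst a x"
  unfolding sim_def by (cases a) auto

lemma reach_If: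
  assumes "fst a x < fst a y \<Longrightarrow> reach c T a b" "\<not> fst a x < fst a y \<Longrightarrow> reach c' T a b"
  shows "reach (IfLess (x + 10) (y + 10) c c') (T + 1) a b"
  unfolding reach_def
proof (intro allI impI)
  fix s assume s: "sim s a"
  obtain rr m where rm: "s = (rr, m)" by (cases s)
  have e: "rr (x + 10) = fst a x" "rr (y + 10) = fst a y" using sim_reg s rm by blast+
  show "run W (IfLess (x + 10) (y + 10) c c') s (\<lambda>t s'. t \<le> T + 1 \<and> sim s' b)"
    unfolding rm
  proof (rule run_If)
    assume "rr (x + 10) < rr (y + 10)"
    then have "run W c s (\<lambda>t s'. t \<le> T \<and> sim s' b)" using assms(1) s unfolding e reach_def by blast
    then show "run W c (rr, m) (\<lambda>t s'. t + 1 \<le> T + 1 \<and> sim s' b)" unfolding rm by (rule run_mono) auto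
  next
    assume "\<not> rr (x + 10) < rr (y + 10)"
    then have "run W c' s (\<lambda>t s'. t \<le> T \<and> sim s' b)" using assms(2) s unfolding e reach_def by blast
    then show "run W c' (rr, m) (\<lambda>t s'. t + 1 \<le> T + 1 \<and> sim s' b)" unfolding rm by (rule run_mono) auto
  qed
qed

text \<open>The loop is followed along a sequence of abstract states with a separate bound for each
  round, so that costs depending on degrees can be summed.\<close>

lemma reach_While:
  assumes "\<And>i. i < N \<Longrightarrow> fst (\<sigma> i) x < fst (\<sigma> i) y" "\<And>i. i < N \<Longrightarrow> reach c (T i) (\<sigma> i) (\<sigma> (Suc i))"
    and "\<not> fst (\<sigma> N) x < fst (\<sigma> N) y"
  shows "reach (WhileLess (x + 10) (y + 10) c) ((\<Sum>i<N. T i + 1) + 1) (\<sigma> 0) (\<sigma> N)"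
  using assms
proof (induction N arbitrary: \<sigma> T)
  case 0
  show ?case unfolding reach_def
  proof (intro allI impI)
    fix s assume s: "sim s (\<sigma> 0)"
    obtain rr m where rm: "s = (rr, m)" by (cases s)
    have e: "rr (x + 10) = fst (\<sigma> 0) x" "rr (y + 10) = fst (\<sigma> 0) y" using sim_reg s rm by blast+
    then show "run W (WhileLess (x + 10) (y + 10) c) s (\<lambda>t s'. t \<le> (\<Sum>i<0. T i + 1) + 1 \<and> sim s' (\<sigma> 0))"
      unfolding rm using 0 s rm by (intro run_While_False) auto
  qed
next
  case (Suc N)
  have rest: "reach (WhileLess (x + 10) (y + 10) c) ((\<Sum>i<N. T (Suc i) + 1) + 1) (\<sigma> (Suc 0)) (\<sigma> (Suc N))"
    using Suc.IH[of "\<lambda>i. \<sigma> (Suc i)" "\<lambda>i. T (Suc i)"] Suc.prems by simp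
  show ?case unfolding reach_def
  proof (intro allI impI)
    fix s assume s: "sim s (\<sigma> 0)"
    obtain rr m where rm: "s = (rr, m)" by (cases s)
    have e: "rr (x + 10) = fst (\<sigma> 0) x" "rr (y + 10) = fst (\<sigma> 0) y" using sim_reg s rm by blast+
    show "run W (WhileLess (x + 10) (y + 10) c) s (\<lambda>t s'. t \<le> (\<Sum>i<Suc N. T i + 1) + 1 \<and> sim s' (\<sigma> (Suc N)))"
      unfolding rm
    proof (rule run_While_True)
      show "rr (x + 10) < rr (y + 10)" unfolding e by (rule Suc.prems(1)) simp
      show "run W c (rr, m) (\<lambda>t1 s'. run W (WhileLess (x + 10) (y + 10) c) s'
        (\<lambda>t2 s'. t1 + t2 + 1 \<le> (\<Sum>i<Suc N. T i + 1) + 1 \<and> sim s' (\<sigma> (Suc N))))"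
      proof (rule run_mono)
        show "run W c (rr, m) (\<lambda>t s'. t \<le> T 0 \<and> sim s' (\<sigma> (Suc 0)))"
          using Suc.prems(2)[of 0] s unfolding reach_def rm by simp
        fix t s' assume t: "t \<le> T 0 \<and> sim s' (\<sigma> (Suc 0))"
        then have "run W (WhileLess (x + 10) (y + 10) c) s' (\<lambda>t s'. t \<le> (\<Sum>i<N. T (Suc i) + 1) + 1 \<and> sim s' (\<sigma> (Suc N)))"
          using rest unfolding reach_def by blast
        then show "run W (WhileLess (x + 10) (y + 10) c) s'
          (\<lambda>t2 s'. t + t2 + 1 \<le> (\<Sum>i<Suc N. T i + 1) + 1 \<and> sim s' (\<sigma> (Suc N)))"
          unfolding sum.lessThan_Suc_shift by (rule run_mono) (use t in auto)
      qed
    qed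
  qed
qed

lemma reach_block: "defineds adj W is a \<Longrightarrow> reach (block is) (costs adj is a) a (sems adj is a)"
proof (induction "is" arbitrary: a)
  case Nil
  then show ?case using reach_Skip by simp
next
  case (Cons i "is")
  have "reach (code i) (cost adj i a) a (sem adj i a)"
    unfolding reach_def using code_sim Cons.prems by simp
  then show ?case using Cons reach_Seq by simp
qed

lemma reach_le: "reach c T a b \<Longrightarrow> T \<le> T' \<Longrightarrow> reach c T' a b"
  unfolding reach_def
proof (intro allI impI)
  fix s assume a: "\<forall>s. sim s a \<longrightarrow> run W c s (\<lambda>t s'. t \<le> T \<and> sim s' b)" "T \<le> T'" "sim s a"
  then have "run W c s (\<lambda>t s'. t \<le> T \<and> sim s' b)" by blast
  then show "run W c s (\<lambda>t s'. t \<le> T' \<and> sim s' b)" by (rule run_mono) (use a(2) in auto)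
qed

lemma reach_block_le:
  "defineds adj W is a \<Longrightarrow> costs adj is a \<le> T \<Longrightarrow> sems adj is a = b \<Longrightarrow> reach (block is) T a b"
  using reach_block reach_le by blast

end

section \<open>Rotation systems and the number of edges\<close>

lemma filter_upt_first:
  assumes "a \<le> k" "k < b" "P k" "\<And>j. a \<le> j \<Longrightarrow> j < k \<Longrightarrow> \<not> P j"
  shows "filter P [a..<b] = k # filter P [Suc k..<b]"
proof -
  have "[a..<b] = [a..<k] @ k # [Suc k..<b]"
    using assms(1,2) upt_add_eq_append[of a k "b - k"] upt_conv_Cons[of k b] by simp
  moreover have "filter P [a..<k] = []" using assms(4) by (auto simp: filter_empty_conv)
  ultimately show ?thesis using assms(3) by simp
qed

text \<open>Crossing-free arcs on a line: map an arc to its left end if it is the longest one starting there,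
  and to its right end otherwise.\<close>

lemma card_noncrossing:
  fixes A :: "nat \<Rightarrow> nat \<Rightarrow> bool"
  assumes "\<And>i k j l. i < k \<Longrightarrow> k < j \<Longrightarrow> j < l \<Longrightarrow> l < n \<Longrightarrow> A i j \<Longrightarrow> A k l \<Longrightarrow> False"
  shows "card {(i, j). i < j \<and> j < n \<and> A i j} \<le> 2 * n"
proof -
  let ?E = "{(i, j). i < j \<and> j < n \<and> A i j}"
  define top where "top i j \<longleftrightarrow> (\<forall>l. j < l \<longrightarrow> l < n \<longrightarrow> \<not> A i l)" for i j
  define f where "f = (\<lambda>(i, j). if top i j then (0, i) else (1, j) :: nat \<times> nat)"
  have "inj_on f ?E"
  proof (rule inj_onI)
    fix p q assume pq: "p \<in> ?E" "q \<in> ?E" "f p = f q"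
    obtain i j i' j' where p: "p = (i, j)" "i < j" "j < n" "A i j" and q: "q = (i', j')" "i' < j'" "j' < n" "A i' j'"
      using pq by auto
    \<comment> \<open>If the arc from \<open>x'\<close> to \<open>y\<close> is not the longest one
      at \<open>x'\<close>, a longer one crosses every arc ending in \<open>y\<close> that starts
      before \<open>x'\<close>.\<close>
    have no: False if "x < x'" "x' < y" "y < n" "A x y" "\<not> top x' y" for x x' y
      using that assms[of x x' y] unfolding top_def by blast
    show "p = q"
    proof (cases "top i j")
      case True
      then have "i' = i" "top i' j'" using pq(3) unfolding f_def p q by (auto split: if_splits)
      then show ?thesis using True p q unfolding top_def by (metis linorder_neqE_nat)
    next
      case False
      then have "j' = j" "\<not> top i' j'" using pq(3) unfolding f_def p q by (auto split: if_splits)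
      then show ?thesis using False p q no[of i i' j] no[of i' i j] by (metis linorder_neqE_nat)
    qed
  qed
  moreover have "f ` ?E \<subseteq> {0, 1} \<times> {..<n}" unfolding f_def by (auto split: if_splits)
  ultimately have "card ?E \<le> card ({0, 1 :: nat} \<times> {..<n})" by (intro card_inj_on_le) auto
  then show ?thesis by (simp add: card_cartesian_product)
qed

locale rotation = boundary_order "{..<m}" E xs "int m" for m :: nat and E :: "nat set set" and xs +
  fixes nbrs :: "nat list list"
  assumes nbrs: "length nbrs = m"
    "\<And>i. nbrs ! vert i = map (\<lambda>k. vert (i + int k)) (filter (\<lambda>k. adj i (i + int k)) [1..<m])"
begin

lemma m3: "3 \<le> m"
  using n(2) by simp

lemma vert_less: "vert i < m"
  using vert_V[of i] by simp

lemma mem_nbrs: "vert j \<in> set (nbrs ! vert i) \<longleftrightarrow> adj i j"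
proof
  assume "vert j \<in> set (nbrs ! vert i)"
  then obtain k where "vert j = vert (i + int k)" "adj i (i + int k)" unfolding nbrs(2) by auto
  then show "adj i j" unfolding adj_def by simp
next
  assume a: "adj i j"
  define k where "k = nat ((j - i) mod int m)"
  have k: "int k = (j - i) mod int m" "k < m" unfolding k_def using m3 by (simp_all add: nat_less_iff)
  have v: "vert (i + int k) = vert j" unfolding vert_eq k(1) by (simp add: mod_simps)
  then have "adj i (i + int k)" using a unfolding adj_def by simp
  moreover from this have "k \<noteq> 0" using irrefl[of i] by (intro notI) simp
  ultimately show "vert j \<in> set (nbrs ! vert i)"
    unfolding nbrs(2) v[symmetric] set_map using k(2) by (intro imageI) simp
qed

text \<open>The sides of the polygon are edges, so the first and last entries are the neighbours on
  the boundary. The program moves along the boundary by reading them.\<close>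

lemma nbrs_ends: "nbrs ! vert i ! 0 = vert (i + 1)" "last (nbrs ! vert i) = vert (i - 1)"
  "2 \<le> length (nbrs ! vert i)"
proof -
  have up: "[1..<m] = 1 # [2..<m - 1] @ [m - 1]"
    using m3 upt_conv_Cons[of 1 m] upt_Suc_append[of 2 "m - 1"] by (simp add: numeral_2_eq_2)
  have "vert (i - 1) = vert (i + int (m - 1))" unfolding vert_eq using m3 by (simp add: mod_eq_dvd_iff)
  moreover have "adj i (i + 1)" by (rule side)
  moreover have "adj i (i + int (m - 1))"
    using side[of "i - 1"] adj_sym[of i "i - 1"] calculation(1) unfolding adj_def by simp
  ultimately show "nbrs ! vert i ! 0 = vert (i + 1)" "last (nbrs ! vert i) = vert (i - 1)"
    "2 \<le> length (nbrs ! vert i)"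
    unfolding nbrs(2) up by simp_all
qed

text \<open>The second entry is the apex of the triangle on the side to the successor, which is how
  the program finds the apex in \<open>flag\<close>.\<close>

lemma nbrs_second:
  assumes "2 \<le> k" "k < int m" "adj i (i + k)" "\<And>j. 2 \<le> j \<Longrightarrow> j < k \<Longrightarrow> \<not> adj i (i + j)"
  shows "nbrs ! vert i ! 1 = vert (i + k)"
proof -
  have "filter (\<lambda>k. adj i (i + int k)) [1..<m] = 1 # filter (\<lambda>k. adj i (i + int k)) [2..<m]"
    using filter_upt_first[of 1 1 m "\<lambda>k. adj i (i + int k)"] side[of i] m3 by (simp add: numeral_2_eq_2)
  moreover have "filter (\<lambda>k. adj i (i + int k)) [2..<m] =
      nat k # filter (\<lambda>k. adj i (i + int k)) [Suc (nat k)..<m]"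
  proof (rule filter_upt_first)
    show "2 \<le> nat k" "nat k < m" "adj i (i + int (nat k))" using assms(1-3) by (auto simp: nat_less_iff)
    show "\<not> adj i (i + int j)" if "2 \<le> j" "j < nat k" for j using assms(4)[of "int j"] that by simp
  qed
  ultimately show ?thesis unfolding nbrs(2) using assms(1) by simp
qed

text \<open>This is the test by which the program recognises an ear.\<close>

lemma degree_two:
  "length (nbrs ! vert i) \<le> 2 \<longleftrightarrow> (\<forall>y. adj i y \<longrightarrow> y mod int m = (i - 1) mod int m \<or> y mod int m = (i + 1) mod int m)"
proof
  assume "length (nbrs ! vert i) \<le> 2"
  then have l: "length (nbrs ! vert i) = 2" using nbrs_ends(3)[of i] by simp
  have "vert y = vert (i - 1) \<or> vert y = vert (i + 1)" if "adj i y" for y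
  proof -
    obtain a b where "nbrs ! vert i = [a, b]" using l by (auto simp: numeral_2_eq_2 length_Suc_conv)
    then show ?thesis using mem_nbrs[of y i] that nbrs_ends(1,2)[of i] by auto
  qed
  then show "\<forall>y. adj i y \<longrightarrow> y mod int m = (i - 1) mod int m \<or> y mod int m = (i + 1) mod int m"
    unfolding vert_eq by blast
next
  assume r: "\<forall>y. adj i y \<longrightarrow> y mod int m = (i - 1) mod int m \<or> y mod int m = (i + 1) mod int m"
  have "set (filter (\<lambda>k. adj i (i + int k)) [1..<m]) \<subseteq> {1, m - 1}"
  proof
    fix k assume "k \<in> set (filter (\<lambda>k. adj i (i + int k)) [1..<m])"
    then have k: "1 \<le> k" "k < m" "adj i (i + int k)" by auto
    then have "(i + int k) mod int m = (i - 1) mod int m \<or> (i + int k) mod int m = (i + 1) mod int m"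
      using r by blast
    then have "int m dvd int k + 1 \<or> int m dvd int k - 1" by (simp add: mod_eq_dvd_iff)
    then have "int m dvd int (k + 1) \<or> int m dvd int (k - 1)" using k(1) by (simp add: of_nat_diff add.commute)
    then have "m dvd k + 1 \<or> m dvd k - 1" unfolding int_dvd_int_iff .
    then show "k \<in> {1, m - 1}"
    proof
      assume "m dvd k + 1"
      then have "m \<le> k + 1" using dvd_imp_le[of m "k + 1"] by simp
      then show ?thesis using k by auto
    next
      assume "m dvd k - 1"
      then have "k - 1 = 0" using k dvd_imp_le[of m "k - 1"] by linarith
      then show ?thesis using k by auto
    qed
  qed
  then have "card (set (filter (\<lambda>k. adj i (i + int k)) [1..<m])) \<le> card {1, m - 1}" by (intro card_mono) auto
  moreover have "card {1, m - 1} \<le> 2" using card_insert_le_m1[of 2 "{m - 1}" 1] by simp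
  moreover have "card (set (filter (\<lambda>k. adj i (i + int k)) [1..<m])) = length (filter (\<lambda>k. adj i (i + int k)) [1..<m])"
    by (intro distinct_card distinct_filter) simp
  ultimately show "length (nbrs ! vert i) \<le> 2" unfolding nbrs(2) by simp
qed

lemma nbrs_less: "v < m \<Longrightarrow> set (nbrs ! v) \<subseteq> {..<m}" "v < m \<Longrightarrow> 2 \<le> length (nbrs ! v)"
proof -
  assume "v < m"
  then obtain i where "v = vert i" using vert_surj[of v 0] by auto
  then show "set (nbrs ! v) \<subseteq> {..<m}" "2 \<le> length (nbrs ! v)"
    using nbrs_ends(3)[of i] vert_less by (auto simp: nbrs(2)) 
qed

lemma bij_vert: "bij_betw (\<lambda>i. vert (int i + c)) {..<m} {..<m}"
proof -
  have inj: "inj_on (\<lambda>i. vert (int i + c)) {..<m}"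
  proof (rule inj_onI)
    fix i j assume ij: "i \<in> {..<m}" "j \<in> {..<m}" "vert (int i + c) = vert (int j + c)"
    then have "int m dvd int i - int j" unfolding vert_eq by (simp add: mod_eq_dvd_iff)
    then have "int i mod int m = int j mod int m" by (simp add: mod_eq_dvd_iff)
    then show "i = j" using ij by simp
  qed
  moreover have "(\<lambda>i. vert (int i + c)) ` {..<m} \<subseteq> {..<m}" using vert_less by auto
  ultimately show ?thesis using endo_inj_surj[of "{..<m}"] unfolding bij_betw_def by blast
qed

lemma length_concat_nbrs: "length (concat nbrs) = (\<Sum>i<m. length (nbrs ! vert (int i + c)))"
proof -
  have "length (concat nbrs) = (\<Sum>v<m. length (nbrs ! v))"
    unfolding length_concat sum_list_sum_nth using nbrs(1) by (simp add: atLeast0LessThan)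
  also have "\<dots> = (\<Sum>i<m. length (nbrs ! vert (int i + c)))"
    using sum.reindex_bij_betw[OF bij_vert, of "\<lambda>v. length (nbrs ! v)" c] by simp
  finally show ?thesis .
qed

text \<open>Each edge is counted in both directions, and \<open>card_noncrossing\<close> bounds the
  edges by \<open>2 * m\<close>.\<close>

lemma total_degree: "length (concat nbrs) \<le> 4 * m"
proof -
  let ?A = "\<lambda>i j. adj (int i) (int j)"
  let ?E = "{(i, j). i < j \<and> j < m \<and> ?A i j}" and ?F = "{(i, j). j < i \<and> i < m \<and> ?A i j}"
  have fin: "finite ?E" "finite ?F" by (rule finite_subset[of _ "{..<m} \<times> {..<m}"]; auto)+
  have E: "card ?E \<le> 2 * m"
  proof (rule card_noncrossing)
    show False if "i < k" "k < j" "j < l" "l < m" "?A i j" "?A k l" for i k j l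
      using no_cross_mod[of "int i" "int k" "int j" "int l"] that by simp
  qed
  have "?F = prod.swap ` ?E" using adj_sym by (auto simp: image_iff)
  then have F: "card ?F = card ?E" by (simp add: card_image)
  have le: "length (nbrs ! vert (int i)) \<le> card {j. j < m \<and> ?A i j}" if "i < m" for i
  proof -
    let ?K = "{k \<in> {1..<m}. adj (int i) (int i + int k)}"
    have "length (nbrs ! vert (int i)) = card (set (filter (\<lambda>k. adj (int i) (int i + int k)) [1..<m]))"
      unfolding nbrs(2) length_map by (intro distinct_card[symmetric] distinct_filter) simp
    also have "set (filter (\<lambda>k. adj (int i) (int i + int k)) [1..<m]) = ?K" by auto
    also have "card ?K \<le> card {j. j < m \<and> ?A i j}"
    proof (rule card_inj_on_le)
      show "inj_on (\<lambda>k. (i + k) mod m) ?K"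
      proof (rule inj_onI)
        fix k l assume kl: "k \<in> ?K" "l \<in> ?K" "(i + k) mod m = (i + l) mod m"
        then have "int m dvd int k - int l" using arg_cong[OF kl(3), of int] by (simp add: zmod_int mod_eq_dvd_iff)
        then have "int k mod int m = int l mod int m" by (simp add: mod_eq_dvd_iff)
        then show "k = l" using kl by simp
      qed
      show "(\<lambda>k. (i + k) mod m) ` ?K \<subseteq> {j. j < m \<and> ?A i j}"
        using m3 adj_mod[of "int i"] by (auto simp: zmod_int adj_def vert_def)
    qed simp
    finally show ?thesis .
  qed
  have "length (concat nbrs) \<le> (\<Sum>i<m. card {j. j < m \<and> ?A i j})"
    unfolding length_concat_nbrs[of 0] using le by (intro sum_mono) simp
  also have "\<dots> = card (SIGMA i:{..<m}. {j. j < m \<and> ?A i j})" by simp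
  also have "(SIGMA i:{..<m}. {j. j < m \<and> ?A i j}) = ?E \<union> ?F"
    using irrefl by (auto; metis linorder_neqE_nat)
  also have "card (?E \<union> ?F) \<le> card ?E + card ?F" by (rule card_Un_le)
  finally show ?thesis using E F by simp
qed

end

section \<open>The program\<close>

definition mark_block :: "instr list" where
  "mark_block = [First 40 40, First 40 40, First 40 40, First 40 40, First 40 40, Mark 40 1, Dec 0 5]"

text \<open>By now register 0 holds the remainder modulo 5 and register 40 the vertex behind the
  last full segment.\<close>

definition tail_prog :: cmd where
  "tail_prog = Seq (Seq (block [Const 28 0]) (IfLess (28 + 10) (0 + 10) (block [Out 40]) Skip))
     (Seq (block [Const 28 2]) (IfLess (28 + 10) (0 + 10) (block [First 40 40, First 40 40, Out 40]) Skip))"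

text \<open>Registers: 0 number of remaining vertices, 40 current anchor, 2 to 5 the four vertices after it,
  6 to 9 the vertices tested by \<open>flag\<close>, 10 the previous flag, 11 the vertex three before the
  anchor, 12 whether this is the first segment, 13 to 21 test results, 23 the flag, 24 the shift.\<close>

definition walk_block :: "instr list" where
  "walk_block = [First 2 40, First 3 2, First 4 3, First 5 4, Second 6 2, Last 7 6, Last 8 7, Last 8 8, Last 9 40]"

text \<open>Each edge test scans the list of \<open>5 * i\<close> or of \<open>5 * i + 3\<close>,
  never that of the apex: one vertex of high degree may be the apex for many segments, whereas every
  scanned list belongs to one segment only.\<close>

definition test_block :: "instr list" where
  "test_block = [Edge 13 40 6, Edge 14 4 7, Edge 15 4 8, Edge 16 4 6, Edge 17 40 11, Edge 18 40 3, Edge 19 40 4,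
     Edge 20 4 9, Get 21 6]"

text \<open>Register 12 switches between the general test and the single edge test of the first
  segment.\<close>

definition flag_block :: "instr list" where
  "flag_block = [And 22 13 14, And 22 22 15, Or 22 22 16, And 22 22 21, AndNot 22 22 12, And 23 12 20, Or 23 22 23]"

definition shift_block :: "instr list" where
  "shift_block = [And 24 17 18, And 24 24 19, And 24 24 10, AndNot 24 24 23]"

text \<open>\<open>Sel\<close> with equal branches copies a register. Marking both candidates and
  unmarking the next anchor turns the marks for \<open>good i\<close> into those for
  \<open>good (i + 1)\<close>.\<close>

definition emit_block :: "instr list" where
  "emit_block = [Sel 25 24 9 40, Out 25, Sel 26 23 3 4, Out 26,
     Mark 3 1, Mark 4 1, Sel 10 23 23 23, Sel 11 3 3 3, First 40 5, Mark 40 0, Const 12 0, Dec 0 5]"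

definition segment_block :: "instr list" where
  "segment_block = walk_block @ test_block @ flag_block @ shift_block @ emit_block"

text \<open>Marking the anchors is a walk of its own that uses up the count and the position;
  registers 33 and 27 keep them for the second walk.\<close>

definition large_prog :: cmd where
  "large_prog = Seq (block [Sel 33 0 0 0, Sel 27 40 40 40, Const 29 4])
     (Seq (WhileLess (29 + 10) (0 + 10) (block mark_block))
     (Seq (block [Sel 0 33 33 33, Sel 40 27 27 27, Const 10 0, Last 11 40, Last 11 11, Last 11 11, Const 12 1])
     (Seq (WhileLess (29 + 10) (0 + 10) (block segment_block)) tail_prog)))"

text \<open>Cell \<open>n + 1\<close> holds the end of the adjacency lists, which is the address of
  the labels.\<close>

definition setup_prog :: cmd where
  "setup_prog = Seq (Put 2 0) (Seq (Load 10 2) (Seq (Put 2 1) (Seq (Add 3 10 2) (Seq (Load 8 3) (Seq (Add 0 8 10) (Put 1 0))))))"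

text \<open>After a vertex of degree two is found, two steps backwards lead to index 0, because the
  landmarks assume an ear at index 2.\<close>

definition solver_prog :: cmd where
  "solver_prog = Seq setup_prog (Seq (block [Const 32 2, Const 30 0, Degree 31 30])
     (Seq (WhileLess (32 + 10) (31 + 10) (block [Inc 30, Degree 31 30]))
     (Seq (block [Last 40 30, Last 40 40, Const 28 5])
       (IfLess (28 + 10) (0 + 10) large_prog (block [Out 40, Last 40 40, Out 40])))))"

context ram_input begin

lemma setup_sim: "run W setup_prog (initial_state (encode_adj adj)) (\<lambda>t s. t \<le> 7 \<and> sim s ((\<lambda>_. 0)(0 := n), (\<lambda>_. 0), []))"
proof -
  define m where "m = snd (initial_state (encode_adj adj))"
  have i: "initial_state (encode_adj adj) = (\<lambda>_. 0, m)" unfolding m_def initial_state_def by simp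
  have input: "input m" unfolding m_def by (rule input_encode)
  have "start n = labels" unfolding start_def labels_def using n(1) by simp
  then have mem: "m 0 = n" "m (Suc n) = labels" using input unfolding input_def by auto
  have "length (encode_adj adj) = labels" unfolding encode_adj_def labels_def using n(1) by simp
  then have zero: "m (labels + v) = 0" for v unfolding m_def initial_state_def by simp
  show ?thesis unfolding setup_prog_def i
    by (intro run_straight; insert labels_le(2) n(2) W mem zero input; simp add: sim_def)
qed

lemma sim_output: "sim s (r, l, out) \<Longrightarrow> output_set s = set out"
proof -
  assume s: "sim s (r, l, out)"
  obtain rr m where rm: "s = (rr, m)" by (cases s)
  have "rr 0 = labels + n" "rr 1 = length out" "\<And>j. j < length out \<Longrightarrow> m (labels + n + j) = out ! j"
    using s unfolding sim_def rm by auto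
  then show "output_set s = set out" unfolding output_set_def rm set_conv_nth by (auto simp: image_iff)
qed

end

text \<open>The \<open>+ 1\<close> is the closing \<open>Skip\<close>, which both blocks have but
  their concatenation contains only once.\<close>

lemma block_append:
  "sems ls (xs @ ys) a = sems ls ys (sems ls xs a)"
  "defineds ls W (xs @ ys) a \<longleftrightarrow> defineds ls W xs a \<and> defineds ls W ys (sems ls xs a)"
  "costs ls (xs @ ys) a + 1 = costs ls xs a + costs ls ys (sems ls xs a)"
  by (induction xs arbitrary: a) auto

fun logical :: "instr \<Rightarrow> bool" where
  "logical (And x y z) = True"
| "logical (Or x y z) = True"
| "logical (AndNot x y z) = True"
| "logical i = False"

lemma logical_block: "list_all logical xs \<Longrightarrow> defineds ls W xs a \<and> costs ls xs a = 10 * length xs + 1"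
proof (induction xs arbitrary: a)
  case (Cons i xs)
  obtain r l out where a: "a = (r, l, out)" by (metis prod.collapse)
  have "defined ls W i a \<and> cost ls i a = 10" using Cons.prems unfolding a by (cases i) simp_all
  then show ?case using Cons by simp
qed simp

text \<open>The passage from \<open>good i\<close> to \<open>good (i + 1)\<close>: two candidates
  become good and one anchor ceases to be. The parameter \<open>b\<close> stands for the absence of
  a remainder.\<close>

lemma good_arith:
  fixes w i k :: int
  assumes "0 \<le> w" "0 \<le> i"
  shows "w \<noteq> 5 * i + 5 \<and> (w = 5 * i + 3 \<or> w = 5 * i + 2 \<or>
      (w mod 5 = 0 \<and> 5 * i < w \<and> w \<le> 5 * k \<or> w = 0 \<and> b \<or> w < 5 * i \<and> (w mod 5 = 2 \<or> w mod 5 = 3))) \<longleftrightarrow>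
    (w mod 5 = 0 \<and> 5 * (i + 1) < w \<and> w \<le> 5 * k \<or> w = 0 \<and> b \<or> w < 5 * (i + 1) \<and> (w mod 5 = 2 \<or> w mod 5 = 3))"
proof -
  consider "w < 5 * i" | "5 * i + 5 < w" | "w = 5 * i + 0" | "w = 5 * i + 1" | "w = 5 * i + 2" | "w = 5 * i + 3" |
    "w = 5 * i + 4" | "w = 5 * i + 5" by linarith
  then show ?thesis using assms by cases auto
qed


section \<open>Correctness and running time of the program\<close>

locale solver = rotation m E xs nbrs + R: ram_input nbrs m W for m E xs nbrs W +
  fixes c0 :: int
  assumes ear: "\<And>y. adj (c0 + 2) y \<Longrightarrow> y mod int m = (c0 + 1) mod int m \<or> y mod int m = (c0 + 3) mod int m"
begin

definition V :: "int \<Rightarrow> nat" where "V i = vert (i + c0)"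

definition e :: "int \<Rightarrow> int \<Rightarrow> bool" where "e i j \<longleftrightarrow> adj (i + c0) (j + c0)"

definition D :: "nat \<Rightarrow> nat" where "D i = length (nbrs ! V (int i))"

lemma e_def': "e = (\<lambda>i j. adj (i + (c0 + 2 - 2)) (j + (c0 + 2 - 2)))"
  unfolding e_def by simp

lemma ear': "adj (c0 + 2) y \<Longrightarrow> y mod int m = (c0 + 2 - 1) mod int m \<or> y mod int m = (c0 + 2 + 1) mod int m"
  using ear[of y] by (simp add: algebra_simps)

lemmas solution = solution_resolving[OF ear', folded e_def']

lemma V_nbrs [simp]: "nbrs ! V i ! 0 = V (i + 1)" "last (nbrs ! V i) = V (i - 1)" "V i < m"
  "V j \<in> set (nbrs ! V i) \<longleftrightarrow> e i j" "length nbrs = m"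
  using nbrs_ends[of "i + c0"] vert_less mem_nbrs nbrs(1) unfolding V_def e_def by (simp_all add: algebra_simps)

lemma V_eq: "V i = V j \<longleftrightarrow> i mod int m = j mod int m"
  unfolding V_def vert_eq by (simp add: mod_eq_dvd_iff)

lemma W_le: "k \<le> 20 \<Longrightarrow> k \<le> W" "m \<le> W" "V i \<le> W"
proof -
  have "20 * m \<le> W" "V i < m" by (rule R.W, rule V_nbrs(3))
  then show "k \<le> 20 \<Longrightarrow> k \<le> W" "m \<le> W" "V i \<le> W" using m3 by linarith+
qed

lemma sum_D: "(\<Sum>i<m. D i) \<le> 4 * m"
  using total_degree length_concat_nbrs[of c0] unfolding D_def V_def by simp

text \<open>The lists scanned in different segments belong to different vertices, so no degree is
  charged to two segments.\<close>

lemma sum_D_segments: "(\<Sum>i<k. D (5 * i) + D (5 * i + 3)) \<le> (\<Sum>i<5 * k. D i)"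
proof (induction k)
  case (Suc k)
  have "5 * Suc k = Suc (Suc (Suc (Suc (Suc (5 * k)))))" by simp
  then have "(\<Sum>i<5 * Suc k. D i) = (\<Sum>i<5 * k. D i) + D (5 * k) + D (5 * k + 1) + D (5 * k + 2) + D (5 * k + 3) + D (5 * k + 4)"
    by (simp only: sum.lessThan_Suc) (simp add: numeral_eq_Suc)
  then show ?case using Suc by simp
qed simp

lemma small_solution: "m \<le> 5 \<Longrightarrow> V ` solution (int m) e = {V 0, V (- 1)}"
proof -
  have "V (int m - 1) = V (- 1)" unfolding V_eq by (simp add: mod_eq_dvd_iff)
  then show "m \<le> 5 \<Longrightarrow> V ` solution (int m) e = {V 0, V (- 1)}" unfolding solution_def by simp
qed

end

locale large_solver = solver +
  assumes m6: "6 \<le> m"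
begin

sublocale P: eared_polygon "int m" e
proof -
  interpret A: ear_at_two "int m" e by (rule solution(1))
  show "eared_polygon (int m) e" using A.eared m6 by simp
qed

definition K :: nat where "K = m div 5"

lemma K: "P.k = int K" "P.r = int (m mod 5)" "m = 5 * K + m mod 5"
  unfolding P.k_def P.r_def K_def by (simp_all add: zdiv_int zmod_int)

definition anchor :: "int \<Rightarrow> nat" where "anchor i = V (if P.shifted i then 5 * i - 1 else 5 * i)"

definition chosen :: "int \<Rightarrow> nat" where "chosen i = V (if P.flag i then 5 * i + 2 else 5 * i + 3)"

definition outputs :: "nat \<Rightarrow> nat list" where
  "outputs i = concat (map (\<lambda>j. [anchor (int j), chosen (int j)]) [0..<i])"

lemma length_outputs: "length (outputs i) = 2 * i"
  unfolding outputs_def by (induction i) auto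

lemma outputs_Suc: "outputs (Suc i) = outputs i @ [anchor (int i), chosen (int i)]"
  unfolding outputs_def by simp

lemma set_outputs: "set (outputs K) \<union> (if 0 < m mod 5 then {V (5 * int K)} else {}) \<union>
    (if 2 < m mod 5 then {V (5 * int K + 2)} else {}) = V ` P.landmarks"
proof -
  have "{0..<int K} = int ` {0..<K}" using image_int_atLeastLessThan[of 0 K] by simp
  then have I: "f ` {0..<P.k} = (\<lambda>j. f (int j)) ` {0..<K}" for f :: "int \<Rightarrow> 'z" unfolding K(1) by (simp add: image_image)
  have "set (outputs K) = (\<lambda>j. anchor (int j)) ` {0..<K} \<union> (\<lambda>j. chosen (int j)) ` {0..<K}"
    unfolding outputs_def by auto
  also have "\<dots> = V ` ((\<lambda>i. if P.shifted i then 5 * i - 1 else 5 * i) ` {0..<P.k}) \<union>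
      V ` ((\<lambda>i. if P.flag i then 5 * i + 2 else 5 * i + 3) ` {0..<P.k})"
    unfolding anchor_def chosen_def image_image I ..
  finally show ?thesis unfolding P.landmarks_def image_Un using K by auto
qed

text \<open>A neighbour beyond the successor exists because the predecessor \<open>5 * i\<close> is
  one, at offset \<open>m - 1\<close>; the least offset is taken.\<close>

lemma second_neighbour:
  obtains h where "5 * i + 2 < h" "h < 5 * i + 1 + int m" "e (5 * i + 1) h"
    "\<And>y. 5 * i + 2 < y \<Longrightarrow> y < h \<Longrightarrow> \<not> e (5 * i + 1) y" "nbrs ! V (5 * i + 1) ! Suc 0 = V h"
proof -
  let ?P = "\<lambda>k. 2 \<le> k \<and> k < m \<and> e (5 * i + 1) (5 * i + 1 + int k)"
  have "?P (m - 1)"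
    using m6 P.side[of "5 * i"] P.commute[of "5 * i"] P.periodic2[of "5 * i + 1" "5 * i"]
    by (simp add: of_nat_diff add.commute)
  then have L: "?P (LEAST k. ?P k)" by (rule LeastI)
  define k where "k = (LEAST k. ?P k)"
  have k: "2 \<le> k" "k < m" "e (5 * i + 1) (5 * i + 1 + int k)" using L unfolding k_def by blast+
  have min: "\<not> ?P j" if "j < k" for j using that not_less_Least unfolding k_def by blast
  have no: "\<not> e (5 * i + 1) (5 * i + 1 + j)" if "2 \<le> j" "j < int k" for j
    using min[of "nat j"] that k(2) by (simp add: nat_less_iff)
  show thesis
  proof (rule that[of "5 * i + 1 + int k"])
    show "5 * i + 2 < 5 * i + 1 + int k" "5 * i + 1 + int k < 5 * i + 1 + int m" using k by simp_all
    show "e (5 * i + 1) (5 * i + 1 + int k)" by (rule k(3))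
    show "\<not> e (5 * i + 1) y" if "5 * i + 2 < y" "y < 5 * i + 1 + int k" for y
      using no[of "y - (5 * i + 1)"] that by simp
    have "nbrs ! vert (5 * i + 1 + c0) ! 1 = vert (5 * i + 1 + c0 + int k)"
      using k no by (intro nbrs_second) (auto simp: e_def algebra_simps)
    then show "nbrs ! V (5 * i + 1) ! Suc 0 = V (5 * i + 1 + int k)" unfolding V_def by (simp add: algebra_simps)
  qed
qed

text \<open>The five blocks are evaluated one at a time, keeping only the registers needed later.
  Four of the eight edge tests scan each list, hence the factor 24; the block costs 91, 91, 71, 41
  and 121 add up to 415 before the joints between blocks are deducted.\<close>

lemma segment:
  fixes i :: int
  assumes i: "0 \<le> i" "i < P.k"
    and r: "r 0 \<le> m" "r 40 = V (5 * i)" "r 10 = of_bool (0 < i \<and> P.flag (i - 1))" "r 11 = V (5 * i - 3)" "r 12 = of_bool (i = 0)"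
    and l: "\<And>z. 0 < l (V z) \<longleftrightarrow> P.good i z" and out: "length out + 1 < m"
  obtains r' where "sems nbrs segment_block (r, l, out) =
      (r', l(V (5 * i + 2) := 1, V (5 * i + 3) := 1, V (5 * i + 5) := 0), out @ [anchor i, chosen i])"
    "r' 0 = r 0 - 5" "r' 40 = V (5 * i + 5)" "r' 10 = of_bool (P.flag i)" "r' 11 = V (5 * i + 2)" "r' 12 = 0" "r' 29 = r 29"
    "defineds nbrs W segment_block (r, l, out)"
    "costs nbrs segment_block (r, l, out) \<le> 420 + 24 * (length (nbrs ! V (5 * i)) + length (nbrs ! V (5 * i + 3)))"
proof -
  obtain h where h: "5 * i + 2 < h" "h < 5 * i + 1 + int m" "e (5 * i + 1) h"
    "\<And>y. 5 * i + 2 < y \<Longrightarrow> y < h \<Longrightarrow> \<not> e (5 * i + 1) y" and second: "nbrs ! V (5 * i + 1) ! Suc 0 = V h"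
    using second_neighbour[of i] by blast
  define A where "A \<longleftrightarrow> e (5 * i + 3) h \<or> e (5 * i) h \<and> e (5 * i + 3) (h - 1) \<and> e (5 * i + 3) (h - 3)"
  have flag0: "P.flag i \<longleftrightarrow> e (5 * i + 3) (5 * i - 1)" if "i = 0" using that unfolding P.flag_def by simp
  have flag1: "P.flag i \<longleftrightarrow> P.good i h \<and> A" if i0: "i \<noteq> 0"
  proof
    assume "P.flag i"
    then obtain h' where h': "5 * i + 2 < h'" "h' < 5 * i + 1 + int m" "e (5 * i + 1) h'"
      "\<forall>y. 5 * i + 2 < y \<and> y < h' \<longrightarrow> \<not> e (5 * i + 1) y" "P.good i h'"
      "e (5 * i + 3) h' \<or> e (5 * i) h' \<and> e (5 * i + 3) (h' - 1) \<and> e (5 * i + 3) (h' - 3)"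
      unfolding P.flag_def if_not_P[OF i0] by blast
    have "\<not> h' < h" using h(4)[of h'] h'(1,3) by blast
    moreover have "\<not> h < h'" using h(1,3) h'(4) by blast
    ultimately have "h' = h" by linarith
    then show "P.good i h \<and> A" using h'(5,6) unfolding A_def by blast
  next
    assume "P.good i h \<and> A"
    then show "P.flag i" unfolding P.flag_def if_not_P[OF i0] A_def using h by (intro exI[of _ h]) blast
  qed
  have flag: "P.flag i \<longleftrightarrow> (A \<and> P.good i h) \<and> i \<noteq> 0 \<or> i = 0 \<and> e (5 * i + 3) (5 * i - 1)"
    using flag0 flag1 by blast
  have shifted: "P.shifted i \<longleftrightarrow>
      ((e (5 * i) (5 * i - 3) \<and> e (5 * i) (5 * i + 2)) \<and> e (5 * i) (5 * i + 3)) \<and> (0 < i \<and> P.flag (i - 1)) \<and> \<not> P.flag i"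
    unfolding P.shifted_def using i by auto
  have W: "V x \<le> W" "Suc 0 \<le> W" "5 \<le> W" for x
    using W_le(1)[of 1] W_le(1)[of 5] by (simp_all add: W_le(3))
  have W': "of_bool b \<le> W" for b using W(2) by (cases b) simp_all
  let ?l = "l(V (5 * i + 2) := 1, V (5 * i + 3) := 1, V (5 * i + 5) := 0)"
  obtain r1 where s1: "sems nbrs walk_block (r, l, out) = (r1, l, out)"
    and r1: "r1 40 = V (5 * i)" "r1 3 = V (5 * i + 2)" "r1 4 = V (5 * i + 3)" "r1 5 = V (5 * i + 4)"
      "r1 6 = V h" "r1 7 = V (h - 1)" "r1 8 = V (h - 3)" "r1 9 = V (5 * i - 1)"
      "r1 0 = r 0" "r1 10 = r 10" "r1 11 = r 11" "r1 12 = r 12" "r1 29 = r 29"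
    unfolding walk_block_def by (simp add: second r add.commute[of _ "5 * i"])
  have d1: "defineds nbrs W walk_block (r, l, out)" "costs nbrs walk_block (r, l, out) = 91"
    unfolding walk_block_def by (simp_all add: second r add.commute[of _ "5 * i"])
  obtain r2 where s2: "sems nbrs test_block (r1, l, out) = (r2, l, out)"
    and r2: "r2 13 = of_bool (e (5 * i) h)" "r2 14 = of_bool (e (5 * i + 3) (h - 1))"
      "r2 15 = of_bool (e (5 * i + 3) (h - 3))" "r2 16 = of_bool (e (5 * i + 3) h)"
      "r2 17 = of_bool (e (5 * i) (5 * i - 3))" "r2 18 = of_bool (e (5 * i) (5 * i + 2))"
      "r2 19 = of_bool (e (5 * i) (5 * i + 3))" "r2 20 = of_bool (e (5 * i + 3) (5 * i - 1))" "r2 21 = l (V h)"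
      "r2 0 = r 0" "r2 3 = V (5 * i + 2)" "r2 4 = V (5 * i + 3)" "r2 5 = V (5 * i + 4)" "r2 9 = V (5 * i - 1)"
      "r2 10 = r 10" "r2 12 = r 12" "r2 29 = r 29" "r2 40 = V (5 * i)"
    unfolding test_block_def by (simp add: r1 r)
  have d2: "defineds nbrs W test_block (r1, l, out)" "costs nbrs test_block (r1, l, out) =
      91 + 24 * (length (nbrs ! V (5 * i)) + length (nbrs ! V (5 * i + 3)))"
    unfolding test_block_def by (simp_all add: r1)
  obtain r3 where s3: "sems nbrs flag_block (r2, l, out) = (r3, l, out)"
    and r3: "r3 23 = of_bool (P.flag i)"
      "r3 0 = r 0" "r3 3 = V (5 * i + 2)" "r3 4 = V (5 * i + 3)" "r3 5 = V (5 * i + 4)" "r3 9 = V (5 * i - 1)"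
      "r3 29 = r 29" "r3 40 = V (5 * i)" "r3 10 = r 10" "r3 17 = r2 17" "r3 18 = r2 18" "r3 19 = r2 19"
  proof -
    let ?f = "(0 < r2 13 \<and> 0 < r2 14 \<and> 0 < r2 15 \<or> 0 < r2 16) \<and> 0 < r2 21 \<and> \<not> 0 < r2 12 \<or> 0 < r2 12 \<and> 0 < r2 20"
    have ex: "\<exists>r3. sems nbrs flag_block (r2, l, out) = (r3, l, out) \<and> r3 23 = of_bool ?f \<and>
      r3 0 = r2 0 \<and> r3 3 = r2 3 \<and> r3 4 = r2 4 \<and> r3 5 = r2 5 \<and> r3 9 = r2 9 \<and> r3 29 = r2 29 \<and> r3 40 = r2 40 \<and>
      r3 10 = r2 10 \<and> r3 17 = r2 17 \<and> r3 18 = r2 18 \<and> r3 19 = r2 19"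
      unfolding flag_block_def by (simp add: conj_assoc) blast
    have f: "?f \<longleftrightarrow> P.flag i" unfolding r2 r(5) l zero_less_of_bool_iff flag A_def by blast
    show thesis using that ex[unfolded f, unfolded r2(10-18)] by blast
  qed
  have d3: "defineds nbrs W flag_block (r2, l, out)" "costs nbrs flag_block (r2, l, out) = 71"
    using logical_block[of flag_block nbrs W] by (simp_all add: flag_block_def del: defineds.simps costs.simps)
  obtain r5 where s5: "sems nbrs shift_block (r3, l, out) = (r5, l, out)"
    and r5: "r5 23 = of_bool (P.flag i)" "r5 24 = of_bool (P.shifted i)"
      "r5 0 = r 0" "r5 3 = V (5 * i + 2)" "r5 4 = V (5 * i + 3)" "r5 5 = V (5 * i + 4)" "r5 9 = V (5 * i - 1)"
      "r5 29 = r 29" "r5 40 = V (5 * i)"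
    unfolding shift_block_def by (simp add: r3 r2 r shifted conj_assoc)
  have d5: "defineds nbrs W shift_block (r3, l, out)" "costs nbrs shift_block (r3, l, out) = 41"
    using logical_block[of shift_block nbrs W] by (simp_all add: shift_block_def del: defineds.simps costs.simps)
  have o: "V (if P.shifted i then 5 * i - 1 else 5 * i) = (if P.shifted i then V (5 * i - 1) else V (5 * i))"
    "V (if P.flag i then 5 * i + 2 else 5 * i + 3) = (if P.flag i then V (5 * i + 2) else V (5 * i + 3))" by simp_all
  obtain r4 where s4: "sems nbrs emit_block (r5, l, out) = (r4, ?l, out @ [anchor i, chosen i])"
    and r4: "r4 0 = r 0 - 5" "r4 40 = V (5 * i + 5)" "r4 10 = of_bool (P.flag i)" "r4 11 = V (5 * i + 2)"
      "r4 12 = 0" "r4 29 = r 29"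
    unfolding emit_block_def anchor_def chosen_def o by (simp add: r5 add.commute[of _ "5 * i"] cong: if_cong)
  have d4: "defineds nbrs W emit_block (r5, l, out)" "costs nbrs emit_block (r5, l, out) = 121"
    unfolding emit_block_def using out by (simp_all add: r5 W W')
  have "costs nbrs segment_block (r, l, out) + 4 =
      415 + 24 * (length (nbrs ! V (5 * i)) + length (nbrs ! V (5 * i + 3)))"
    using block_append(3)[of nbrs walk_block "test_block @ flag_block @ shift_block @ emit_block" "(r, l, out)"]
      block_append(3)[of nbrs test_block "flag_block @ shift_block @ emit_block" "(r1, l, out)"]
      block_append(3)[of nbrs flag_block "shift_block @ emit_block" "(r2, l, out)"]
      block_append(3)[of nbrs shift_block emit_block "(r3, l, out)"]
      d1(2) d2(2) d3(2) d5(2) d4(2)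
    unfolding segment_block_def s1 s2 s3 s5 by linarith
  then have "costs nbrs segment_block (r, l, out) \<le> 420 + 24 * (length (nbrs ! V (5 * i)) + length (nbrs ! V (5 * i + 3)))"
    by linarith
  moreover have "sems nbrs segment_block (r, l, out) = (r4, ?l, out @ [anchor i, chosen i])"
    "defineds nbrs W segment_block (r, l, out)"
    unfolding segment_block_def block_append(1,2) s1 s2 s3 s5 s4 using d1(1) d2(1) d3(1) d5(1) d4(1) by blast+
  ultimately show thesis using r4 by (intro that[of r4])
qed

lemma good_step:
  fixes l :: "nat \<Rightarrow> nat"
  assumes "0 \<le> i" "i + 1 < P.k" "\<And>z. 0 < l (V z) \<longleftrightarrow> P.good i z"
  shows "0 < (l(V (5 * i + 2) := 1, V (5 * i + 3) := 1, V (5 * i + 5) := 0)) (V z) \<longleftrightarrow> P.good (i + 1) z"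
proof -
  define w where "w = z mod int m"
  have w: "0 \<le> w" "w < int m" unfolding w_def using m6 by simp_all
  \<comment> \<open>A further segment follows, so the indices up to \<open>5 * i + 5\<close> do not
    wrap around.\<close>
  have b: "5 * i + 5 < int m" using assms P.nk(1) by linarith
  have V: "V z = V (5 * i + c) \<longleftrightarrow> w = 5 * i + c" if "0 \<le> c" "c \<le> 5" for c
  proof -
    have "(5 * i + c) mod int m = 5 * i + c" using that b assms(1) by (intro mod_pos_pos_trivial) auto
    then show ?thesis unfolding V_eq w_def by simp
  qed
  have "0 < (l(V (5 * i + 2) := 1, V (5 * i + 3) := 1, V (5 * i + 5) := 0)) (V z) \<longleftrightarrow>
      w \<noteq> 5 * i + 5 \<and> (w = 5 * i + 3 \<or> w = 5 * i + 2 \<or> P.good i z)"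
    using V[of 2] V[of 3] V[of 5] assms(3)[of z] by simp
  also have "\<dots> \<longleftrightarrow> P.good (i + 1) z"
    unfolding P.good_def w_def[symmetric] Let_def by (rule good_arith[OF w(1) assms(1)])
  finally show ?thesis .
qed

definition marks :: "nat \<Rightarrow> nat \<Rightarrow> nat" where
  "marks i v = of_bool (\<exists>j\<in>{1..i}. v = V (5 * int j))"

lemma marks_Suc: "(marks i)(V (5 * int i + 5) := 1) = marks (Suc i)"
proof
  fix v
  have "{1..Suc i} = insert (Suc i) {1..i}" "5 * int i + 5 = 5 * int (Suc i)" by auto
  then show "((marks i)(V (5 * int i + 5) := 1)) v = marks (Suc i) v" unfolding marks_def by (simp add: add.commute[of _ "5 * int i"])
qed

text \<open>The first segment has no earlier candidates, so only multiples of 5 are good for it; the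
  last of them denotes vertex 0 exactly if there is no remainder.\<close>

lemma marks_good: "0 < marks K (V z) \<longleftrightarrow> P.good 0 z"
proof -
  define w where "w = z mod int m"
  have w: "0 \<le> w" "w < int m" unfolding w_def using m6 by simp_all
  have le: "5 * int j < int m \<or> j = K \<and> P.r = 0 \<and> 5 * int j = int m" if "j \<le> K" for j
    using that K(2,3) by linarith
  have V: "V z = V (5 * int j) \<longleftrightarrow> w = (if 5 * int j < int m then 5 * int j else 0)" if "j \<le> K" for j
    using le[OF that] unfolding V_eq w_def by auto
  have "0 < marks K (V z) \<longleftrightarrow> (\<exists>j\<in>{1..K}. w = (if 5 * int j < int m then 5 * int j else 0))"
    unfolding marks_def using V by auto
  also have "\<dots> \<longleftrightarrow> w mod 5 = 0 \<and> 0 < w \<and> w \<le> 5 * P.k \<or> w = 0 \<and> P.r = 0"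
  proof
    assume "\<exists>j\<in>{1..K}. w = (if 5 * int j < int m then 5 * int j else 0)"
    then obtain j where j: "1 \<le> j" "j \<le> K" "w = (if 5 * int j < int m then 5 * int j else 0)" by auto
    then show "w mod 5 = 0 \<and> 0 < w \<and> w \<le> 5 * P.k \<or> w = 0 \<and> P.r = 0"
      using le[OF j(2)] K(1) by (auto split: if_splits)
  next
    assume "w mod 5 = 0 \<and> 0 < w \<and> w \<le> 5 * P.k \<or> w = 0 \<and> P.r = 0"
    then show "\<exists>j\<in>{1..K}. w = (if 5 * int j < int m then 5 * int j else 0)"
    proof
      assume a: "w mod 5 = 0 \<and> 0 < w \<and> w \<le> 5 * P.k"
      then have "w = 5 * (w div 5)" by presburger
      then obtain q where "w = 5 * q" by blast
      then show ?thesis using a K(1) w by (intro bexI[of _ "nat q"]) auto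
    next
      assume a: "w = 0 \<and> P.r = 0"
      then show ?thesis using K m6 by (intro bexI[of _ K]) auto
    qed
  qed
  also have "\<dots> \<longleftrightarrow> P.good 0 z" unfolding P.good_def w_def[symmetric] Let_def using w by auto
  finally show ?thesis .
qed

lemma mark_sems:
  "r 40 = V j \<Longrightarrow> sems nbrs mark_block (r, l, out) = (r(40 := V (j + 5), 0 := r 0 - 5), l(V (j + 5) := 1), out)"
  unfolding mark_block_def by (simp add: add.commute[of _ j])

lemma mark_loop:
  assumes "r 29 = 4"
  shows "R.reach (WhileLess (29 + 10) (0 + 10) (block mark_block)) (72 * K + 1)
    (r(40 := V 0, 0 := m), (\<lambda>_. 0), out) (r(40 := V (5 * int K), 0 := m - 5 * K), marks K, out)"
proof -
  define \<sigma> where "\<sigma> i = (r(40 := V (5 * int i), 0 := m - 5 * i), marks i, out)" for i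
  have W: "Suc 0 \<le> W" "5 \<le> W" using W_le(1)[of 1] W_le(1)[of 5] by simp_all
  have step: "R.reach (block mark_block) 71 (\<sigma> i) (\<sigma> (Suc i))" if "i < K" for i
  proof (rule R.reach_block_le)
    show "defineds nbrs W mark_block (\<sigma> i)" unfolding mark_block_def \<sigma>_def by (simp add: W)
    show "costs nbrs mark_block (\<sigma> i) \<le> 71" unfolding mark_block_def \<sigma>_def by simp
    have e: "5 * int (Suc i) = 5 * int i + 5" "m - 5 * Suc i = m - 5 * i - 5" by simp_all
    show "sems nbrs mark_block (\<sigma> i) = \<sigma> (Suc i)"
      unfolding \<sigma>_def marks_Suc[symmetric] e
      by (subst mark_sems[where j = "5 * int i"]) (simp_all add: fun_upd_twist del: diff_diff_left)
  qed
  have "R.reach (WhileLess (29 + 10) (0 + 10) (block mark_block)) ((\<Sum>i<K. 71 + 1) + 1) (\<sigma> 0) (\<sigma> K)"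
    using step assms K(3) by (intro R.reach_While) (auto simp: \<sigma>_def)
  moreover have "marks 0 = (\<lambda>_. 0)" unfolding marks_def by auto
  ultimately show ?thesis unfolding \<sigma>_def by (simp add: mult.commute)
qed

lemma segment_loop:
  assumes r: "r 0 = m" "r 40 = V 0" "r 10 = 0" "r 11 = V (- 3)" "r 12 = 1" "r 29 = 4"
  obtains r' l' where "R.reach (WhileLess (29 + 10) (0 + 10) (block segment_block)) (600 * m) (r, marks K, [])
      (r', l', outputs K)" "r' 0 = m mod 5" "r' 40 = V (5 * int K)"
proof -
  define \<sigma> where "\<sigma> i = (sems nbrs segment_block ^^ i) (r, marks K, [])" for i
  \<comment> \<open>The marks are described only while a segment remains to be processed: after the
    last one, the unmarked index \<open>5 * i\<close> may have wrapped around to 0.\<close>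
  define I where "I i = (\<exists>r l. \<sigma> i = (r, l, outputs i) \<and> r 0 = m - 5 * i \<and> r 40 = V (5 * int i) \<and>
    r 10 = of_bool (0 < int i \<and> P.flag (int i - 1)) \<and> (r 11 = V (5 * int i - 3)) \<and> r 12 = of_bool (int i = 0) \<and>
    r 29 = 4 \<and> (i < K \<longrightarrow> (\<forall>z. 0 < l (V z) \<longleftrightarrow> P.good (int i) z)))" for i
  have step: "I (Suc i) \<and> defineds nbrs W segment_block (\<sigma> i) \<and>
      costs nbrs segment_block (\<sigma> i) \<le> 420 + 24 * (D (5 * i) + D (5 * i + 3))" if "I i" "i < K" for i
  proof -
    obtain r l where s: "\<sigma> i = (r, l, outputs i)" and r: "r 0 = m - 5 * i" "r 40 = V (5 * int i)"
      "r 10 = of_bool (0 < int i \<and> P.flag (int i - 1))" "r 11 = V (5 * int i - 3)" "r 12 = of_bool (int i = 0)" "r 29 = 4"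
      and l: "\<And>z. 0 < l (V z) \<longleftrightarrow> P.good (int i) z"
      using \<open>I i\<close> \<open>i < K\<close> unfolding I_def by blast
    have out: "length (outputs i) + 1 < m" unfolding length_outputs using \<open>i < K\<close> K(3) by linarith
    have ik: "0 \<le> int i" "int i < P.k" "r 0 \<le> m" using \<open>i < K\<close> K(1) r(1) by simp_all
    obtain r' where r': "sems nbrs segment_block (r, l, outputs i) =
      (r', l(V (5 * int i + 2) := 1, V (5 * int i + 3) := 1, V (5 * int i + 5) := 0), outputs i @ [anchor (int i), chosen (int i)])"
      "r' 0 = r 0 - 5" "r' 40 = V (5 * int i + 5)" "r' 10 = of_bool (P.flag (int i))" "r' 11 = V (5 * int i + 2)"
      "r' 12 = 0" "r' 29 = r 29" and dc: "defineds nbrs W segment_block (r, l, outputs i)"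
      "costs nbrs segment_block (r, l, outputs i) \<le>
        420 + 24 * (length (nbrs ! V (5 * int i)) + length (nbrs ! V (5 * int i + 3)))"
      by (rule segment[OF ik r(2-5) l out])
    define l' where "l' = l(V (5 * int i + 2) := 1, V (5 * int i + 3) := 1, V (5 * int i + 5) := 0)"
    have s': "\<sigma> (Suc i) = (r', l', outputs (Suc i))"
      using r'(1) s unfolding \<sigma>_def outputs_Suc l'_def by simp
    have g: "0 < l' (V z) \<longleftrightarrow> P.good (int (Suc i)) z" if "Suc i < K" for z
      using good_step[of "int i" l z] l that K(1) unfolding l'_def by (simp add: add.commute[of 1])
    have v: "V (5 * int i + 5 - 3) = V (5 * int i + 2)" by (rule arg_cong) simp
    have e: "5 * int (Suc i) = 5 * int i + 5" "int (Suc i) - 1 = int i"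
      "m - 5 * Suc i = m - 5 * i - 5" by simp_all
    have "I (Suc i)" unfolding I_def e s'
      by (rule exI[of _ r'], rule exI[of _ l']) (use r'(2-4,6-7) r'(5)[folded v] r g in simp)
    moreover have "length (nbrs ! V (5 * int i)) = D (5 * i)" "length (nbrs ! V (5 * int i + 3)) = D (5 * i + 3)"
      unfolding D_def by (simp_all add: add.commute)
    ultimately show ?thesis using dc s by simp
  qed
  have I: "I i" if "i \<le> K" for i
    using that
  proof (induction i)
    case 0
    show ?case unfolding I_def by (rule exI[of _ r], rule exI[of _ "marks K"]) (simp add: \<sigma>_def outputs_def r marks_good)
  next
    case (Suc i)
    then show ?case using step by simp
  qed
  have "R.reach (WhileLess (29 + 10) (0 + 10) (block segment_block))
    ((\<Sum>i<K. 420 + 24 * (D (5 * i) + D (5 * i + 3)) + 1) + 1) (\<sigma> 0) (\<sigma> K)"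
  proof (rule R.reach_While)
    have test: "fst (\<sigma> i) 29 = 4" "fst (\<sigma> i) 0 = m - 5 * i" if i: "i \<le> K" for i
    proof -
      obtain r l where "\<sigma> i = (r, l, outputs i)" "r 0 = m - 5 * i" "r 29 = 4" using I[OF i] unfolding I_def by blast
      then show "fst (\<sigma> i) 29 = 4" "fst (\<sigma> i) 0 = m - 5 * i" by simp_all
    qed
    show "fst (\<sigma> i) 29 < fst (\<sigma> i) 0" if "i < K" for i using test[of i] that K(3) by simp
    show "\<not> fst (\<sigma> K) 29 < fst (\<sigma> K) 0" using test[of K] K(3) by simp
    show "R.reach (block segment_block) (420 + 24 * (D (5 * i) + D (5 * i + 3))) (\<sigma> i) (\<sigma> (Suc i))" if i: "i < K" for i
    proof (rule R.reach_block_le)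
      show "defineds nbrs W segment_block (\<sigma> i)"
        "costs nbrs segment_block (\<sigma> i) \<le> 420 + 24 * (D (5 * i) + D (5 * i + 3))"
        using step[of i] I[of i] i by simp_all
      show "sems nbrs segment_block (\<sigma> i) = \<sigma> (Suc i)" unfolding \<sigma>_def by simp
    qed
  qed
  \<comment> \<open>There are at most \<open>m / 5\<close> segments at 421 units each, and scanning
    costs at most 24 times the total degree \<open>4 * m\<close>.\<close>
  moreover have "(\<Sum>i<K. 420 + 24 * (D (5 * i) + D (5 * i + 3)) + 1) + 1 \<le> 600 * m"
  proof -
    have "(\<Sum>i<5 * K. D i) \<le> (\<Sum>i<m. D i)" using K(3) by (intro sum_mono2) auto
    then have "(\<Sum>i<K. D (5 * i) + D (5 * i + 3)) \<le> 4 * m" using sum_D_segments[of K] sum_D by linarith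
    moreover have "(\<Sum>i<K. 420 + 24 * (D (5 * i) + D (5 * i + 3)) + 1) = 421 * K + 24 * (\<Sum>i<K. D (5 * i) + D (5 * i + 3))"
      unfolding sum_distrib_left by (simp add: sum.distrib)
    ultimately show ?thesis using K(3) m6 by linarith
  qed
  ultimately have R: "R.reach (WhileLess (29 + 10) (0 + 10) (block segment_block)) (600 * m) (\<sigma> 0) (\<sigma> K)"
    using R.reach_le by blast
  obtain r' l' where "\<sigma> K = (r', l', outputs K)" "r' 0 = m - 5 * K" "r' 40 = V (5 * int K)"
    using I[of K] unfolding I_def by blast
  moreover have "m - 5 * K = m mod 5" using K(3) by linarith
  ultimately show thesis using that R unfolding \<sigma>_def by simp
qed

lemma tail_run:
  assumes "r 0 = m mod 5" "r 40 = V (5 * int K)"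
  shows "\<exists>r' out. R.reach tail_prog 100 (r, l, outputs K) (r', l, out) \<and> set out = V ` P.landmarks"
proof -
  let ?o1 = "outputs K @ (if 0 < m mod 5 then [V (5 * int K)] else [])"
  let ?o2 = "?o1 @ (if 2 < m mod 5 then [V (5 * int K + 2)] else [])"
  let ?r = "r(28 := 0)" and ?q = "r(28 := 2)"
  let ?q' = "if 2 < m mod 5 then ?q(40 := V (5 * int K + 2)) else ?q"
  have len: "length (outputs K) + m mod 5 \<le> m" "m mod 5 \<le> 4" unfolding length_outputs using K(3) by linarith+
  have len1: "length ?o1 < m" if "2 < m mod 5" using len that by (simp add: length_outputs)
  have a: "R.reach (block [Const 28 0]) 11 (r, l, outputs K) (?r, l, outputs K)"
    by (rule R.reach_block_le) simp_all
  have b: "R.reach (IfLess (28 + 10) (0 + 10) (block [Out 40]) Skip) (11 + 1) (?r, l, outputs K) (?r, l, ?o1)"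
  proof (rule R.reach_If)
    assume "fst (?r, l, outputs K) 28 < fst (?r, l, outputs K) 0"
    then show "R.reach (block [Out 40]) 11 (?r, l, outputs K) (?r, l, ?o1)"
      using len assms by (intro R.reach_block_le) simp_all
  next
    assume "\<not> fst (?r, l, outputs K) 28 < fst (?r, l, outputs K) 0"
    then have "(?r, l, ?o1) = (?r, l, outputs K)" using assms by simp
    then show "R.reach Skip 11 (?r, l, outputs K) (?r, l, ?o1)" using R.reach_le[OF R.reach_Skip, of 11] by simp
  qed
  have c: "R.reach (block [Const 28 2]) 11 (?r, l, ?o1) (?q, l, ?o1)"
    using W_le(1)[of 2] by (intro R.reach_block_le) simp_all
  have d: "R.reach (IfLess (28 + 10) (0 + 10) (block [First 40 40, First 40 40, Out 40]) Skip) (31 + 1) (?q, l, ?o1) (?q', l, ?o2)"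
  proof (rule R.reach_If)
    assume "fst (?q, l, ?o1) 28 < fst (?q, l, ?o1) 0"
    then have t: "2 < m mod 5" using assms by simp
    show "R.reach (block [First 40 40, First 40 40, Out 40]) 31 (?q, l, ?o1) (?q', l, ?o2)"
    proof (rule R.reach_block_le)
      show "defineds nbrs W [First 40 40, First 40 40, Out 40] (?q, l, ?o1)" using len1[OF t] assms by simp
      show "sems nbrs [First 40 40, First 40 40, Out 40] (?q, l, ?o1) = (?q', l, ?o2)"
        using t assms by (simp add: add.commute[of _ "5 * int K"])
    qed simp
  next
    assume "\<not> fst (?q, l, ?o1) 28 < fst (?q, l, ?o1) 0"
    then have "(?q', l, ?o2) = (?q, l, ?o1)" using assms by simp
    then show "R.reach Skip 31 (?q, l, ?o1) (?q', l, ?o2)" using R.reach_le[OF R.reach_Skip, of 31] by simp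
  qed
  have "R.reach tail_prog (11 + (11 + 1) + (11 + (31 + 1))) (r, l, outputs K) (?q', l, ?o2)"
    unfolding tail_prog_def by (intro R.reach_Seq[OF R.reach_Seq[OF a b] R.reach_Seq[OF c d]])
  then have "R.reach tail_prog 100 (r, l, outputs K) (?q', l, ?o2)" by (rule R.reach_le) simp
  moreover have "set ?o2 = V ` P.landmarks" unfolding set_outputs[symmetric] by auto
  ultimately show ?thesis by blast
qed

lemma large_run:
  assumes "r 0 = m" "r 40 = V 0"
  shows "\<exists>r' l' out. R.reach large_prog (900 * m) (r, (\<lambda>_. 0), []) (r', l', out) \<and> set out = V ` P.landmarks"
proof -
  have W: "Suc 0 \<le> W" "4 \<le> W" using W_le(1)[of 1] W_le(1)[of 4] by simp_all
  let ?r1 = "r(33 := m, 27 := V 0, 29 := 4)"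
  let ?r2 = "?r1(40 := V (5 * int K), 0 := m - 5 * K)"
  let ?r3 = "?r2(0 := m, 40 := V 0, 10 := 0, 11 := V (- 3), 12 := 1)"
  have e: "?r1(40 := V 0, 0 := m) = ?r1" using assms by (auto simp: fun_eq_iff)
  have a: "R.reach (block [Sel 33 0 0 0, Sel 27 40 40 40, Const 29 4]) 31 (r, (\<lambda>_. 0), []) (?r1, (\<lambda>_. 0), [])"
    using assms W W_le by (intro R.reach_block_le) simp_all
  have b: "R.reach (WhileLess (29 + 10) (0 + 10) (block mark_block)) (72 * K + 1) (?r1, (\<lambda>_. 0), []) (?r2, marks K, [])"
    using mark_loop[of ?r1 "[]"] unfolding e by simp
  have c: "R.reach (block [Sel 0 33 33 33, Sel 40 27 27 27, Const 10 0, Last 11 40, Last 11 11, Last 11 11, Const 12 1]) 71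
      (?r2, marks K, []) (?r3, marks K, [])"
    using W W_le by (intro R.reach_block_le) simp_all
  have r3: "?r3 0 = m" "?r3 40 = V 0" "?r3 10 = 0" "?r3 11 = V (- 3)" "?r3 12 = 1" "?r3 29 = 4" by simp_all
  obtain r' l' where d: "R.reach (WhileLess (29 + 10) (0 + 10) (block segment_block)) (600 * m) (?r3, marks K, [])
      (r', l', outputs K)" "r' 0 = m mod 5" "r' 40 = V (5 * int K)"
    by (rule segment_loop[OF r3])
  obtain r'' out where f: "R.reach tail_prog 100 (r', l', outputs K) (r'', l', out)" "set out = V ` P.landmarks"
    using tail_run[OF d(2,3)] by blast
  have "R.reach large_prog (31 + (72 * K + 1 + (71 + (600 * m + 100)))) (r, (\<lambda>_. 0), []) (r'', l', out)"
    unfolding large_prog_def by (intro R.reach_Seq[OF a R.reach_Seq[OF b R.reach_Seq[OF c R.reach_Seq[OF d(1) f(1)]]]])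
  then have "R.reach large_prog (900 * m) (r, (\<lambda>_. 0), []) (r'', l', out)"
    by (rule R.reach_le) (use K(3) m6 in linarith)
  then show ?thesis using f(2) by blast
qed

end

theorem (in rotation) solver_prog_correct:
  assumes "2000 * m \<le> W"
  shows "\<exists>t s. exec W solver_prog (initial_state (encode_adj nbrs)) t s \<and> t \<le> 2000 * m \<and>
    resolving_set {..<m} E (output_set s) \<and> int (card (output_set s)) = \<lceil>2 * real m / 5\<rceil>"
proof -
  interpret R: ram_input nbrs m W
    using nbrs(1) m3 nbrs_less total_degree assms by unfold_locales auto
  define Q where "Q v \<longleftrightarrow> v < m \<and> length (nbrs ! v) \<le> 2" for v
  have "\<exists>v. Q v"
  proof (rule ear_exists)
    fix p assume "\<And>y. adj p y \<Longrightarrow> y mod int m = (p - 1) mod int m \<or> y mod int m = (p + 1) mod int m"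
    then have "Q (vert p)" unfolding Q_def degree_two using vert_less by blast
    then show "\<exists>v. Q v" by blast
  qed
  then have QN: "Q (LEAST v. Q v)" by (rule LeastI_ex)
  define N where "N = (LEAST v. Q v)"
  have N: "N < m" "length (nbrs ! N) \<le> 2" using QN unfolding N_def Q_def by blast+
  have before: "2 < length (nbrs ! v)" if "v < N" for v
  proof -
    have "\<not> Q v" using not_less_Least[of v Q] that unfolding N_def by blast
    then show ?thesis using that N(1) unfolding Q_def by simp
  qed
  \<comment> \<open>Labels are unrelated to boundary positions; \<open>q\<close> is the position of
    the ear found, and position \<open>q - 2\<close> becomes index 0.\<close>
  obtain q where q: "N = vert q" using vert_surj[of N 0] N(1) by auto
  interpret S: solver m E xs nbrs W "q - 2"
  proof
    fix y assume "adj (q - 2 + 2) y"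
    then show "y mod int m = (q - 2 + 1) mod int m \<or> y mod int m = (q - 2 + 3) mod int m"
      using N(2)[unfolded q degree_two] by (simp add: add.commute)
  qed
  have VN: "N = S.V 2" unfolding S.V_def q by simp
  have W: "2 \<le> W" "5 \<le> W" "m \<le> W" using S.W_le(1)[of 2] S.W_le(1)[of 5] S.W_le(2) by simp_all
  define \<sigma> :: "nat \<Rightarrow> astate" where
    "\<sigma> i = ((\<lambda>_. 0)(0 := m, 32 := 2, 30 := i, 31 := length (nbrs ! i)), (\<lambda>_. 0), [])" for i
  let ?a = "((\<lambda>_. 0)(0 := m), (\<lambda>_. 0), []) :: astate"
  have start: "R.reach (block [Const 32 2, Const 30 0, Degree 31 30]) 31 ?a (\<sigma> 0)"
    using W m3 nbrs(1) by (intro R.reach_block_le) (simp_all add: \<sigma>_def)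
  have loop: "R.reach (WhileLess (32 + 10) (31 + 10) (block [Inc 30, Degree 31 30])) ((\<Sum>i<N. 21 + 1) + 1) (\<sigma> 0) (\<sigma> N)"
  proof (rule R.reach_While)
    show "fst (\<sigma> i) 32 < fst (\<sigma> i) 31" if "i < N" for i using before[OF that] unfolding \<sigma>_def by simp
    show "\<not> fst (\<sigma> N) 32 < fst (\<sigma> N) 31" using N(2) unfolding \<sigma>_def by simp
    show "R.reach (block [Inc 30, Degree 31 30]) 21 (\<sigma> i) (\<sigma> (Suc i))" if "i < N" for i
      using that N(1) W nbrs(1) by (intro R.reach_block_le) (auto simp: \<sigma>_def fun_eq_iff)
  qed
  let ?r = "(fst (\<sigma> N))(40 := S.V 0, 28 := 5)"
  have "nbrs ! N = nbrs ! S.V 2" using VN by simp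
  then have go: "R.reach (block [Last 40 30, Last 40 40, Const 28 5]) 31 (\<sigma> N) (?r, (\<lambda>_. 0), [])"
    using W N(1) nbrs(1) by (intro R.reach_block_le) (simp_all add: \<sigma>_def)
  have "\<exists>r l out. R.reach (IfLess (28 + 10) (0 + 10) large_prog (block [Out 40, Last 40 40, Out 40])) (900 * m + 1)
      (?r, (\<lambda>_. 0), []) (r, l, out) \<and> set out = S.V ` solution (int m) S.e"
  proof (cases "m \<le> 5")
    case True
    have "R.reach (block [Out 40, Last 40 40, Out 40]) (900 * m) (?r, (\<lambda>_. 0), []) (?r(40 := S.V (- 1)), (\<lambda>_. 0), [S.V 0, S.V (- 1)])"
      using m3 nbrs(1) by (intro R.reach_block_le) simp_all
    then have "R.reach (IfLess (28 + 10) (0 + 10) large_prog (block [Out 40, Last 40 40, Out 40])) (900 * m + 1)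
      (?r, (\<lambda>_. 0), []) (?r(40 := S.V (- 1)), (\<lambda>_. 0), [S.V 0, S.V (- 1)])"
      using True by (intro R.reach_If) (simp_all add: \<sigma>_def)
    then show ?thesis using S.small_solution[OF True] by (intro exI conjI) auto
  next
    case False
    interpret L: large_solver m E xs nbrs W "q - 2" using False by unfold_locales simp
    obtain r l out where L: "R.reach large_prog (900 * m) (?r, (\<lambda>_. 0), []) (r, l, out)" "set out = S.V ` L.P.landmarks"
      using L.large_run[of ?r] by (auto simp: \<sigma>_def)
    then have "R.reach (IfLess (28 + 10) (0 + 10) large_prog (block [Out 40, Last 40 40, Out 40])) (900 * m + 1)
      (?r, (\<lambda>_. 0), []) (r, l, out)"
      using False by (intro R.reach_If) (simp_all add: \<sigma>_def)
    moreover have "solution (int m) S.e = L.P.landmarks" using False unfolding solution_def by simp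
    ultimately show ?thesis using L(2) by auto
  qed
  then obtain r l out where fin: "R.reach (IfLess (28 + 10) (0 + 10) large_prog (block [Out 40, Last 40 40, Out 40])) (900 * m + 1)
      (?r, (\<lambda>_. 0), []) (r, l, out)" "set out = S.V ` solution (int m) S.e" by blast
  \<comment> \<open>The search takes 22 units per vertex tried and the main branch
    \<open>900 * m + 1\<close>; the rest is constant, so \<open>2000 * m\<close> is a generous
    bound.\<close>
  note body = R.reach_Seq[OF start R.reach_Seq[OF loop R.reach_Seq[OF go fin(1)]]]
  have "run W solver_prog (initial_state (encode_adj nbrs)) (\<lambda>t s. t \<le> 2000 * m \<and> R.sim s (r, l, out))"
    unfolding solver_prog_def
  proof (rule run_Seq, rule run_mono[OF R.setup_sim])
    fix t :: nat and s assume t: "t \<le> 7 \<and> R.sim s ?a"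
    then show "run W (Seq (block [Const 32 2, Const 30 0, Degree 31 30])
      (Seq (WhileLess (32 + 10) (31 + 10) (block [Inc 30, Degree 31 30]))
      (Seq (block [Last 40 30, Last 40 40, Const 28 5])
        (IfLess (28 + 10) (0 + 10) large_prog (block [Out 40, Last 40 40, Out 40]))))) s
      (\<lambda>t' s'. t + t' \<le> 2000 * m \<and> R.sim s' (r, l, out))"
    proof -
      have "R.sim s ?a" using t by simp
      then show ?thesis
        by (intro run_mono[OF body[unfolded R.reach_def, rule_format]]) (use N(1) m3 t in auto)
    qed
  qed
  then obtain t s where ex: "exec W solver_prog (initial_state (encode_adj nbrs)) t s" "t \<le> 2000 * m" "R.sim s (r, l, out)"
    unfolding run_def by blast
  have "output_set s = (\<lambda>i. vert (i + (q - 2))) ` solution (int m) S.e"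
    using R.sim_output[OF ex(3)] fin(2) unfolding S.V_def by simp
  then show ?thesis using ex(1,2) S.solution(2,3) by (intro exI[of _ t] exI[of _ s]) simp
qed

text \<open>Here the given embedding supplies the crossing-free order. Reading its indices modulo
  \<open>n\<close> turns the list at a corner into the list at any integer position.\<close>

lemma rotation_system_rotation:
  assumes "3 \<le> n" "maximal_outerplanar {..<n} E" "rotation_system n E nbrs"
  shows "\<exists>xs. rotation n E xs nbrs"
proof -
  obtain h where h: "bij_betw h {..<n} {..<n}"
    "\<And>i k j l. i < k \<Longrightarrow> k < j \<Longrightarrow> j < l \<Longrightarrow> l < n \<Longrightarrow> \<not> ({h i, h j} \<in> E \<and> {h k, h l} \<in> E)"
    and len: "length nbrs = n"
    and a: "\<And>i. i < n \<Longrightarrow> nbrs ! h i =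
      map (\<lambda>k. h ((i + k) mod n)) (filter (\<lambda>k. {h i, h ((i + k) mod n)} \<in> E) [1..<n])"
    using assms(3) unfolding rotation_system_def convex_embedding_def by blast
  interpret boundary_order "{..<n}" E "map h [0..<n]" "int n"
  proof
    show "maximal_outerplanar {..<n} E" by (rule assms(2))
    show "distinct (map h [0..<n])" "set (map h [0..<n]) = {..<n}"
      using h(1) unfolding bij_betw_def by (auto simp: distinct_map atLeast0LessThan)
    show "noncrossing E (map h [0..<n])" unfolding noncrossing_def using h(2) by auto
    show "int n = int (length (map h [0..<n]))" "3 \<le> int n" using assms(1) by simp_all
  qed
  have "nbrs ! vert i = map (\<lambda>k. vert (i + int k)) (filter (\<lambda>k. adj i (i + int k)) [1..<n])" for i
  proof -
    define b where "b = nat (i mod int n)"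
    have b: "b < n" "int b = i mod int n" unfolding b_def using assms(1) by (simp_all add: nat_less_iff)
    have v: "vert (i + int k) = h ((b + k) mod n)" for k
    proof -
      have "(i + int k) mod int n = int ((b + k) mod n)" unfolding zmod_int of_nat_add b(2) by (simp add: mod_simps)
      then show ?thesis unfolding vert_def using assms(1) by simp
    qed
    have "vert i = h b" using v[of 0] b(1) by simp
    then show ?thesis unfolding adj_def v using a[OF b(1)] by simp
  qed
  then have "rotation n E (map h [0..<n]) nbrs" using len by unfold_locales
  then show ?thesis by blast
qed

theorem theorem9:
  shows "(\<forall>(V :: 'a set) E. maximal_outerplanar V E \<and> card V \<ge> 3 \<longrightarrow>
            (\<exists>S. S \<subseteq> V \<and> resolving_set V E S \<and> int (card S) = \<lceil>2 * real (card V) / 5\<rceil>))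
       \<and> (\<exists>(prog :: cmd) (C :: nat). \<forall>n E adj.
            n \<ge> 3 \<and> maximal_outerplanar {..<n} E \<and> rotation_system n E adj \<longrightarrow>
            (\<exists>t s. exec (C * n) prog (initial_state (encode_adj adj)) t s \<and> t \<le> C * n \<and>
               resolving_set {..<n} E (output_set s) \<and>
               int (card (output_set s)) = \<lceil>2 * real n / 5\<rceil>))"
proof (rule conjI)
  show "\<forall>(V :: 'a set) E. maximal_outerplanar V E \<and> card V \<ge> 3 \<longrightarrow>
      (\<exists>S. S \<subseteq> V \<and> resolving_set V E S \<and> int (card S) = \<lceil>2 * real (card V) / 5\<rceil>)"
    using resolving_set_exists by blast
  show "\<exists>(prog :: cmd) (C :: nat). \<forall>n E adj.
      n \<ge> 3 \<and> maximal_outerplanar {..<n} E \<and> rotation_system n E adj \<longrightarrow>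
      (\<exists>t s. exec (C * n) prog (initial_state (encode_adj adj)) t s \<and> t \<le> C * n \<and>
         resolving_set {..<n} E (output_set s) \<and> int (card (output_set s)) = \<lceil>2 * real n / 5\<rceil>)"
  proof (rule exI[of _ solver_prog], rule exI[of _ 2000], intro allI impI)
    fix n E and adj :: "nat list list"
    assume "n \<ge> 3 \<and> maximal_outerplanar {..<n} E \<and> rotation_system n E adj"
    then obtain xs where "rotation n E xs adj" using rotation_system_rotation by blast
    then show "\<exists>t s. exec (2000 * n) solver_prog (initial_state (encode_adj adj)) t s \<and> t \<le> 2000 * n \<and>
         resolving_set {..<n} E (output_set s) \<and> int (card (output_set s)) = \<lceil>2 * real n / 5\<rceil>"
      by (rule rotation.solver_prog_correct) simp
  qed
qed

end
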